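(* For each $i\in\mathcal N$ let $\mathcal X_i\subset\mathbb R^{m_i}$ be a closed and compact convex set and let $r_i$ be its indicator function ($0$ on $\mathcal X_i$, $+\infty$ elsewhere). Assume the following for every $i\in\mathcal N$. (1) For every fixed $x_{-i}\in\prod_{j\ne i}\mathcal X_j$ the map $x_i\mapsto f_i(x_i,h_i(x_i)+\sigma(x_{-i}))$ is convex on $\mathcal X_i$; and $f_i$ is continuously differentiable in $(x_i,\sigma)$ on an open set containing $\mathcal X_i\times\mathbb R^m$. (2) $\phi$ is Lipschitz continuous and monotone on $\mathcal X=\prod_{i=1}^N\mathcal X_i$. (3) $h_i$ is $L_{hi}$-Lipschitz on $\mathcal X_i$; and for every $c_z>0$ there is a constant $L_{fi}$ (possibly depending on $c_z$) such that $\|F_i(x_i,z_1)-F_i(x_i,z_2)\|\le L_{fi}\|z_1-z_2\|$ for all $x_i\in\mathcal X_i$ and all $z_1,z_2\in\mathbb R^m$ with $\|z_1\|,\|z_2\|\le c_z$. (4) $\psi_i(\cdot,\cdot;\xi_i)$ is differentiable on $\mathcal C_i\times\mathbb R^m$ for every fixed $\xi_i\in\mathbb R^{d_i}$, where $\mathcal C_i$ is an open set containing $\mathcal X_i$; and for all $x_i\in\mathcal X_i$, $z_i\in\mathbb R^m$, $\mathbb E[q_i(x_i,z_i;\xi_i)\mid x_i]=F_i(x_i,z_i)$ and $\mathbb E[\|q_i(x_i,z_i;\xi_i)-F_i(x_i,z_i)\|^2\mid x_i]\le\upsilon_i^2$ for some $\upsilon_i>0$. (5) $W_k$ is doubly stochastic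 for all $k\ge0$; there is $\varsigma\in(0,1)$ with $\omega_{ij,k}\ge\varsigma$ for all $k\ge 0$, $i\in\mathcal N$, $j\in\mathcal N_{i,k}$; and there is a positive integer $P$ such that the graph $(\mathcal N,\bigcup_{l=1}^P\mathcal E_{k+l})$ is strongly connected for every $k\ge0$. Let $\beta=\big(1-\frac{\varsigma}{4N^2}\big)^{1/P}\in(0,1)$. For each $i$ set $\alpha_{i,k}=(k+\lambda_i)^{-(1/2+\tau)}$ and $\eta_{i,k}=(k+\delta_i)^{-(1/2-2\tau)}$ for some $\lambda_i>0,\delta_i>0$, with $0<\tau<1/4$. Let $\hat x_K$ be the averaged sequence of the algorithm described in the context. Then $$\mathbb E[G(\hat x_K)]=\mathcal O\big(NK^{-(0.5-2\tau)}\big)+\mathcal O\big(N^5\beta^{-1}(1-\beta)^{-2}K^{-(0.5-\tau)}\big),\qquad\forall K\ge1.$$ In addition, let $\hat x_K$ represent an $\epsilon$-equilibrium, i.e. $\mathbb E[G(\hat x_K)]\le\epsilon$. Then the sample complexity (number of sampled gradients), or equivalently the iteration complexity (number of proximal evaluations), required to compute an $\epsilon$-equilibrium is no smaller than $$\max\Big\{\mathcal O\big((N/\epsilon)^{\frac1{0.5-2\tau}}\big),\ \mathcal O\Big(\big(N^5/(\epsilon\beta(1-\beta)^2)\big)^{\frac1{0.5-\tau}}\Big)\Big\}.$$ One further obtains a simplified sample (or iteration) complexity $\mathcal O\big((1/\epsilon)^{2+\tilde\varepsilon}\big)$ for some $\tilde\varepsilon>0$ when the impact of $N$ and of the network connectivity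 parameter $\beta$ is neglected.
   Context: Game. There are $N$ players, $\mathcal N=\{1,\dots,N\}$; player $i$ controls $x_i\in\mathbb R^{m_i}$, $m=\sum_i m_i$, $x=(x_1,\dots,x_N)$, $x_{-i}=(x_j)_{j\ne i}$. The functions $h_j:\mathbb R^{m_j}\to\mathbb R^m$ are continuously differentiable, $\sigma(x)=\sum_{j=1}^N h_j(x_j)$ and $\sigma(x_{-i})=\sum_{j\ne i}h_j(x_j)$. Given $x_{-i}$, player $i$ minimizes $f_i(x_i,h_i(x_i)+\sigma(x_{-i}))+r_i(x_i)$ over $x_i$, where $f_i(x_i,s)=\mathbb E[\psi_i(x_i,s;\xi_i)]$, $\xi_i$ is an $\mathbb R^{d_i}$-valued random variable and $\psi_i:\mathbb R^{m_i}\times\mathbb R^m\times\mathbb R^{d_i}\to\mathbb R$. Maps. $F_i(x_i,z_i)=\big(\nabla_{x_i}f_i(x_i,\sigma)+\nabla h_i(x_i)\nabla_\sigma f_i(x_i,\sigma)\big)\big|_{\sigma=z_i}$ ($\nabla h_i$ is the transposed Jacobian), $\phi_i(x)=F_i(x_i,\sigma(x))$, $\phi=(\phi_1,\dots,\phi_N)$, and $q_i(x_i,z_i;\xi_i)=\big(\nabla_{x_i}\psi_i(x_i,\sigma;\xi_i)+\nabla h_i(x_i)\nabla_\sigma\psi_i(x_i,\sigma;\xi_i)\big)\big|_{\sigma=z_i}$. "Monotone on $\mathcal X$" means $(\phi(x)-\phi(x'))^T(x-x')\ge0$ for all $x,x'\in\mathcal X$. $\|\cdot\|$ is the Euclidean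 norm. Gap function: $G(x)=\sup_{y\in\mathcal X}(x-y)^T\phi(y)$ for $x\in\mathcal X$. Network. At time $k$, players communicate over a digraph $\mathcal G_k=(\mathcal N,\mathcal E_k)$, $(j,i)\in\mathcal E_k$ meaning $i$ receives information from $j$; $\mathcal N_{i,k}=\{j:(j,i)\in\mathcal E_k\}$, and $i\in\mathcal N_{i,k}$. $W_k=[\omega_{ij,k}]$ is the nonnegative matrix with $\omega_{ij,k}>0$ iff $(j,i)\in\mathcal E_k$, and $\omega_{ij,k}=0$ otherwise. Algorithm. Start with $x_{i,0}\in\mathcal X_i$, $v_{i,0}=h_i(x_{i,0})$. For $k=0,1,2,\dots$ and each $i$: $\hat v_{i,k}=\sum_{j\in\mathcal N_{i,k}}\omega_{ij,k}v_{j,k}$; $x_{i,k+1}=\Pi_{\mathcal X_i}\big(x_{i,k}-\alpha_{i,k}(q_i(x_{i,k},N\hat v_{i,k};\xi_{i,k})+\eta_{i,k}x_{i,k})\big)$ with $\Pi_{\mathcal X_i}$ the Euclidean projection (the proximal evaluation for an indicator function); $v_{i,k+1}=\hat v_{i,k}+h_i(x_{i,k+1})-h_i(x_{i,k})$. Each player uses one sampled gradient and one projection per iteration. Here $\xi_{i,k}$ is the random realization of $\xi_i$ at time $k$; with $\zeta_{i,k}=q_i(x_{i,k},N\hat v_{i,k};\xi_{i,k})-F_i(x_{i,k},N\hat v_{i,k})$ and $\mathcal F_k$ the $\sigma$-algebra generated by $x_0$ and $\zeta_{i,l}$, $i\in\mathcal N$, $0\le l\le k-1$, the sampling is such that $\mathbb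 E[\zeta_{i,k}\mid\mathcal F_k]=0$ and $\mathbb E[\|\zeta_{i,k}\|^2\mid\mathcal F_k]\le\upsilon_i^2$ a.s. Averaged sequence: $x_k=(x_{1,k},\dots,x_{N,k})$, $\alpha_{\max,k}=\max_i\alpha_{i,k}$, $\hat x_K=\frac{\sum_{p=0}^{K-1}\alpha_{\max,p}x_p}{\sum_{p=0}^{K-1}\alpha_{\max,p}}$. In the $\mathcal O(\cdot)$ terms the dependence on $K$ (respectively $\epsilon$), on the number of players $N$ and on the network connectivity parameter $\beta$ is displayed explicitly, except in the last, simplified complexity, where the dependence on $N$ and $\beta$ is suppressed.
   Formalization: "No smaller than max{O(.),O(.)}" is stated as sufficiency: every K at least this maximum, for suitable constants, gives an epsilon-equilibrium; as a literal lower bound it fails (one player, a one-point strategy set: the gap is 0 for all K). *)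

theory Defs
  imports "HOL-Probability.Probability"
begin

section \<open>Euclidean spaces of varying dimension inside one type\<close>

text \<open>
  The dimensions of the strategy spaces, of the aggregate and of the samples vary with the player,
  and the hidden constants of the complexity bounds must be chosen before the number of players
  (hence before the dimensions).  Dimensions are therefore values: all vectors live in the
  inner product space of finitely supported real sequences, and the Euclidean space of
  dimension \<open>d\<close> is the subspace \<open>Rn d\<close> of sequences supported in \<open>{..<d}\<close>.
\<close>

typedef fseq = "{f :: nat \<Rightarrow> real. finite {n. f n \<noteq> 0}}"
  morphisms coord Abs_fseq
  by (rule exI[of _ "\<lambda>_. 0"]) simp

setup_lifting type_definition_fseq

lemma fseq_eqI: "(\<And>n. coord x n = coord y n) \<Longrightarrow> x = y"
  by (metis coord_inject ext)

lemma finite_support [simp]: "finite {n. coord x n \<noteq> 0}"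
  using coord[of x] by simp

instantiation fseq :: real_vector
begin

lift_definition zero_fseq :: fseq is "\<lambda>_. 0" by simp

lift_definition plus_fseq :: "fseq \<Rightarrow> fseq \<Rightarrow> fseq" is "\<lambda>f g n. f n + g n"
  subgoal for f g
    by (rule finite_subset[of _ "{n. f n \<noteq> 0} \<union> {n. g n \<noteq> 0}"]) auto
  done

lift_definition uminus_fseq :: "fseq \<Rightarrow> fseq" is "\<lambda>f n. - f n" by simp

lift_definition minus_fseq :: "fseq \<Rightarrow> fseq \<Rightarrow> fseq" is "\<lambda>f g n. f n - g n"
  subgoal for f g
    by (rule finite_subset[of _ "{n. f n \<noteq> 0} \<union> {n. g n \<noteq> 0}"]) auto
  done

lift_definition scaleR_fseq :: "real \<Rightarrow> fseq \<Rightarrow> fseq" is "\<lambda>r f n. r * f n"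
  subgoal for r f
    by (rule finite_subset[of _ "{n. f n \<noteq> 0}"]) auto
  done

instance
  by standard (transfer; simp add: algebra_simps fun_eq_iff)+

end

lemma coord_simps [simp]:
  "coord 0 n = 0"
  "coord (x + y) n = coord x n + coord y n"
  "coord (x - y) n = coord x n - coord y n"
  "coord (- x) n = - coord x n"
  "coord (r *\<^sub>R x) n = r * coord x n"
  by (transfer, simp)+

lemma coord_sum: "coord (\<Sum>a\<in>A. f a) n = (\<Sum>a\<in>A. coord (f a) n)"
  by (induction A rule: infinite_finite_induct) auto

instantiation fseq :: real_inner
begin

definition inner_fseq :: "fseq \<Rightarrow> fseq \<Rightarrow> real" where
  "inner_fseq x y = (\<Sum>n | coord x n \<noteq> 0. coord x n * coord y n)"

definition norm_fseq :: "fseq \<Rightarrow> real" where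
  "norm_fseq x = sqrt (inner x x)"

definition dist_fseq :: "fseq \<Rightarrow> fseq \<Rightarrow> real" where
  "dist_fseq x y = norm (x - y)"

definition sgn_fseq :: "fseq \<Rightarrow> fseq" where
  "sgn_fseq x = inverse (norm x) *\<^sub>R x"

definition uniformity_fseq :: "(fseq \<times> fseq) filter" where
  "uniformity_fseq = (INF e\<in>{0<..}. principal {(x, y). dist x y < e})"

definition open_fseq :: "fseq set \<Rightarrow> bool" where
  "open_fseq U \<longleftrightarrow> (\<forall>x\<in>U. \<forall>\<^sub>F (x', y) in uniformity. x' = x \<longrightarrow> y \<in> U)"

lemma inner_fseq_eq:
  assumes "finite A" "{n. coord x n \<noteq> 0} \<subseteq> A"
  shows "inner x y = (\<Sum>n\<in>A. coord x n * coord y n)"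
  unfolding inner_fseq_def by (rule sum.mono_neutral_left) (use assms in auto)

instance
proof
  fix x y z :: fseq and r :: real and U :: "fseq set"
  show "dist x y = norm (x - y)" by (rule dist_fseq_def)
  show "sgn x = inverse (norm x) *\<^sub>R x" by (rule sgn_fseq_def)
  show "uniformity = (INF e\<in>{0<..}. principal {(x, y). dist (x::fseq) y < e})"
    by (rule uniformity_fseq_def)
  show "open U \<longleftrightarrow> (\<forall>x\<in>U. \<forall>\<^sub>F (x', y) in uniformity. x' = x \<longrightarrow> y \<in> U)"
    by (rule open_fseq_def)
  show "norm x = sqrt (inner x x)" by (rule norm_fseq_def)
  define A where "A = {n. coord x n \<noteq> 0} \<union> {n. coord y n \<noteq> 0}"
  have A: "finite A" "{n. coord x n \<noteq> 0} \<subseteq> A" "{n. coord y n \<noteq> 0} \<subseteq> A"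
    "{n. coord (x + y) n \<noteq> 0} \<subseteq> A" "{n. coord (r *\<^sub>R x) n \<noteq> 0} \<subseteq> A"
    by (auto simp: A_def)
  show "inner x y = inner y x"
    by (simp add: inner_fseq_eq[OF A(1,2)] inner_fseq_eq[OF A(1,3)] mult.commute)
  show "inner (x + y) z = inner x z + inner y z"
    by (simp add: inner_fseq_eq[OF A(1,2)] inner_fseq_eq[OF A(1,3)] inner_fseq_eq[OF A(1,4)]
        distrib_right sum.distrib)
  show "inner (r *\<^sub>R x) y = r * inner x y"
    by (simp add: inner_fseq_eq[OF A(1,2)] inner_fseq_eq[OF A(1,5)] sum_distrib_left mult.assoc)
  show "0 \<le> inner x x"
    by (auto simp: inner_fseq_def intro: sum_nonneg)
  have "inner x x = 0 \<longleftrightarrow> (\<forall>n\<in>{n. coord x n \<noteq> 0}. coord x n * coord x n = 0)"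
    unfolding inner_fseq_def by (rule sum_nonneg_eq_0_iff) auto
  then show "inner x x = 0 \<longleftrightarrow> x = 0"
    by (auto intro: fseq_eqI)
qed

end

definition fbasis :: "nat \<Rightarrow> fseq" where
  "fbasis n = Abs_fseq (\<lambda>k. if k = n then 1 else 0)"

lemma coord_fbasis [simp]: "coord (fbasis n) k = (if k = n then 1 else 0)"
  unfolding fbasis_def by (subst Abs_fseq_inverse) auto

lemma fseq_expand: "x = (\<Sum>n | coord x n \<noteq> 0. coord x n *\<^sub>R fbasis n)"
proof (rule fseq_eqI)
  fix k
  have "(\<Sum>n | coord x n \<noteq> 0. coord x n * (if k = n then 1 else 0))
      = (\<Sum>n | coord x n \<noteq> 0. if n = k then coord x n else 0)"
    by (rule sum.cong) auto
  also have "\<dots> = coord x k" by simp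
  finally show "coord x k = coord (\<Sum>n | coord x n \<noteq> 0. coord x n *\<^sub>R fbasis n) k"
    by (simp add: coord_sum)
qed

lemma norm_fbasis [simp]: "norm (fbasis n) = 1"
proof -
  have "inner (fbasis n) (fbasis n) = 1"
    by (subst inner_fseq_eq[of "{n}"]) auto
  then show ?thesis by (simp add: norm_eq_sqrt_inner)
qed

text \<open>The Bochner integral of the library requires a second countable codomain.\<close>

instance fseq :: second_countable_topology
proof
  define lc :: "rat list \<Rightarrow> fseq" where
    "lc = (\<lambda>qs. \<Sum>n<length qs. real_of_rat (qs ! n) *\<^sub>R fbasis n)"
  define B where "B = (\<lambda>(qs, m). ball (lc qs) (inverse (real (Suc m)))) ` UNIV"
  have dense: "\<exists>qs. dist x (lc qs) < e" if "e > 0" for x e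
  proof -
    obtain N where N: "{n. coord x n \<noteq> 0} \<subseteq> {..<N}"
      using finite_nat_iff_bounded[of "{n. coord x n \<noteq> 0}"] by auto
    define d where "d = e / real (Suc N)"
    have "d > 0" using that by (simp add: d_def)
    then have "\<exists>q. \<bar>coord x n - real_of_rat q\<bar> < d" for n
      using of_rat_dense[of "coord x n" "coord x n + d"] by (auto simp: abs_less_iff) (smt (verit))
    then obtain q where q: "\<And>n. \<bar>coord x n - real_of_rat (q n)\<bar> < d" by metis
    have x: "x = (\<Sum>n<N. coord x n *\<^sub>R fbasis n)"
      by (subst fseq_expand) (rule sum.mono_neutral_left, use N in auto)
    have "x - lc (map q [0..<N]) = (\<Sum>n<N. (coord x n - real_of_rat (q n)) *\<^sub>R fbasis n)"
      by (subst x) (simp add: lc_def sum_subtractf scaleR_diff_left)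
    then have "dist x (lc (map q [0..<N])) \<le> (\<Sum>n<N. \<bar>coord x n - real_of_rat (q n)\<bar>)"
      by (simp add: dist_norm) (rule order_trans[OF norm_sum], simp)
    also have "\<dots> \<le> (\<Sum>n<N. d)" by (rule sum_mono) (use q in \<open>auto intro: less_imp_le\<close>)
    also have "\<dots> < e" using that by (simp add: d_def field_simps)
    finally show ?thesis by blast
  qed
  have "countable B" by (simp add: B_def)
  moreover have "topological_basis B"
  proof (rule topological_basisI)
    show "open b" if "b \<in> B" for b using that by (auto simp: B_def)
    fix U :: "fseq set" and x assume "open U" "x \<in> U"
    then obtain e where e: "e > 0" "ball x e \<subseteq> U" by (meson open_contains_ball)
    obtain m where m: "inverse (real (Suc m)) < e / 2"
      using reals_Archimedean[of "e / 2"] e by auto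
    obtain qs where qs: "dist x (lc qs) < inverse (real (Suc m))"
      using dense[of "inverse (real (Suc m))" x] by auto
    have "ball (lc qs) (inverse (real (Suc m))) \<subseteq> ball x e"
    proof
      fix y assume "y \<in> ball (lc qs) (inverse (real (Suc m)))"
      then show "y \<in> ball x e"
        using qs m dist_triangle[of x y "lc qs"] by simp
    qed
    then show "\<exists>b\<in>B. x \<in> b \<and> b \<subseteq> U"
      using qs e by (intro bexI[of _ "ball (lc qs) (inverse (real (Suc m)))"])
        (auto simp: B_def dist_commute simp del: of_nat_Suc intro!: image_eqI[of _ _ "(qs, m)"])
  qed
  ultimately show "\<exists>B::fseq set set. countable B \<and> open = generate_topology B"
    using topological_basis_imp_subbasis by blast
qed

definition Rn :: "nat \<Rightarrow> fseq set" where
  "Rn d = {x. \<forall>n\<ge>d. coord x n = 0}"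

section \<open>Differential calculus on the subspaces\<close>

text \<open>
  Derivatives are taken within \<open>Rn d\<close>.  They are determined only on \<open>Rn d\<close>, so the
  gradient is required to be a vector of \<open>Rn d\<close>, which makes it unique.
\<close>

definition grad :: "nat \<Rightarrow> (fseq \<Rightarrow> real) \<Rightarrow> fseq \<Rightarrow> fseq" where
  "grad d f x = (THE v. v \<in> Rn d \<and> (f has_derivative (\<lambda>y. inner v y)) (at x within Rn d))"

text \<open>
  Application of the transposed Jacobian at \<open>x\<close> of a map from \<open>Rn d\<close> to \<open>Rn e\<close> to a vector \<open>w\<close>
  of \<open>Rn e\<close>: the columns of the transposed Jacobian are the gradients of the components.
\<close>

definition jac_transpose :: "nat \<Rightarrow> nat \<Rightarrow> (fseq \<Rightarrow> fseq) \<Rightarrow> fseq \<Rightarrow> fseq \<Rightarrow> fseq" where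
  "jac_transpose d e h x w = (\<Sum>b<e. coord w b *\<^sub>R grad d (\<lambda>y. coord (h y) b) x)"

definition cont_diff_on :: "('a::real_normed_vector) set \<Rightarrow> ('a \<Rightarrow> 'b::real_normed_vector) \<Rightarrow> bool" where
  "cont_diff_on S f \<longleftrightarrow>
     (\<exists>f' :: 'a \<Rightarrow> ('a \<Rightarrow>\<^sub>L 'b).
        (\<forall>x\<in>S. (f has_derivative blinfun_apply (f' x)) (at x within S)) \<and> continuous_on S f')"

text \<open>
  Same definition as the library's \<open>closest_point\<close>, which is restricted to types with the
  Heine-Borel property; \<open>fseq\<close> does not have it, although its subspaces \<open>Rn d\<close> do.
\<close>

definition euclid_proj :: "fseq set \<Rightarrow> fseq \<Rightarrow> fseq" where
  "euclid_proj S a = (SOME x. x \<in> S \<and> (\<forall>y\<in>S. dist a x \<le> dist a y))"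

section \<open>The game\<close>

text \<open>
  Players are numbered \<open>1, \<dots>, nplayers\<close>; a profile is a function from players to vectors.
  Time-indexed fields take the time last for vectors and scalars attached to a player
  (\<open>sample g i k\<close>, \<open>step g i k\<close>, \<open>reg g i k\<close>) and first for the network
  (\<open>edges g k\<close>, \<open>weight g k i j\<close>).  A pair \<open>(j, i) \<in> edges g k\<close> means that \<open>i\<close> receives
  from \<open>j\<close>.
\<close>

record 'w agg_game =
  nplayers :: nat
  sdim :: "nat \<Rightarrow> nat"
  ndim :: "nat \<Rightarrow> nat"
  strat :: "nat \<Rightarrow> fseq set"
  agg :: "nat \<Rightarrow> fseq \<Rightarrow> fseq"
  loss :: "nat \<Rightarrow> fseq \<Rightarrow> fseq \<Rightarrow> fseq \<Rightarrow> real"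
  pspace :: "'w measure"
  noise :: "nat \<Rightarrow> 'w \<Rightarrow> fseq"
  edges :: "nat \<Rightarrow> (nat \<times> nat) set"
  weight :: "nat \<Rightarrow> nat \<Rightarrow> nat \<Rightarrow> real"
  start :: "nat \<Rightarrow> 'w \<Rightarrow> fseq"
  sample :: "nat \<Rightarrow> nat \<Rightarrow> 'w \<Rightarrow> fseq"
  step :: "nat \<Rightarrow> nat \<Rightarrow> real"
  reg :: "nat \<Rightarrow> nat \<Rightarrow> real"

definition players :: "'w agg_game \<Rightarrow> nat set" where
  "players g = {1..nplayers g}"

definition adim :: "'w agg_game \<Rightarrow> nat" where
  "adim g = (\<Sum>i\<in>players g. sdim g i)"

definition profiles :: "'w agg_game \<Rightarrow> (nat \<Rightarrow> fseq) set" where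
  "profiles g = (\<Pi>\<^sub>E i\<in>players g. strat g i)"

definition aggregate :: "'w agg_game \<Rightarrow> (nat \<Rightarrow> fseq) \<Rightarrow> fseq" where
  "aggregate g x = (\<Sum>j\<in>players g. agg g j (x j))"

definition aggregate_others :: "'w agg_game \<Rightarrow> nat \<Rightarrow> (nat \<Rightarrow> fseq) \<Rightarrow> fseq" where
  "aggregate_others g i x = (\<Sum>j\<in>players g - {i}. agg g j (x j))"

definition cost :: "'w agg_game \<Rightarrow> nat \<Rightarrow> fseq \<Rightarrow> fseq \<Rightarrow> real" where
  "cost g i x s = integral\<^sup>L (pspace g) (\<lambda>\<omega>. loss g i x s (noise g i \<omega>))"

definition grad_map :: "'w agg_game \<Rightarrow> nat \<Rightarrow> fseq \<Rightarrow> fseq \<Rightarrow> fseq" where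
  "grad_map g i x z =
     grad (sdim g i) (\<lambda>y. cost g i y z) x
     + jac_transpose (sdim g i) (adim g) (agg g i) x (grad (adim g) (\<lambda>s. cost g i x s) z)"

definition sampled_grad :: "'w agg_game \<Rightarrow> nat \<Rightarrow> fseq \<Rightarrow> fseq \<Rightarrow> fseq \<Rightarrow> fseq" where
  "sampled_grad g i x z \<xi> =
     grad (sdim g i) (\<lambda>y. loss g i y z \<xi>) x
     + jac_transpose (sdim g i) (adim g) (agg g i) x (grad (adim g) (\<lambda>s. loss g i x s \<xi>) z)"

definition pseudo_grad :: "'w agg_game \<Rightarrow> nat \<Rightarrow> (nat \<Rightarrow> fseq) \<Rightarrow> fseq" where
  "pseudo_grad g i x = grad_map g i (x i) (aggregate g x)"

definition gap :: "'w agg_game \<Rightarrow> (nat \<Rightarrow> fseq) \<Rightarrow> real" where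
  "gap g x = (SUP y\<in>profiles g. \<Sum>i\<in>players g. inner (x i - y i) (pseudo_grad g i y))"

section \<open>The algorithm\<close>

definition mix :: "'w agg_game \<Rightarrow> nat \<Rightarrow> (nat \<Rightarrow> fseq) \<Rightarrow> nat \<Rightarrow> fseq" where
  "mix g k v i = (\<Sum>j | (j, i) \<in> edges g k. weight g k i j *\<^sub>R v j)"

text \<open>The state at time \<open>k\<close> consists of the strategies and of the tracking variables.\<close>

primrec state :: "'w agg_game \<Rightarrow> 'w \<Rightarrow> nat \<Rightarrow> (nat \<Rightarrow> fseq) \<times> (nat \<Rightarrow> fseq)" where
  "state g \<omega> 0 = ((\<lambda>i. start g i \<omega>), (\<lambda>i. agg g i (start g i \<omega>)))"
| "state g \<omega> (Suc k) =
     (let x = fst (state g \<omega> k);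
          vh = mix g k (snd (state g \<omega> k));
          x' = (\<lambda>i. euclid_proj (strat g i)
                 (x i - step g i k *\<^sub>R
                   (sampled_grad g i (x i) (real (nplayers g) *\<^sub>R vh i) (sample g i k \<omega>)
                    + reg g i k *\<^sub>R x i)))
      in (x', (\<lambda>i. vh i + agg g i (x' i) - agg g i (x i))))"

definition iterate :: "'w agg_game \<Rightarrow> nat \<Rightarrow> nat \<Rightarrow> 'w \<Rightarrow> fseq" where
  "iterate g i k \<omega> = fst (state g \<omega> k) i"

definition mixed_estimate :: "'w agg_game \<Rightarrow> nat \<Rightarrow> nat \<Rightarrow> 'w \<Rightarrow> fseq" where
  "mixed_estimate g i k \<omega> = mix g k (snd (state g \<omega> k)) i"

definition sampling_error :: "'w agg_game \<Rightarrow> nat \<Rightarrow> nat \<Rightarrow> 'w \<Rightarrow> fseq" where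
  "sampling_error g i k \<omega> =
     (let x = iterate g i k \<omega>; z = real (nplayers g) *\<^sub>R mixed_estimate g i k \<omega>
      in sampled_grad g i x z (sample g i k \<omega>) - grad_map g i x z)"

definition history :: "'w agg_game \<Rightarrow> nat \<Rightarrow> 'w measure" where
  "history g k = sigma (space (pspace g))
     ({start g i -` A \<inter> space (pspace g) | i A. i \<in> players g \<and> A \<in> sets borel}
      \<union> {sampling_error g i l -` A \<inter> space (pspace g) | i l A.
           i \<in> players g \<and> l < k \<and> A \<in> sets borel})"

definition max_step :: "'w agg_game \<Rightarrow> nat \<Rightarrow> real" where
  "max_step g k = Max ((\<lambda>i. step g i k) ` players g)"

definition avg_iterate :: "'w agg_game \<Rightarrow> nat \<Rightarrow> 'w \<Rightarrow> nat \<Rightarrow> fseq" where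
  "avg_iterate g K \<omega> i =
     (\<Sum>p<K. max_step g p *\<^sub>R iterate g i p \<omega>) /\<^sub>R (\<Sum>p<K. max_step g p)"

definition expected_gap :: "'w agg_game \<Rightarrow> nat \<Rightarrow> real" where
  "expected_gap g K = integral\<^sup>L (pspace g) (\<lambda>\<omega>. gap g (avg_iterate g K \<omega>))"

text \<open>
  The point \<open>avg_iterate g K\<close> is obtained with \<open>K\<close> iterations, i.e. with \<open>K\<close> sampled gradients
  and \<open>K\<close> projections per player, so \<open>K\<close> is both the sample and the iteration count.
\<close>

definition eps_equilibrium :: "'w agg_game \<Rightarrow> real \<Rightarrow> nat \<Rightarrow> bool" where
  "eps_equilibrium g \<epsilon> K \<longleftrightarrow> expected_gap g K \<le> \<epsilon>"

section \<open>Assumptions\<close>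

definition game_data :: "'w agg_game \<Rightarrow> bool" where
  "game_data g \<longleftrightarrow>
     nplayers g \<ge> 1 \<and> prob_space (pspace g) \<and>
     (\<forall>i\<in>players g.
        strat g i \<subseteq> Rn (sdim g i) \<and> compact (strat g i) \<and> convex (strat g i) \<and>
        agg g i ` Rn (sdim g i) \<subseteq> Rn (adim g) \<and> cont_diff_on (Rn (sdim g i)) (agg g i) \<and>
        noise g i \<in> borel_measurable (pspace g) \<and>
        noise g i ` space (pspace g) \<subseteq> Rn (ndim g i))"

text \<open>
  Integrability of the losses is what makes the expectation defining \<open>cost\<close> meaningful; it is
  asked for only where \<open>cost\<close> is differentiated.
\<close>

definition smooth_convex_costs :: "'w agg_game \<Rightarrow> bool" where
  "smooth_convex_costs g \<longleftrightarrow>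
     (\<forall>i\<in>players g.
        (\<forall>x\<in>(\<Pi>\<^sub>E j\<in>players g - {i}. strat g j).
           convex_on (strat g i) (\<lambda>y. cost g i y (agg g i y + aggregate_others g i x))) \<and>
        (\<exists>U. openin (top_of_set (Rn (sdim g i) \<times> Rn (adim g))) U \<and>
             strat g i \<times> Rn (adim g) \<subseteq> U \<and>
             (\<forall>(x, s)\<in>U. integrable (pspace g) (\<lambda>\<omega>. loss g i x s (noise g i \<omega>))) \<and>
             cont_diff_on U (\<lambda>(x, s). cost g i x s)))"

text \<open>The Euclidean norm of a profile is the \<open>L2_set\<close> norm of the norms of its blocks.\<close>

definition lipschitz_monotone :: "'w agg_game \<Rightarrow> bool" where
  "lipschitz_monotone g \<longleftrightarrow>
     (\<exists>L. \<forall>x\<in>profiles g. \<forall>y\<in>profiles g.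
        L2_set (\<lambda>i. norm (pseudo_grad g i x - pseudo_grad g i y)) (players g)
          \<le> L * L2_set (\<lambda>i. norm (x i - y i)) (players g)) \<and>
     (\<forall>x\<in>profiles g. \<forall>y\<in>profiles g.
        (\<Sum>i\<in>players g. inner (pseudo_grad g i x - pseudo_grad g i y) (x i - y i)) \<ge> 0)"

definition lipschitz_data :: "'w agg_game \<Rightarrow> bool" where
  "lipschitz_data g \<longleftrightarrow>
     (\<forall>i\<in>players g.
        (\<exists>L. L-lipschitz_on (strat g i) (agg g i)) \<and>
        (\<forall>c>0. \<exists>L. \<forall>x\<in>strat g i.
           L-lipschitz_on (Rn (adim g) \<inter> cball 0 c) (grad_map g i x)))"

definition unbiased_gradients :: "'w agg_game \<Rightarrow> (nat \<Rightarrow> real) \<Rightarrow> bool" where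
  "unbiased_gradients g \<upsilon> \<longleftrightarrow>
     (\<forall>i\<in>players g. \<upsilon> i > 0 \<and>
        (\<exists>C. openin (top_of_set (Rn (sdim g i))) C \<and> strat g i \<subseteq> C \<and>
           (\<forall>\<xi>\<in>Rn (ndim g i). (\<lambda>(x, s). loss g i x s \<xi>) differentiable_on (C \<times> Rn (adim g)))) \<and>
        (\<forall>x\<in>strat g i. \<forall>z\<in>Rn (adim g).
           has_bochner_integral (pspace g) (\<lambda>\<omega>. sampled_grad g i x z (noise g i \<omega>)) (grad_map g i x z) \<and>
           (\<integral>\<^sup>+ \<omega>. ennreal ((norm (sampled_grad g i x z (noise g i \<omega>) - grad_map g i x z))\<^sup>2) \<partial>pspace g)
             \<le> ennreal ((\<upsilon> i)\<^sup>2)))"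

definition network :: "'w agg_game \<Rightarrow> real \<Rightarrow> nat \<Rightarrow> bool" where
  "network g wmin P \<longleftrightarrow>
     (\<forall>k. edges g k \<subseteq> players g \<times> players g \<and> (\<forall>i\<in>players g. (i, i) \<in> edges g k)) \<and>
     (\<forall>k. \<forall>i\<in>players g. \<forall>j\<in>players g.
        weight g k i j \<ge> 0 \<and> (weight g k i j > 0 \<longleftrightarrow> (j, i) \<in> edges g k)) \<and>
     (\<forall>k. \<forall>i\<in>players g.
        (\<Sum>j\<in>players g. weight g k i j) = 1 \<and> (\<Sum>j\<in>players g. weight g k j i) = 1) \<and>
     0 < wmin \<and> wmin < 1 \<and>
     (\<forall>k. \<forall>(j, i)\<in>edges g k. weight g k i j \<ge> wmin) \<and>
     P \<ge> 1 \<and>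
     (\<forall>k. \<forall>i\<in>players g. \<forall>j\<in>players g. (i, j) \<in> (\<Union>l\<in>{1..P}. edges g (k + l))\<^sup>*)"

text \<open>
  The conditional mean of the vector-valued sampling error vanishes coordinatewise.  The
  conditional second moment is the extended nonnegative one, so that no integrability has to be
  presupposed (\<open>real_cond_exp\<close> would be junk for a non-integrable square).
\<close>

definition sampling_scheme :: "'w agg_game \<Rightarrow> (nat \<Rightarrow> real) \<Rightarrow> bool" where
  "sampling_scheme g \<upsilon> \<longleftrightarrow>
     (\<forall>i\<in>players g.
        start g i \<in> borel_measurable (pspace g) \<and>
        start g i ` space (pspace g) \<subseteq> strat g i \<and>
        (\<forall>k.
           sample g i k \<in> borel_measurable (pspace g) \<and>
           sample g i k ` space (pspace g) \<subseteq> Rn (ndim g i) \<and>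
           distr (pspace g) borel (sample g i k) = distr (pspace g) borel (noise g i) \<and>
           sampling_error g i k \<in> borel_measurable (pspace g) \<and>
           (\<forall>n<sdim g i. AE \<omega> in pspace g.
              real_cond_exp (pspace g) (history g k) (\<lambda>\<omega>. coord (sampling_error g i k \<omega>) n) \<omega> = 0) \<and>
           (AE \<omega> in pspace g.
              nn_cond_exp (pspace g) (history g k) (\<lambda>\<omega>. ennreal ((norm (sampling_error g i k \<omega>))\<^sup>2)) \<omega>
                \<le> ennreal ((\<upsilon> i)\<^sup>2))))"

definition power_steps :: "'w agg_game \<Rightarrow> real \<Rightarrow> (nat \<Rightarrow> real) \<Rightarrow> (nat \<Rightarrow> real) \<Rightarrow> bool" where
  "power_steps g \<tau> lam \<delta> \<longleftrightarrow>
     (\<forall>i\<in>players g. lam i > 0 \<and> \<delta> i > 0 \<and>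
        (\<forall>k. step g i k = (real k + lam i) powr (- (1/2 + \<tau>)) \<and>
             reg g i k = (real k + \<delta> i) powr (- (1/2 - 2 * \<tau>))))"

definition admissible ::
  "'w agg_game \<Rightarrow> real \<Rightarrow> real \<Rightarrow> nat \<Rightarrow> (nat \<Rightarrow> real) \<Rightarrow> (nat \<Rightarrow> real) \<Rightarrow> (nat \<Rightarrow> real) \<Rightarrow> bool" where
  "admissible g \<tau> wmin P \<upsilon> lam \<delta> \<longleftrightarrow>
     game_data g \<and> smooth_convex_costs g \<and> lipschitz_monotone g \<and> lipschitz_data g \<and>
     unbiased_gradients g \<upsilon> \<and> network g wmin P \<and> sampling_scheme g \<upsilon> \<and> power_steps g \<tau> lam \<delta>"

section \<open>Connectivity parameter and hidden constants\<close>

definition conn_param :: "nat \<Rightarrow> real \<Rightarrow> nat \<Rightarrow> real" where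
  "conn_param N wmin P = (1 - wmin / (4 * (real N)\<^sup>2)) powr (1 / real P)"

text \<open>
  The bounds display their dependence on the number of players and on the connectivity
  parameter, so the factor hidden in an order symbol has to be uniform in these and may depend
  only on the other constants of the problem.  The following predicate states that \<open>\<kappa>\<close> dominates
  them: the size of the strategy sets and of the maps \<open>agg\<close> on them, the Lipschitz constants, the
  size of \<open>grad_map\<close> at zero aggregate, the standard deviations of the samples, and the shifts
  (from both sides).  The Lipschitz constant of \<open>grad_map\<close> in its second argument is taken on a
  ball that contains all the aggregates and all their estimates, since it may depend on the radius.
\<close>

definition constants_below ::
  "'w agg_game \<Rightarrow> (nat \<Rightarrow> real) \<Rightarrow> (nat \<Rightarrow> real) \<Rightarrow> (nat \<Rightarrow> real) \<Rightarrow> real \<Rightarrow> bool" where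
  "constants_below g \<upsilon> lam \<delta> \<kappa> \<longleftrightarrow>
     \<kappa> > 0 \<and>
     (\<forall>i\<in>players g.
        (\<forall>x\<in>strat g i. norm x \<le> \<kappa> \<and> norm (agg g i x) \<le> \<kappa> \<and> norm (grad_map g i x 0) \<le> \<kappa>) \<and>
        \<kappa>-lipschitz_on (strat g i) (agg g i) \<and>
        \<upsilon> i \<le> \<kappa> \<and> 1 / \<kappa> \<le> lam i \<and> lam i \<le> \<kappa> \<and> 1 / \<kappa> \<le> \<delta> i \<and> \<delta> i \<le> \<kappa>) \<and>
     (\<exists>c>0.
        (\<forall>x\<in>profiles g. norm (aggregate g x) \<le> c) \<and>
        (\<forall>i\<in>players g. \<forall>k. \<forall>\<omega>\<in>space (pspace g).
           norm (real (nplayers g) *\<^sub>R mixed_estimate g i k \<omega>) \<le> c) \<and>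
        (\<forall>i\<in>players g. \<forall>x\<in>strat g i.
           \<kappa>-lipschitz_on (Rn (adim g) \<inter> cball 0 c) (grad_map g i x)))"

end

theory Submission
  imports Defs
begin

text \<open>
  The expected gap is controlled by summing the projection inequality
  \<open>\<parallel>x\<^sub>k\<^sub>+\<^sub>1 - y\<parallel>\<^sup>2 \<le> \<parallel>x\<^sub>k - \<alpha>\<^sub>k d\<^sub>k - y\<parallel>\<^sup>2\<close> over time and players.  Monotonicity moves the
  gradient from the iterates to \<open>y\<close>; the steps of different players differ by a telescoping,
  hence summable, amount; the regularisation contributes \<open>\<Sum>\<^sub>k \<alpha>\<^sub>k \<eta>\<^sub>k = O(K\<^sup>\<tau>)\<close> per player;
  the noise is orthogonal to the past, and its part depending on \<open>y\<close> is
  \<open>\<langle>y, \<Sum>\<^sub>k \<alpha>\<^sub>k \<zeta>\<^sub>k\<rangle>\<close>, whose supremum over \<open>y\<close> has bounded mean because \<open>\<Sum>\<^sub>k \<alpha>\<^sub>k\<^sup>2 < \<infinity>\<close>.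

  What remains is the tracking error.  Over each connectivity window the Euclidean disagreement
  contracts by \<open>\<beta>\<^sup>P\<close>, so it is a geometric convolution of the increments of the aggregate.
  Bounding the increments by the diameter gives a disagreement of order \<open>N / (1 - \<beta>)\<close>, hence
  gradients of order \<open>N\<^sup>2 / (1 - \<beta>)\<close>; feeding this back makes the increments \<open>O(\<alpha>\<^sub>k)\<close>, and the
  errors weighted by \<open>\<alpha>\<^sub>k\<close> become summable with total \<open>O(N\<^sup>5 / (1 - \<beta>)\<^sup>2)\<close>.  Dividing by
  \<open>\<Sum>\<^sub>k \<alpha>\<^sub>k \<ge> c K\<^bsup>1/2 - \<tau>\<^esup>\<close> yields the rate.
\<close>

section \<open>Vectors, gradients and projections\<close>

text \<open>Two obstacles shape the argument. The Lipschitz constant of \<open>grad_map\<close> in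
  the aggregate is available on bounded sets only, yet the estimates are driven by gradients;
  compactness of the strategy sets bounds the estimates without any gradient, and only then is the
  ball fixed. Moreover, monotonicity concerns the sum over players, so all players must carry one
  weight per time, \<open>max_step\<close>, although each moves with its own step.

  The contraction factor comes from sorting the values and cutting the order between neighbours.
  Strong connectivity forces every cut to be crossed within a window, a crossing lowers the sum of
  squares by at least \<open>wmin\<close> / 2 times the squared gap, and the squared gaps control
  the variance up to the factor N^2 / 2. This gives 1 - \<open>wmin\<close> / N^2 for squared norms,
  hence 1 - \<open>wmin\<close> / (4 N^2) for norms.\<close>

lemma inner_fbasis: "inner x (fbasis n) = coord x n"
proof -
  have "inner (fbasis n) x = coord x n"
    by (subst inner_fseq_eq[of "{n}"]) auto
  then show ?thesis by (simp add: inner_commute)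
qed

lemma bounded_linear_coord: "bounded_linear (\<lambda>x. coord x n)"
  using bounded_linear_inner_left[of "fbasis n"] by (simp add: inner_fbasis)

lemma continuous_on_coord [continuous_intros]:
  "continuous_on S f \<Longrightarrow> continuous_on S (\<lambda>x. coord (f x) n)"
  by (rule bounded_linear.continuous_on[OF bounded_linear_coord])

lemma borel_measurable_coord [measurable]: "(\<lambda>x. coord x n) \<in> borel_measurable borel"
  by (rule borel_measurable_continuous_onI) (intro continuous_intros)

lemma Rn_0 [simp, intro]: "0 \<in> Rn d"
  and Rn_add: "x \<in> Rn d \<Longrightarrow> y \<in> Rn d \<Longrightarrow> x + y \<in> Rn d"
  and Rn_diff: "x \<in> Rn d \<Longrightarrow> y \<in> Rn d \<Longrightarrow> x - y \<in> Rn d"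
  and Rn_scaleR: "x \<in> Rn d \<Longrightarrow> r *\<^sub>R x \<in> Rn d"
  and Rn_sum: "(\<And>a. a \<in> A \<Longrightarrow> f a \<in> Rn d) \<Longrightarrow> sum f A \<in> Rn d"
  by (auto simp: Rn_def coord_sum intro: sum.neutral)

lemma fbasis_in_Rn: "b < d \<Longrightarrow> fbasis b \<in> Rn d"
  by (auto simp: Rn_def)

lemma inner_Rn:
  assumes "x \<in> Rn d"
  shows "inner x y = (\<Sum>b<d. coord x b * coord y b)"
  by (rule inner_fseq_eq) (use assms in \<open>auto simp: Rn_def not_less[symmetric]\<close>)

lemma norm_sq_Rn:
  assumes "x \<in> Rn d"
  shows "(norm x)\<^sup>2 = (\<Sum>b<d. (coord x b)\<^sup>2)"
  by (simp add: power2_norm_eq_inner inner_Rn[OF assms]) (simp add: power2_eq_square)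

lemma Rn_expand:
  assumes "x \<in> Rn d"
  shows "x = (\<Sum>b<d. coord x b *\<^sub>R fbasis b)"
  by (subst fseq_expand, rule sum.mono_neutral_left)
    (use assms in \<open>auto simp: Rn_def not_less[symmetric]\<close>)

text \<open>The derivative within \<open>Rn d\<close> sees a vector only through directions that
  stay in the subspace: restricting f to the lines through x along e_n with n < d reduces the claim
  to uniqueness of derivatives on the real line. The coordinates from d on vanish by membership in
  \<open>Rn d\<close>.\<close>

lemma grad_unique:
  assumes x: "x \<in> Rn d" and v: "v \<in> Rn d" and w: "w \<in> Rn d"
    and dv: "(f has_derivative (\<lambda>y. inner v y)) (at x within Rn d)"
    and dw: "(f has_derivative (\<lambda>y. inner w y)) (at x within Rn d)"
  shows "v = w"
proof (rule fseq_eqI)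
  fix n
  show "coord v n = coord w n"
  proof (cases "n < d")
    case False
    then show ?thesis using v w by (auto simp: Rn_def)
  next
    case True
    have line: "((\<lambda>t. f (x + t *\<^sub>R fbasis n)) has_derivative (\<lambda>t. inner u (t *\<^sub>R fbasis n))) (at 0)"
      if "(f has_derivative (\<lambda>y. inner u y)) (at x within Rn d)" for u
    proof -
      have g: "((\<lambda>t. x + t *\<^sub>R fbasis n) has_derivative (\<lambda>t. t *\<^sub>R fbasis n)) (at 0)"
        by (auto intro!: derivative_eq_intros)
      have "range (\<lambda>t. x + t *\<^sub>R fbasis n) \<subseteq> Rn d"
        using x True by (auto intro!: Rn_add Rn_scaleR fbasis_in_Rn)
      from has_derivative_in_compose[OF g, of f "\<lambda>y. inner u y"] has_derivative_subset[OF that this]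
      show ?thesis by simp
    qed
    have "(\<lambda>t. inner v (t *\<^sub>R fbasis n)) = (\<lambda>t. inner w (t *\<^sub>R fbasis n))"
      by (rule has_derivative_unique[OF line[OF dv] line[OF dw]])
    from fun_cong[OF this, of 1] show ?thesis by (simp add: inner_fbasis)
  qed
qed

text \<open>Any derivative L determines the gradient by its values on the basis vectors. This
  formula replaces the definite description in later continuity and membership proofs.\<close>

lemma grad_eqI:
  assumes x: "x \<in> Rn d" and f: "(f has_derivative L) (at x within Rn d)"
  shows "grad d f x = (\<Sum>b<d. L (fbasis b) *\<^sub>R fbasis b)"
proof -
  define v where "v = (\<Sum>b<d. L (fbasis b) *\<^sub>R fbasis b)"
  have v: "v \<in> Rn d" unfolding v_def by (intro Rn_sum Rn_scaleR fbasis_in_Rn) auto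
  have L: "linear L" using f has_derivative_bounded_linear bounded_linear.linear by blast
  have eq: "inner v y = L y" if "y \<in> Rn d" for y
  proof -
    have "L y = L (\<Sum>b<d. coord y b *\<^sub>R fbasis b)" using Rn_expand[OF that] by simp
    also have "\<dots> = (\<Sum>b<d. coord y b * L (fbasis b))"
      by (simp add: linear_sum[OF L] linear_cmul[OF L])
    also have "\<dots> = inner v y"
      by (simp add: v_def inner_sum_left inner_commute[of "fbasis _"] inner_fbasis mult.commute)
    finally show ?thesis by simp
  qed
  \<comment> \<open>L and the inner product with v agree on \<open>Rn d\<close> only, so the
    derivative is transferred through the difference quotients, whose increments y - x lie in
    \<open>Rn d\<close>.\<close>
  have "(f has_derivative (\<lambda>y. inner v y)) (at x within Rn d)"
    unfolding has_derivative_iff_norm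
  proof (intro conjI bounded_linear_inner_right)
    show "((\<lambda>y. norm (f y - f x - inner v (y - x)) / norm (y - x)) \<longlongrightarrow> 0) (at x within Rn d)"
    proof (rule Lim_transform_eventually)
      show "((\<lambda>y. norm (f y - f x - L (y - x)) / norm (y - x)) \<longlongrightarrow> 0) (at x within Rn d)"
        using f unfolding has_derivative_iff_norm by blast
      show "\<forall>\<^sub>F y in at x within Rn d. norm (f y - f x - L (y - x)) / norm (y - x)
          = norm (f y - f x - inner v (y - x)) / norm (y - x)"
        unfolding eventually_at_filter using x by (auto simp: eq Rn_diff)
    qed
  qed
  then show ?thesis
    unfolding grad_def v_def[symmetric] using v grad_unique[OF x] by (intro the_equality) blast+
qed

lemma grad_in_Rn:
  assumes "x \<in> Rn d" "f differentiable (at x within Rn d)"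
  shows "grad d f x \<in> Rn d"
  using grad_eqI[OF assms(1)] assms(2)
  by (auto simp: differentiable_def intro!: Rn_sum Rn_scaleR fbasis_in_Rn)

text \<open>Smoothness is assumed within a relatively open set, whereas \<open>grad\<close>
  differentiates within the whole subspace; the two filters agree at points of the open set.\<close>

lemma at_within_openin:
  assumes "openin (top_of_set T) U" "x \<in> U"
  shows "at x within U = at x within T"
proof -
  obtain V where V: "open V" "U = T \<inter> V" using assms(1) by (auto simp: openin_open)
  show ?thesis by (rule at_within_nhd[of x V]) (use V assms in auto)
qed

lemma has_derivative_partials:
  fixes f :: "'a::real_normed_vector \<Rightarrow> 'b::real_normed_vector \<Rightarrow> 'c::real_normed_vector"
  assumes f: "((\<lambda>(x, s). f x s) has_derivative L) (at (x, s) within A \<times> B)"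
    and "x \<in> A" "s \<in> B"
  shows "((\<lambda>y. f y s) has_derivative (\<lambda>y. L (y, 0))) (at x within A)"
    and "((\<lambda>y. f x y) has_derivative (\<lambda>y. L (0, y))) (at s within B)"
proof -
  have 1: "((\<lambda>y. (y, s)) has_derivative (\<lambda>y. (y, 0))) (at x within A)"
    by (auto intro!: derivative_eq_intros)
  have 2: "((\<lambda>y. (x, y)) has_derivative (\<lambda>y. (0, y))) (at s within B)"
    by (auto intro!: derivative_eq_intros)
  show "((\<lambda>y. f y s) has_derivative (\<lambda>y. L (y, 0))) (at x within A)"
    using has_derivative_in_compose[OF 1, of "\<lambda>(x, s). f x s" L]
      has_derivative_subset[OF f, of "(\<lambda>y. (y, s)) ` A"] assms by auto
  show "((\<lambda>y. f x y) has_derivative (\<lambda>y. L (0, y))) (at s within B)"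
    using has_derivative_in_compose[OF 2, of "\<lambda>(x, s). f x s" L]
      has_derivative_subset[OF f, of "(\<lambda>y. (x, y)) ` B"] assms by auto
qed

section \<open>Metric projection onto compact convex sets\<close>

lemma euclid_proj_props:
  assumes "compact S" "S \<noteq> {}"
  shows "euclid_proj S a \<in> S" "y \<in> S \<Longrightarrow> dist a (euclid_proj S a) \<le> dist a y"
proof -
  have "\<exists>x\<in>S. \<forall>y\<in>S. dist a x \<le> dist a y"
    by (rule continuous_attains_inf) (use assms in \<open>auto intro!: continuous_intros\<close>)
  then have "\<exists>x. x \<in> S \<and> (\<forall>y\<in>S. dist a x \<le> dist a y)" by blast
  from someI_ex[OF this]
  show "euclid_proj S a \<in> S" "y \<in> S \<Longrightarrow> dist a (euclid_proj S a) \<le> dist a y"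
    by (auto simp: euclid_proj_def)
qed

text \<open>If the angle at the nearest point p towards y were acute, a short move from p towards y,
  which convexity keeps in S, would come closer to a.\<close>

lemma euclid_proj_variational:
  assumes S: "compact S" "convex S" and y: "y \<in> S"
  shows "inner (a - euclid_proj S a) (y - euclid_proj S a) \<le> 0"
proof (rule ccontr)
  define p where "p = euclid_proj S a"
  have p: "p \<in> S" "\<And>y. y \<in> S \<Longrightarrow> dist a p \<le> dist a y"
    unfolding p_def using euclid_proj_props[OF S(1)] y by blast+
  assume "\<not> ?thesis"
  then have pos: "inner (a - p) (y - p) > 0" by (simp add: p_def)
  then have ne: "inner (y - p) (y - p) > 0" by auto
  have expand: "inner (u - t *\<^sub>R w) (u - t *\<^sub>R w) = inner u u - t * (2 * inner u w - t * inner w w)"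
    for u w :: fseq and t
    by (simp add: inner_diff_left inner_diff_right inner_commute[of w u] algebra_simps)
  \<comment> \<open>This minimises the quadratic distance along the segment, truncated at 1; it
    keeps 2 <a - p, y - p> - t |y - p|^2 positive.\<close>
  define t where "t = min 1 (inner (a - p) (y - p) / inner (y - p) (y - p))"
  have t: "0 < t" "t \<le> 1" "t * inner (y - p) (y - p) \<le> inner (a - p) (y - p)"
    using pos ne by (auto simp: t_def min_def field_simps)
  have "p + t *\<^sub>R (y - p) = (1 - t) *\<^sub>R p + t *\<^sub>R y" by (simp add: algebra_simps)
  then have "p + t *\<^sub>R (y - p) \<in> S"
    using convexD_alt[OF S(2) p(1) y, of t] t by simp
  from p(2)[OF this] have "inner (a - p) (a - p) \<le> inner (a - p - t *\<^sub>R (y - p)) (a - p - t *\<^sub>R (y - p))"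
    by (simp add: dist_norm norm_eq_sqrt_inner algebra_simps)
  also have "\<dots> = inner (a - p) (a - p) - t * (2 * inner (a - p) (y - p) - t * inner (y - p) (y - p))"
    by (simp only: expand)
  finally have "t * (2 * inner (a - p) (y - p) - t * inner (y - p) (y - p)) \<le> 0" by simp
  moreover have "t * (2 * inner (a - p) (y - p) - t * inner (y - p) (y - p)) > 0"
    using t pos by (intro mult_pos_pos) auto
  ultimately show False by simp
qed

text \<open>The variational inequalities at the two projections, each tested with the other
  projection, add up to |p - q|^2 <= <a - b, p - q>; Cauchy-Schwarz finishes.\<close>

lemma euclid_proj_nonexpansive:
  assumes S: "compact S" "convex S" "S \<noteq> {}"
  shows "norm (euclid_proj S a - euclid_proj S b) \<le> norm (a - b)"
proof -
  define p q where "p = euclid_proj S a" and "q = euclid_proj S b"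
  have pq: "p \<in> S" "q \<in> S" unfolding p_def q_def using euclid_proj_props S by auto
  have "inner (a - p) (q - p) \<le> 0" "inner (b - q) (p - q) \<le> 0"
    unfolding p_def q_def using euclid_proj_variational S pq p_def q_def by auto
  then have "inner (p - q) (p - q) \<le> inner (a - b) (p - q)"
    by (simp add: inner_diff_left inner_diff_right inner_commute)
  also have "\<dots> \<le> norm (a - b) * norm (p - q)" by (rule norm_cauchy_schwarz)
  finally have "norm (p - q) * norm (p - q) \<le> norm (a - b) * norm (p - q)"
    by (simp add: power2_norm_eq_inner[symmetric] power2_eq_square)
  then show ?thesis by (cases "norm (p - q) = 0") (auto simp: p_def q_def)
qed

text \<open>A strategy is its own projection, so nonexpansiveness compares a new iterate with a
  fixed competitor y as well as with its predecessor.\<close>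

lemma euclid_proj_self:
  assumes "x \<in> S" shows "euclid_proj S x = x"
  unfolding euclid_proj_def
proof (rule some_equality)
  show "z = x" if "z \<in> S \<and> (\<forall>y\<in>S. dist x z \<le> dist x y)" for z
    using that assms by (metis dist_eq_0_iff dist_le_zero_iff)
qed (use assms in auto)

lemma continuous_on_euclid_proj:
  assumes "compact S" "convex S" "S \<noteq> {}"
  shows "continuous_on UNIV (euclid_proj S)"
proof -
  have "1-lipschitz_on UNIV (euclid_proj S)"
    by (rule lipschitz_onI) (use euclid_proj_nonexpansive[OF assms] in \<open>auto simp: dist_norm\<close>)
  then show ?thesis by (rule lipschitz_on_continuous_on)
qed

section \<open>Contraction of doubly stochastic averaging\<close>

text \<open>The variance of a random variable is half the mean squared difference of two independent
  copies; the rows of a stochastic matrix will play the role of the law.\<close>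

lemma weighted_variance:
  fixes a z :: "'a \<Rightarrow> real"
  assumes "(\<Sum>i\<in>I. a i) = 1"
  shows "(\<Sum>i\<in>I. a i * (z i)\<^sup>2) - (\<Sum>i\<in>I. a i * z i)\<^sup>2
    = (\<Sum>i\<in>I. \<Sum>j\<in>I. a i * a j * (z i - z j)\<^sup>2) / 2"
proof -
  have "(\<Sum>i\<in>I. \<Sum>j\<in>I. a i * a j * (z i - z j)\<^sup>2)
      = (\<Sum>i\<in>I. \<Sum>j\<in>I. (a i * (z i)\<^sup>2) * a j) + (\<Sum>i\<in>I. \<Sum>j\<in>I. a i * (a j * (z j)\<^sup>2))
        - 2 * (\<Sum>i\<in>I. \<Sum>j\<in>I. (a i * z i) * (a j * z j))"
    unfolding sum_distrib_left sum.distrib[symmetric] sum_subtractf[symmetric]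
    by (intro sum.cong) (auto simp: power2_eq_square algebra_simps)
  also have "\<dots> = 2 * (\<Sum>i\<in>I. a i * (z i)\<^sup>2) - 2 * (\<Sum>i\<in>I. a i * z i)\<^sup>2"
    unfolding sum_product[symmetric] using assms by (simp add: power2_eq_square)
  finally show ?thesis by simp
qed

lemma sum_squares_le_square_sum:
  fixes g :: "'a \<Rightarrow> real"
  assumes "\<And>i. i \<in> A \<Longrightarrow> 0 \<le> g i"
  shows "(\<Sum>i\<in>A. (g i)\<^sup>2) \<le> (\<Sum>i\<in>A. g i)\<^sup>2"
proof -
  have "L2_set g A \<le> (\<Sum>i\<in>A. g i)" by (rule L2_set_le_sum) (use assms in auto)
  then have "(L2_set g A)\<^sup>2 \<le> (\<Sum>i\<in>A. g i)\<^sup>2" by (rule power_mono) simp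
  then show ?thesis by (simp add: L2_set_def sum_nonneg)
qed

lemma sum_gaps:
  fixes x :: "nat \<Rightarrow> real"
  assumes "1 \<le> m" "m \<le> Suc n"
  shows "(\<Sum>d = m..n. x (d - 1) - x d) = x (m - 1) - x n"
  using assms(2)
proof (induction n)
  case 0
  then show ?case using assms(1) by simp
next
  case (Suc n)
  then show ?case by (cases "m = Suc (Suc n)") auto
qed

text \<open>The gaps in D between i and j are non-overlapping intervals of values. The topmost has z
  i above it and the bottommost has z j below it, so the gaps add up to at most z i - z j; the
  square of a sum of nonnegative numbers dominates the sum of squares.\<close>

lemma sum_gap_squares_between:
  fixes x z :: "nat \<Rightarrow> real"
  assumes anti: "\<And>i j. i \<le> j \<Longrightarrow> j < n \<Longrightarrow> x j \<le> x i"
    and D: "D \<subseteq> {1..<n}"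
    and lo: "\<And>d i. d \<in> D \<Longrightarrow> i < d \<Longrightarrow> x (d - 1) \<le> z i"
    and hi: "\<And>d j. d \<in> D \<Longrightarrow> d \<le> j \<Longrightarrow> j < n \<Longrightarrow> z j \<le> x d"
    and ij: "i < j" "j < n"
  shows "(\<Sum>d\<in>D \<inter> {i<..j}. (x (d - 1) - x d)\<^sup>2) \<le> (z i - z j)\<^sup>2"
proof (cases "D \<inter> {i<..j} = {}")
  case True
  then show ?thesis by simp
next
  case False
  let ?E = "D \<inter> {i<..j}"
  have fin: "finite ?E" by simp
  have ge: "x d \<le> x (d - 1)" if "d < n" for d using anti[of "d - 1" d] that by simp
  define p q where "p = Min ?E" and "q = Max ?E"
  have p: "p \<in> ?E" and q: "q \<in> ?E"
    unfolding p_def q_def using Min_in[OF fin False] Max_in[OF fin False] by auto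
  have pq: "?E \<subseteq> {p..q}" "p \<le> q" using fin p by (auto simp: p_def q_def)
  have sq: "(\<Sum>d\<in>?E. (x (d - 1) - x d)\<^sup>2) \<le> (\<Sum>d\<in>?E. x (d - 1) - x d)\<^sup>2"
    by (rule sum_squares_le_square_sum) (use ge D in auto)
  have nn: "0 \<le> (\<Sum>d\<in>?E. x (d - 1) - x d)"
    by (rule sum_nonneg) (use ge D in auto)
  have "(\<Sum>d\<in>?E. x (d - 1) - x d) \<le> (\<Sum>d = p..q. x (d - 1) - x d)"
    by (rule sum_mono2) (use ge q ij pq in auto)
  also have "\<dots> = x (p - 1) - x q" by (rule sum_gaps) (use p pq in auto)
  also have "\<dots> \<le> z i - z j" using lo[of p i] hi[of q j] p q ij by auto
  finally show ?thesis using sq power_mono[OF _ nn] order_trans by blast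
qed

text \<open>Unit column sums turn the loss in the sum of squares into the sum over rows l of the
  variance of z under the weights \<open>a l\<close>. Each pair (i, j) in that variance pays for all
  gaps separating it, and a cut d collects from row l the product of the masses on its two
  sides.\<close>

lemma averaging_step_decrease:
  fixes a :: "nat \<Rightarrow> nat \<Rightarrow> real" and x z :: "nat \<Rightarrow> real"
  assumes nonneg: "\<And>l i. l < n \<Longrightarrow> i < n \<Longrightarrow> 0 \<le> a l i"
    and rows: "\<And>l. l < n \<Longrightarrow> (\<Sum>i<n. a l i) = 1"
    and cols: "\<And>i. i < n \<Longrightarrow> (\<Sum>l<n. a l i) = 1"
    and anti: "\<And>i j. i \<le> j \<Longrightarrow> j < n \<Longrightarrow> x j \<le> x i"
    and D: "D \<subseteq> {1..<n}"
    and lo: "\<And>d i. d \<in> D \<Longrightarrow> i < d \<Longrightarrow> x (d - 1) \<le> z i"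
    and hi: "\<And>d j. d \<in> D \<Longrightarrow> d \<le> j \<Longrightarrow> j < n \<Longrightarrow> z j \<le> x d"
    and w: "0 < w"
    and cross: "\<And>d. d \<in> D \<Longrightarrow> \<exists>l<n. w \<le> (\<Sum>i<d. a l i) \<and> w \<le> (\<Sum>i = d..<n. a l i)"
  shows "w / 2 * (\<Sum>d\<in>D. (x (d - 1) - x d)\<^sup>2) \<le> (\<Sum>i<n. (z i)\<^sup>2) - (\<Sum>l<n. (\<Sum>i<n. a l i * z i)\<^sup>2)"
proof -
  have finD: "finite D" using D finite_subset by blast
  define g where "g = (\<lambda>d. (x (d - 1) - x d)\<^sup>2)"
  \<comment> \<open>The squared gap at d is charged to the ordered pair (i, j) when d separates i on
    the left from j on the right; of the two orders of a pair at most one is charged.\<close>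
  define s where "s = (\<lambda>i j d. if i < d \<and> d \<le> j then g d else 0)"
  have g0: "g d \<ge> 0" for d by (simp add: g_def)
  have s_sum: "(\<Sum>d\<in>D. s i j d) = (\<Sum>d\<in>D \<inter> {i<..j}. g d)" for i j
    unfolding s_def using finD by (simp add: sum.If_cases Int_def greaterThanAtMost_def)
  have sep: "(\<Sum>d\<in>D. s i j d) + (\<Sum>d\<in>D. s j i d) \<le> (z i - z j)\<^sup>2" if "i < n" "j < n" for i j
  proof (cases i j rule: linorder_cases)
    case less
    then have "{j<..i} = {}" by auto
    then show ?thesis
      using sum_gap_squares_between[where x = x and z = z and n = n, OF anti D lo hi less that(2)] by (simp add: s_sum g_def)
  next
    case greater
    then have "{i<..j} = {}" by auto
    then show ?thesis
      using sum_gap_squares_between[where x = x and z = z and n = n, OF anti D lo hi greater that(1)]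
      by (simp add: s_sum g_def power2_commute)
  qed (simp add: s_sum)
  have row: "(\<Sum>i<n. \<Sum>j<n. a l i * a l j * (\<Sum>d\<in>D. s i j d))
      \<le> (\<Sum>i<n. a l i * (z i)\<^sup>2) - (\<Sum>i<n. a l i * z i)\<^sup>2" if l: "l < n" for l
  proof -
    have swap: "(\<Sum>i<n. \<Sum>j<n. a l i * a l j * (\<Sum>d\<in>D. s i j d))
        = (\<Sum>i<n. \<Sum>j<n. a l i * a l j * (\<Sum>d\<in>D. s j i d))"
      by (subst sum.swap) (simp add: mult.commute)
    \<comment> \<open>Symmetrising over the two orders of a pair cancels the 1 / 2 in the variance
      identity.\<close>
    have "2 * (\<Sum>i<n. \<Sum>j<n. a l i * a l j * (\<Sum>d\<in>D. s i j d))
        = (\<Sum>i<n. \<Sum>j<n. a l i * a l j * ((\<Sum>d\<in>D. s i j d) + (\<Sum>d\<in>D. s j i d)))"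
      by (subst mult_2, subst (2) swap) (simp add: sum.distrib distrib_left)
    also have "\<dots> \<le> (\<Sum>i<n. \<Sum>j<n. a l i * a l j * (z i - z j)\<^sup>2)"
      by (intro sum_mono mult_left_mono sep mult_nonneg_nonneg nonneg l) auto
    finally show ?thesis using weighted_variance[OF rows[OF l], of z] by simp
  qed
  have cut: "w / 2 * g d \<le> (\<Sum>l<n. (\<Sum>i<n. \<Sum>j<n. a l i * a l j * s i j d))" if d: "d \<in> D" for d
  proof -
    have dn: "d < n" "1 \<le> d" using d D by auto
    have prod: "(\<Sum>i<n. \<Sum>j<n. a l i * a l j * s i j d) = g d * ((\<Sum>i<d. a l i) * (\<Sum>i = d..<n. a l i))" for l
    proof -
      have "(\<Sum>i<n. \<Sum>j<n. a l i * a l j * s i j d)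
          = (\<Sum>i<n. \<Sum>j<n. (if i < d then a l i else 0) * (if d \<le> j then a l j else 0)) * g d"
        unfolding sum_distrib_right by (intro sum.cong) (auto simp: s_def)
      also have "\<dots> = (\<Sum>i<n. if i < d then a l i else 0) * (\<Sum>j<n. if d \<le> j then a l j else 0) * g d"
        by (simp add: sum_product)
      also have "(\<Sum>i<n. if i < d then a l i else 0) = (\<Sum>i<d. a l i)"
        using dn by (simp add: sum.If_cases Int_def) (rule sum.cong, auto)
      also have "(\<Sum>j<n. if d \<le> j then a l j else 0) = (\<Sum>i = d..<n. a l i)"
        using dn by (simp add: sum.If_cases Int_def) (rule sum.cong, auto)
      finally show ?thesis by simp
    qed
    obtain l where l: "l < n" "w \<le> (\<Sum>i<d. a l i)" "w \<le> (\<Sum>i = d..<n. a l i)"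
      using cross[OF d] by blast
    define C where "C = (\<Sum>i<d. a l i)"
    have C': "(\<Sum>i = d..<n. a l i) = 1 - C"
    proof -
      have "(\<Sum>i<n. a l i) = C + (\<Sum>i = d..<n. a l i)"
        unfolding C_def using dn
        by (subst sum.union_disjoint[symmetric]) (auto intro!: sum.cong)
      then show ?thesis using rows[OF l(1)] by simp
    qed
    \<comment> \<open>Both masses are at least w and the larger is at least 1 / 2.\<close>
    have "w / 2 \<le> C * (1 - C)"
    proof (cases "C \<le> 1/2")
      case True
      then have "w * (1/2) \<le> C * (1 - C)" by (intro mult_mono) (use l w C_def in auto)
      then show ?thesis by simp
    next
      case False
      then have "(1/2) * w \<le> C * (1 - C)" by (intro mult_mono) (use l w C_def C' in auto)
      then show ?thesis by simp
    qed
    from mult_right_mono[OF this g0[of d]]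
    have "w / 2 * g d \<le> g d * ((\<Sum>i<d. a l i) * (\<Sum>i = d..<n. a l i))"
      unfolding C' C_def[symmetric] by (simp add: mult_ac)
    also have "\<dots> \<le> (\<Sum>l<n. g d * ((\<Sum>i<d. a l i) * (\<Sum>i = d..<n. a l i)))"
      by (rule member_le_sum[of l])
        (use l dn g0 in \<open>auto intro!: mult_nonneg_nonneg sum_nonneg nonneg\<close>)
    finally show ?thesis by (simp add: prod)
  qed
  have "w / 2 * (\<Sum>d\<in>D. g d) \<le> (\<Sum>d\<in>D. (\<Sum>l<n. (\<Sum>i<n. \<Sum>j<n. a l i * a l j * s i j d)))"
    unfolding sum_distrib_left by (rule sum_mono) (rule cut)
  also have "\<dots> = (\<Sum>l<n. (\<Sum>i<n. \<Sum>j<n. a l i * a l j * (\<Sum>d\<in>D. s i j d)))"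
    unfolding sum_distrib_left
    by (subst sum.swap, rule sum.cong[OF refl], subst sum.swap, rule sum.cong[OF refl], rule sum.swap)
  also have "\<dots> \<le> (\<Sum>l<n. (\<Sum>i<n. a l i * (z i)\<^sup>2) - (\<Sum>i<n. a l i * z i)\<^sup>2)"
    by (rule sum_mono) (use row in auto)
  also have "\<dots> = (\<Sum>i<n. (\<Sum>l<n. a l i) * (z i)\<^sup>2) - (\<Sum>l<n. (\<Sum>i<n. a l i * z i)\<^sup>2)"
    unfolding sum_subtractf sum_distrib_right by (subst sum.swap) simp
  also have "(\<Sum>i<n. (\<Sum>l<n. a l i) * (z i)\<^sup>2) = (\<Sum>i<n. (z i)\<^sup>2)" by (simp add: cols)
  finally show ?thesis by (simp add: g_def)
qed

text \<open>
  The entries are in decreasing order at the start of the window.  A cut between two consecutive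
  entries costs at least \<open>w / 2\<close> times its squared gap at the first time it is crossed, since
  up to then the averages on either side stay on their side of the gap.
\<close>

lemma averaging_window_decrease:
  fixes a :: "nat \<Rightarrow> nat \<Rightarrow> nat \<Rightarrow> real" and z :: "nat \<Rightarrow> nat \<Rightarrow> real"
  assumes nonneg: "\<And>t l i. l < n \<Longrightarrow> i < n \<Longrightarrow> 0 \<le> a t l i"
    and rows: "\<And>t l. l < n \<Longrightarrow> (\<Sum>i<n. a t l i) = 1"
    and cols: "\<And>t i. i < n \<Longrightarrow> (\<Sum>l<n. a t l i) = 1"
    and w: "0 < w"
    and pos: "\<And>t l i. l < n \<Longrightarrow> i < n \<Longrightarrow> 0 < a t l i \<Longrightarrow> w \<le> a t l i"
    and diag: "\<And>t l. l < n \<Longrightarrow> 0 < a t l l"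
    and cross: "\<And>d. 0 < d \<Longrightarrow> d < n \<Longrightarrow> \<exists>t<P. \<exists>l<n. \<exists>i<n. 0 < a t l i \<and> (l < d) \<noteq> (i < d)"
    and z: "\<And>t l. l < n \<Longrightarrow> z (Suc t) l = (\<Sum>i<n. a t l i * z t i)"
    and anti: "\<And>i j. i \<le> j \<Longrightarrow> j < n \<Longrightarrow> z 0 j \<le> z 0 i"
  shows "w / 2 * (\<Sum>d = 1..<n. (z 0 (d - 1) - z 0 d)\<^sup>2) \<le> (\<Sum>i<n. (z 0 i)\<^sup>2) - (\<Sum>i<n. (z P i)\<^sup>2)"
proof -
  define crs where "crs = (\<lambda>d t. \<exists>l<n. \<exists>i<n. 0 < a t l i \<and> (l < d) \<noteq> (i < d))"
  define T where "T = (\<lambda>d. LEAST t. crs d t)"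
  have T: "crs d (T d)" "T d < P" "\<And>t. t < T d \<Longrightarrow> \<not> crs d t" if "d \<in> {1..<n}" for d
  proof -
    obtain t where t: "t < P" "crs d t" using cross[of d] \<open>d \<in> {1..<n}\<close> by (auto simp: crs_def)
    show "crs d (T d)" unfolding T_def by (rule LeastI) (rule t(2))
    show "T d < P" unfolding T_def using Least_le[of "crs d" t] t by linarith
    show "\<not> crs d t'" if "t' < T d" for t' using not_less_Least that unfolding T_def by blast
  qed
  have inv: "(\<forall>i<d. z 0 (d - 1) \<le> z t i) \<and> (\<forall>j<n. d \<le> j \<longrightarrow> z t j \<le> z 0 d)"
    if d: "d \<in> {1..<n}" and "t \<le> T d" for d t
    using that(2)
  proof (induction t)
    case 0
    show ?case using d anti by auto
  next
    case (Suc t)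
    have nc: "a t l i = 0" if "l < n" "i < n" "(l < d) \<noteq> (i < d)" for l i
      using T(3)[OF d, of t] Suc.prems nonneg[of l i t] that unfolding crs_def
      by (metis Suc_le_eq order_le_less)
    have lo: "z 0 (d - 1) \<le> z (Suc t) l" if l: "l < d" for l
    proof -
      have "z 0 (d - 1) = (\<Sum>i<n. a t l i * z 0 (d - 1))"
        using rows[of l t] l d by (simp add: sum_distrib_right[symmetric])
      also have "\<dots> \<le> (\<Sum>i<n. a t l i * z t i)"
      proof (rule sum_mono)
        fix i assume "i \<in> {..<n}"
        then show "a t l i * z 0 (d - 1) \<le> a t l i * z t i"
          using Suc nc[of l i] l d nonneg[of l i t] by (cases "i < d") (auto intro: mult_left_mono)
      qed
      finally show ?thesis using z l d by simp
    qed
    have hi: "z (Suc t) l \<le> z 0 d" if l: "d \<le> l" "l < n" for l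
    proof -
      have "(\<Sum>i<n. a t l i * z t i) \<le> (\<Sum>i<n. a t l i * z 0 d)"
      proof (rule sum_mono)
        fix i assume "i \<in> {..<n}"
        then show "a t l i * z t i \<le> a t l i * z 0 d"
          using Suc nc[of l i] l d nonneg[of l i t] by (cases "i < d") (auto intro: mult_left_mono)
      qed
      also have "\<dots> = z 0 d" using rows[of l t] l d by (simp add: sum_distrib_right[symmetric])
      finally show ?thesis using z l d by simp
    qed
    show ?case using lo hi by blast
  qed
  define D where "D = (\<lambda>t. {d \<in> {1..<n}. T d = t})"
  have step: "w / 2 * (\<Sum>d\<in>D t. (z 0 (d - 1) - z 0 d)\<^sup>2) \<le> (\<Sum>i<n. (z t i)\<^sup>2) - (\<Sum>i<n. (z (Suc t) i)\<^sup>2)" for t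
  proof -
    have "w / 2 * (\<Sum>d\<in>D t. (z 0 (d - 1) - z 0 d)\<^sup>2)
        \<le> (\<Sum>i<n. (z t i)\<^sup>2) - (\<Sum>l<n. (\<Sum>i<n. a t l i * z t i)\<^sup>2)"
    proof (rule averaging_step_decrease[OF nonneg rows cols anti _ _ _ w])
      show "D t \<subseteq> {1..<n}" by (auto simp: D_def)
      show "z 0 (d - 1) \<le> z t i" if "d \<in> D t" "i < d" for d i
        using inv[of d t] that by (auto simp: D_def)
      show "z t j \<le> z 0 d" if "d \<in> D t" "d \<le> j" "j < n" for d j
        using inv[of d t] that by (auto simp: D_def)
      fix d assume "d \<in> D t"
      then have d: "d \<in> {1..<n}" "T d = t" by (auto simp: D_def)
      then obtain l i where li: "l < n" "i < n" "0 < a t l i" "(l < d) \<noteq> (i < d)"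
        using T(1)[OF d(1)] unfolding crs_def by blast
      have ge: "w \<le> (\<Sum>i\<in>A. a t l i)" if "j \<in> A" "0 < a t l j" "A \<subseteq> {..<n}" for A j
      proof -
        have "w \<le> a t l j" using pos li that by auto
        also have "\<dots> \<le> (\<Sum>i\<in>A. a t l i)"
          by (rule member_le_sum) (use that nonneg li finite_subset[OF that(3)] in auto)
        finally show ?thesis .
      qed
      \<comment> \<open>Row l is that of the crossing edge: the loop at l puts weight at least w on
        its own side of the cut, and the edge from i puts at least w on the other side.\<close>
      show "\<exists>l<n. w \<le> (\<Sum>i<d. a t l i) \<and> w \<le> (\<Sum>i = d..<n. a t l i)"
      proof (intro exI[of _ l] conjI li(1))
        show "w \<le> (\<Sum>i<d. a t l i)"
          by (rule ge[of "if l < d then l else i"]) (use li diag[OF li(1), of t] d in auto)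
        show "w \<le> (\<Sum>i = d..<n. a t l i)"
          by (rule ge[of "if l < d then i else l"]) (use li diag[OF li(1), of t] d in auto)
      qed
    qed
    then show ?thesis by (simp add: z)
  qed
  \<comment> \<open>Every cut is charged exactly once, at its first crossing, which falls inside the
    window.\<close>
  have "(\<Sum>d = 1..<n. (z 0 (d - 1) - z 0 d)\<^sup>2) = (\<Sum>t<P. \<Sum>d\<in>D t. (z 0 (d - 1) - z 0 d)\<^sup>2)"
    unfolding D_def by (rule sum.group[symmetric]) (use T in auto)
  then have "w / 2 * (\<Sum>d = 1..<n. (z 0 (d - 1) - z 0 d)\<^sup>2)
      = (\<Sum>t<P. w / 2 * (\<Sum>d\<in>D t. (z 0 (d - 1) - z 0 d)\<^sup>2))"
    by (simp add: sum_distrib_left)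
  also have "\<dots> \<le> (\<Sum>t<P. (\<Sum>i<n. (z t i)\<^sup>2) - (\<Sum>i<n. (z (Suc t) i)\<^sup>2))"
    by (rule sum_mono) (rule step)
  also have "\<dots> = (\<Sum>i<n. (z 0 i)\<^sup>2) - (\<Sum>i<n. (z P i)\<^sup>2)" by (rule sum_lessThan_telescope')
  finally show ?thesis .
qed

text \<open>The sum of squared deviations from the mean (\<open>spread_eq\<close>), written so that
  the second term is invariant under doubly stochastic averaging and only the sum of squares has to
  be followed.\<close>

definition spread :: "'a set \<Rightarrow> ('a \<Rightarrow> real) \<Rightarrow> real" where
  "spread I z = (\<Sum>i\<in>I. (z i)\<^sup>2) - (\<Sum>i\<in>I. z i)\<^sup>2 / real (card I)"

lemma spread_eq:
  assumes "finite I" "I \<noteq> {}"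
  shows "spread I z = (\<Sum>i\<in>I. (z i - (\<Sum>j\<in>I. z j) / real (card I))\<^sup>2)"
proof -
  define m where "m = (\<Sum>j\<in>I. z j) / real (card I)"
  have n: "real (card I) > 0" using assms by (simp add: card_gt_0_iff)
  then have s: "(\<Sum>j\<in>I. z j) = real (card I) * m" by (simp add: m_def)
  have "(\<Sum>i\<in>I. (z i - m)\<^sup>2) = (\<Sum>i\<in>I. (z i)\<^sup>2) - 2 * m * (\<Sum>i\<in>I. z i) + real (card I) * m\<^sup>2"
  proof -
    have "(\<Sum>i\<in>I. (z i - m)\<^sup>2) = (\<Sum>i\<in>I. (z i)\<^sup>2 - 2 * m * z i + m\<^sup>2)"
      by (rule sum.cong) (simp_all add: power2_diff)
    then show ?thesis by (simp add: sum.distrib sum_subtractf sum_distrib_left[symmetric])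
  qed
  then show ?thesis unfolding spread_def m_def[symmetric] s using n
    by (simp add: power2_eq_square algebra_simps)
qed

text \<open>Any difference of two values is at most the range, a sum of n - 1 gaps, whose square is
  at most n times the sum of squared gaps by Cauchy-Schwarz. Inserting this for all pairs in the
  variance identity with weights 1 / n gives the factor n^2 / 2.\<close>

lemma spread_gaps:
  fixes x :: "nat \<Rightarrow> real"
  assumes anti: "\<And>i j. i \<le> j \<Longrightarrow> j < n \<Longrightarrow> x j \<le> x i" and n: "0 < n"
  shows "spread {..<n} x \<le> (real n)\<^sup>2 / 2 * (\<Sum>d = 1..<n. (x (d - 1) - x d)\<^sup>2)"
proof -
  let ?g = "\<Sum>d = 1..<n. (x (d - 1) - x d)\<^sup>2"
  have range: "(x i - x j)\<^sup>2 \<le> real n * ?g" if "i < n" "j < n" for i j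
  proof -
    have "x i \<le> x 0" "x j \<le> x 0" "x (n - 1) \<le> x i" "x (n - 1) \<le> x j"
      using that n by (auto intro!: anti)
    then have "\<bar>x i - x j\<bar> \<le> \<bar>x 0 - x (n - 1)\<bar>" by linarith
    then have "(x i - x j)\<^sup>2 \<le> (x 0 - x (n - 1))\<^sup>2" by (rule abs_le_square_iff[THEN iffD1])
    also have "x 0 - x (n - 1) = (\<Sum>d = 1..n - 1. x (d - 1) - x d)"
      using sum_gaps[of 1 "n - 1" x] by simp
    also have "{1..n - 1} = {1..<n}" using n by auto
    also have "(\<Sum>d = 1..<n. x (d - 1) - x d)\<^sup>2 \<le> real (card {1..<n}) * ?g"
      using Cauchy_Schwarz_ineq_sum[of "\<lambda>_. 1" "\<lambda>d. x (d - 1) - x d" "{1..<n}"] by simp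
    also have "\<dots> \<le> real n * ?g" by (intro mult_right_mono sum_nonneg) auto
    finally show ?thesis .
  qed
  have "(\<Sum>i<n. (1 / real n) * (x i)\<^sup>2) - (\<Sum>i<n. (1 / real n) * x i)\<^sup>2
      = (\<Sum>i<n. \<Sum>j<n. (1 / real n) * (1 / real n) * (x i - x j)\<^sup>2) / 2"
    by (rule weighted_variance) (use n in auto)
  also have "\<dots> \<le> (\<Sum>i<n. \<Sum>j<n. (1 / real n) * (1 / real n) * (real n * ?g)) / 2"
    by (intro divide_right_mono sum_mono mult_left_mono range) auto
  also have "\<dots> = real n * ?g / 2" using n by simp
  finally have "real n * ((\<Sum>i<n. (1 / real n) * (x i)\<^sup>2) - (\<Sum>i<n. (1 / real n) * x i)\<^sup>2)
      \<le> real n * (real n * ?g / 2)" by (rule mult_left_mono) simp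
  moreover have "real n * ((\<Sum>i<n. (1 / real n) * (x i)\<^sup>2) - (\<Sum>i<n. (1 / real n) * x i)\<^sup>2)
      = spread {..<n} x"
    unfolding spread_def sum_distrib_left[symmetric] using n
    by (simp add: right_diff_distrib power_divide) (simp add: power2_eq_square)
  ultimately show ?thesis by (simp add: power2_eq_square)
qed

lemma sum_doubly_stochastic:
  fixes a :: "'a \<Rightarrow> 'a \<Rightarrow> real" and z :: "'a \<Rightarrow> 'b::real_vector"
  assumes "\<And>i. i \<in> I \<Longrightarrow> (\<Sum>l\<in>I. a l i) = 1"
  shows "(\<Sum>l\<in>I. \<Sum>i\<in>I. a l i *\<^sub>R z i) = (\<Sum>i\<in>I. z i)"
  by (subst sum.swap) (simp add: assms scaleR_sum_left[symmetric])

lemma sorted_enumeration: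
  fixes z :: "'a \<Rightarrow> real"
  assumes "finite I"
  obtains e where "bij_betw e {..<card I} I" "\<And>i j. i \<le> j \<Longrightarrow> j < card I \<Longrightarrow> z (e j) \<le> z (e i)"
proof -
  obtain xs where xs: "set xs = I" "distinct xs" using finite_distinct_list[OF assms] by blast
  define ys where "ys = sort_key (\<lambda>i. - z i) xs"
  have ys: "set ys = I" "distinct ys" "length ys = card I"
    using xs by (auto simp: ys_def distinct_card)
  have "sorted (map (\<lambda>i. - z i) ys)" by (simp add: ys_def)
  then have "z (ys ! j) \<le> z (ys ! i)" if "i \<le> j" "j < card I" for i j
    using that ys by (auto simp: sorted_iff_nth_mono)
  moreover have "bij_betw (\<lambda>i. ys ! i) {..<card I} I"
    by (rule bij_betw_nth[OF ys(2)]) (simp_all only: ys)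
  ultimately show ?thesis using that by blast
qed

text \<open>Sorting the initial values turns the cuts of the ordered list into proper nonempty
  subsets of I, for which \<open>cross\<close> supplies the crossings. The window loses w / 2 times
  the sum of squared gaps, and \<open>spread_gaps\<close> bounds the initial spread by n^2 / 2 times
  the same sum.\<close>

lemma averaging_contraction:
  fixes a :: "nat \<Rightarrow> 'a \<Rightarrow> 'a \<Rightarrow> real" and z :: "nat \<Rightarrow> 'a \<Rightarrow> real"
  assumes I: "finite I" "I \<noteq> {}"
    and nonneg: "\<And>t l i. l \<in> I \<Longrightarrow> i \<in> I \<Longrightarrow> 0 \<le> a t l i"
    and rows: "\<And>t l. l \<in> I \<Longrightarrow> (\<Sum>i\<in>I. a t l i) = 1"
    and cols: "\<And>t i. i \<in> I \<Longrightarrow> (\<Sum>l\<in>I. a t l i) = 1"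
    and w: "0 < w"
    and pos: "\<And>t l i. l \<in> I \<Longrightarrow> i \<in> I \<Longrightarrow> 0 < a t l i \<Longrightarrow> w \<le> a t l i"
    and diag: "\<And>t l. l \<in> I \<Longrightarrow> 0 < a t l l"
    and cross: "\<And>S. S \<subset> I \<Longrightarrow> S \<noteq> {} \<Longrightarrow> \<exists>t<P. \<exists>l\<in>I. \<exists>i\<in>I. 0 < a t l i \<and> (l \<in> S) \<noteq> (i \<in> S)"
    and z: "\<And>t l. l \<in> I \<Longrightarrow> z (Suc t) l = (\<Sum>i\<in>I. a t l i * z t i)"
  shows "spread I (z P) \<le> (1 - w / (real (card I))\<^sup>2) * spread I (z 0)"
proof -
  define n where "n = card I"
  have n: "0 < n" using I by (simp add: n_def card_gt_0_iff)
  obtain e where e: "bij_betw e {..<n} I" and anti: "\<And>i j. i \<le> j \<Longrightarrow> j < n \<Longrightarrow> z 0 (e j) \<le> z 0 (e i)"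
    using sorted_enumeration[OF I(1)] unfolding n_def by blast
  have eI: "e i \<in> I" if "i < n" for i using e that by (auto simp: bij_betw_def)
  note re = sum.reindex_bij_betw[OF e]
  have spread_e: "spread {..<n} (\<lambda>i. z t (e i)) = spread I (z t)" for t
    unfolding spread_def re[of "\<lambda>i. (z t i)\<^sup>2"] re[of "z t"] by (simp add: n_def)
  have total: "(\<Sum>i\<in>I. z t i) = (\<Sum>i\<in>I. z 0 i)" for t
  proof (induction t)
    case (Suc t)
    have "(\<Sum>l\<in>I. z (Suc t) l) = (\<Sum>l\<in>I. \<Sum>i\<in>I. a t l i *\<^sub>R z t i)"
      by (rule sum.cong) (simp_all add: z)
    also have "\<dots> = (\<Sum>i\<in>I. z t i)" by (rule sum_doubly_stochastic) (rule cols)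
    finally show ?case using Suc by simp
  qed simp
  have "w / 2 * (\<Sum>d = 1..<n. (z 0 (e (d - 1)) - z 0 (e d))\<^sup>2)
      \<le> (\<Sum>i<n. (z 0 (e i))\<^sup>2) - (\<Sum>i<n. (z P (e i))\<^sup>2)"
  proof (rule averaging_window_decrease[where a = "\<lambda>t l i. a t (e l) (e i)" and z = "\<lambda>t i. z t (e i)"])
    fix d assume d: "0 < d" "d < n"
    define S where "S = e ` {..<d}"
    have mem: "e i \<in> S \<longleftrightarrow> i < d" if "i < n" for i
    proof
      assume "e i \<in> S"
      then obtain k where k: "k < d" "e i = e k" by (auto simp: S_def)
      then have "i = k" using inj_onD[OF bij_betw_imp_inj_on[OF e], of i k] that d by auto
      then show "i < d" using k by simp
    qed (auto simp: S_def)
    have "S \<noteq> {}" "S \<subseteq> I" "e d \<notin> S" using d eI mem by (auto simp: S_def)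
    then have "S \<subset> I" using eI[OF d(2)] by blast
    from cross[OF this \<open>S \<noteq> {}\<close>] obtain t l i
      where "t < P" "l \<in> I" "i \<in> I" "0 < a t l i" "(l \<in> S) \<noteq> (i \<in> S)" by blast
    moreover obtain l' i' where "l' < n" "e l' = l" "i' < n" "e i' = i"
      using e \<open>l \<in> I\<close> \<open>i \<in> I\<close> by (metis bij_betw_imp_surj_on imageE lessThan_iff)
    ultimately show "\<exists>t<P. \<exists>l<n. \<exists>i<n. 0 < a t (e l) (e i) \<and> (l < d) \<noteq> (i < d)"
      using mem by metis
  next
    fix t l assume l: "l < n"
    show "(\<Sum>i<n. a t (e l) (e i)) = 1" using rows[OF eI[OF l]] by (simp add: re)
    show "(\<Sum>i<n. a t (e i) (e l)) = 1" using cols[OF eI[OF l]] by (simp add: re[of "\<lambda>i. a t i (e l)"])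
    show "z (Suc t) (e l) = (\<Sum>i<n. a t (e l) (e i) * z t (e i))"
      using z[OF eI[OF l]] by (simp add: re[of "\<lambda>i. a t (e l) i * z t i"])
  qed (use anti w eI nonneg pos diag in auto)
  then have drop: "w / 2 * (\<Sum>d = 1..<n. (z 0 (e (d - 1)) - z 0 (e d))\<^sup>2) \<le> spread I (z 0) - spread I (z P)"
    using re[of "\<lambda>i. (z 0 i)\<^sup>2"] re[of "\<lambda>i. (z P i)\<^sup>2"] by (simp add: spread_def total[of P])
  have "spread I (z 0) \<le> (real n)\<^sup>2 / 2 * (\<Sum>d = 1..<n. (z 0 (e (d - 1)) - z 0 (e d))\<^sup>2)"
    using spread_gaps[of n "\<lambda>i. z 0 (e i)", OF anti n] by (simp add: spread_e)
  then have "w / (real n)\<^sup>2 * spread I (z 0)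
      \<le> w / (real n)\<^sup>2 * ((real n)\<^sup>2 / 2 * (\<Sum>d = 1..<n. (z 0 (e (d - 1)) - z 0 (e d))\<^sup>2))"
    by (rule mult_left_mono) (use w in auto)
  also have "\<dots> = w / 2 * (\<Sum>d = 1..<n. (z 0 (e (d - 1)) - z 0 (e d))\<^sup>2)" using n by simp
  also note drop
  finally show ?thesis by (simp add: n_def algebra_simps)
qed

section \<open>Sums of powers\<close>

text \<open>The shift may be smaller than 1, so the term k = 0 is split off; in the other terms the
  shift only helps and is dropped.\<close>

lemma sum_powr_shift_bounded:
  fixes \<mu> p :: real
  assumes "0 < \<mu>" "1 < p"
  shows "(\<Sum>k<K. (real k + \<mu>) powr (- p)) \<le> \<mu> powr (- p) + (\<Sum>k. real (Suc k) powr (- p))"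
proof -
  have sm: "summable (\<lambda>k. real (Suc k) powr (- p))"
    using assms summable_Suc_iff[of "\<lambda>k. real k powr (- p)"] by (simp add: summable_real_powr_iff)
  show ?thesis
  proof (cases K)
    case 0
    then show ?thesis by (simp del: of_nat_Suc add: suminf_nonneg sm)
  next
    case (Suc K')
    have "(\<Sum>k<K. (real k + \<mu>) powr (- p)) = \<mu> powr (- p) + (\<Sum>k<K'. (real (Suc k) + \<mu>) powr (- p))"
      unfolding Suc by (subst sum.lessThan_Suc_shift) simp
    also have "(\<Sum>k<K'. (real (Suc k) + \<mu>) powr (- p)) \<le> (\<Sum>k<K'. real (Suc k) powr (- p))"
      by (rule sum_mono, rule powr_mono2') (use assms in auto)
    also have "\<dots> \<le> (\<Sum>k. real (Suc k) powr (- p))"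
      by (rule sum_le_suminf[OF sm]) auto
    finally show ?thesis by simp
  qed
qed

text \<open>Mean value theorem for x powr t on [k, k + 1]; since t - 1 <= 0, the derivative is
  smallest at the right end. At k = 0 differentiability may fail at the left end, where continuity
  suffices.\<close>

lemma powr_increment:
  fixes t :: real
  assumes "0 < t" "t \<le> 1"
  shows "t * real (Suc k) powr (t - 1) \<le> real (Suc k) powr t - real k powr t"
proof -
  obtain z where z: "real k < z" "z < real (Suc k)"
    "real (Suc k) powr t - real k powr t = t * z powr (t - 1) * (real (Suc k) - real k)"
  proof (rule mvt[of "real k" "real (Suc k)" "\<lambda>x. x powr t" "\<lambda>x h. t * x powr (t - 1) * h"])
    show "continuous_on {real k..real (Suc k)} (\<lambda>x. x powr t)"
      by (rule continuous_on_powr') (use assms in \<open>auto intro!: continuous_intros\<close>)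
    show "((\<lambda>x. x powr t) has_derivative (\<lambda>h. t * x powr (t - 1) * h)) (at x)"
      if "real k < x" "x < real (Suc k)" for x
      using has_real_derivative_powr[of x t] that by (simp add: has_field_derivative_def)
  qed auto
  have "real (Suc k) powr (t - 1) \<le> z powr (t - 1)"
    by (rule powr_mono2') (use z assms in auto)
  then show ?thesis using z assms by (simp add: mult_left_mono)
qed

text \<open>Comparison with the telescoping increments of x powr t, after splitting off the term k =
  0 on account of small shifts.\<close>

lemma sum_powr_shift_le:
  fixes \<mu> t :: real
  assumes "0 < \<mu>" "0 < t" "t \<le> 1" "1 \<le> K"
  shows "(\<Sum>k<K. (real k + \<mu>) powr (t - 1)) \<le> (\<mu> powr (t - 1) + 1 / t) * real K powr t"
proof -
  obtain K' where K: "K = Suc K'" using assms(4) by (cases K) auto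
  have "(\<Sum>k<K'. real (Suc k) powr (t - 1)) \<le> (\<Sum>k<K'. 1 / t * (real (Suc k) powr t - real k powr t))"
  proof (rule sum_mono)
    fix k show "real (Suc k) powr (t - 1) \<le> 1 / t * (real (Suc k) powr t - real k powr t)"
      using powr_increment[OF assms(2,3), of k] assms by (simp add: field_simps)
  qed
  also have "\<dots> = 1 / t * real K' powr t"
    unfolding sum_distrib_left[symmetric] by (subst sum_lessThan_telescope) (use assms in simp)
  also have "\<dots> \<le> 1 / t * real K powr t"
    by (intro mult_left_mono powr_mono2) (use assms K in auto)
  finally have 1: "(\<Sum>k<K'. real (Suc k) powr (t - 1)) \<le> 1 / t * real K powr t" .
  have "(\<Sum>k<K. (real k + \<mu>) powr (t - 1)) = \<mu> powr (t - 1) + (\<Sum>k<K'. (real (Suc k) + \<mu>) powr (t - 1))"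
    unfolding K by (subst sum.lessThan_Suc_shift) simp
  also have "(\<Sum>k<K'. (real (Suc k) + \<mu>) powr (t - 1)) \<le> (\<Sum>k<K'. real (Suc k) powr (t - 1))"
    by (rule sum_mono, rule powr_mono2') (use assms in auto)
  also note 1
  also have "\<mu> powr (t - 1) \<le> \<mu> powr (t - 1) * real K powr t"
    using ge_one_powr_ge_zero[of "real K" t] assms by (simp add: mult_left_mono[of 1, simplified])
  finally show ?thesis by (simp add: algebra_simps)
qed

text \<open>Telescoping with lag m: the sum equals the first m values minus m later ones.\<close>

lemma sum_shift_difference_le:
  fixes f :: "nat \<Rightarrow> real"
  assumes "\<And>k. 0 \<le> f k"
  shows "(\<Sum>k<K. f k - f (k + m)) \<le> (\<Sum>k<m. f k)"
proof -
  have "(\<Sum>k<K. f k - f (k + m)) = (\<Sum>k<m. f k) - (\<Sum>k<m. f (K + k))"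
  proof (induction K)
    case (Suc K)
    have "(\<Sum>k<m. f (Suc K + k)) + f K = (\<Sum>k<Suc m. f (K + k))"
      by (subst sum.lessThan_Suc_shift) simp
    then have "(\<Sum>k<m. f (Suc K + k)) + f K = (\<Sum>k<m. f (K + k)) + f (K + m)" by simp
    then show ?case using Suc by simp
  qed simp
  then show ?thesis using sum_nonneg[of "{..<m}" "\<lambda>k. f (K + k)"] assms by simp
qed

text \<open>K times the smallest summand already has the right order. The extra 1 in the shift is
  covered by k + 1 <= K, so every base is at most (1 + \<kappa>) K.\<close>

lemma sum_powr_ge:
  fixes \<kappa> s :: real
  assumes "0 < s" "0 \<le> \<kappa>" "1 \<le> K"
  shows "(1 + \<kappa>) powr (- s) * real K powr (1 - s) \<le> (\<Sum>k<K. (real k + \<kappa> + 1) powr (- s))"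
proof -
  have "(1 + \<kappa>) powr (- s) * real K powr (1 - s) = real K * ((1 + \<kappa>) * real K) powr (- s)"
  proof -
    have "real K powr (1 - s) = real K * real K powr (- s)"
      using assms powr_add[of "real K" 1 "- s"] by simp
    then show ?thesis using assms by (simp add: powr_mult)
  qed
  also have "\<dots> = (\<Sum>k<K. ((1 + \<kappa>) * real K) powr (- s))" by simp
  also have "\<dots> \<le> (\<Sum>k<K. (real k + \<kappa> + 1) powr (- s))"
  proof (rule sum_mono, rule powr_mono2')
    fix k assume "k \<in> {..<K}"
    then have "real k + 1 \<le> real K" "\<kappa> \<le> \<kappa> * real K"
      using assms mult_left_mono[of 1 "real K" \<kappa>] by auto
    then show "real k + \<kappa> + 1 \<le> (1 + \<kappa>) * real K" by (simp add: algebra_simps)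
  qed (use assms in auto)
  finally show ?thesis .
qed

text \<open>Exchanging the sums weighs b t by a geometric series whose coefficients a k are at most
  a t, as a decreases. The induction performs this through the recursion r (k + 1) = \<beta> r k + b
  k of the inner convolution.\<close>

lemma sum_geometric_tail_le:
  fixes a b :: "nat \<Rightarrow> real"
  assumes a: "\<And>k. 0 \<le> a k" "\<And>k. a (Suc k) \<le> a k" and b: "\<And>k. 0 \<le> b k"
    and \<beta>: "0 \<le> \<beta>" "\<beta> < 1"
  shows "(\<Sum>k<K. a k * (\<Sum>t<k. \<beta> ^ (k - Suc t) * b t)) \<le> (\<Sum>t<K. a t * b t) / (1 - \<beta>)"
proof -
  define r where "r = (\<lambda>k. \<Sum>t<k. \<beta> ^ (k - Suc t) * b t)"
  have r0: "r k \<ge> 0" for k unfolding r_def by (intro sum_nonneg mult_nonneg_nonneg) (use b \<beta> in auto)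
  have rS: "r (Suc k) = \<beta> * r k + b k" for k
  proof -
    have "(\<Sum>t<k. \<beta> ^ (Suc k - Suc t) * b t) = \<beta> * (\<Sum>t<k. \<beta> ^ (k - Suc t) * b t)"
      unfolding sum_distrib_left
    proof (rule sum.cong[OF refl])
      fix t assume "t \<in> {..<k}"
      then have "Suc k - Suc t = Suc (k - Suc t)" by auto
      then show "\<beta> ^ (Suc k - Suc t) * b t = \<beta> * (\<beta> ^ (k - Suc t) * b t)" by simp
    qed
    then show ?thesis by (simp add: r_def)
  qed
  \<comment> \<open>The added potential bounds what the inputs before time K can still contribute
    from time K on.\<close>
  have "(\<Sum>k<K. a k * r k) + a K * r K / (1 - \<beta>) \<le> (\<Sum>t<K. a t * b t) / (1 - \<beta>)"
  proof (induction K)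
    case 0
    then show ?case by (simp add: r_def)
  next
    case (Suc K)
    have "a (Suc K) * r (Suc K) / (1 - \<beta>) \<le> a K * (\<beta> * r K + b K) / (1 - \<beta>)"
      unfolding rS[symmetric] by (intro divide_right_mono mult_right_mono a r0) (use \<beta> in auto)
    moreover have "a K * r K + a K * (\<beta> * r K + b K) / (1 - \<beta>)
        = a K * r K / (1 - \<beta>) + a K * b K / (1 - \<beta>)"
    proof -
      have "A + A * \<beta> / (1 - \<beta>) = A / (1 - \<beta>)" for A using \<beta> by (simp add: field_simps)
      from this[of "a K * r K"] show ?thesis by (simp add: distrib_left add_divide_distrib mult_ac)
    qed
    ultimately show ?case using Suc by (simp add: add_divide_distrib)
  qed
  moreover have "0 \<le> a K * r K / (1 - \<beta>)"
    by (intro divide_nonneg_nonneg mult_nonneg_nonneg a r0) (use \<beta> in auto)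
  ultimately show ?thesis by (simp add: r_def)
qed

lemma sum_power_le:
  fixes \<beta> :: real
  assumes "0 \<le> \<beta>" "\<beta> < 1"
  shows "(\<Sum>k<K. \<beta> ^ k) \<le> 1 / (1 - \<beta>)"
  using assms by (simp add: sum_gp_strict divide_right_mono)

lemma sum_power_rev_le:
  fixes \<beta> :: real
  assumes "0 \<le> \<beta>" "\<beta> < 1"
  shows "(\<Sum>t<k. \<beta> ^ (k - Suc t)) \<le> 1 / (1 - \<beta>)"
  using sum_power_le[OF assms, of k] by (simp add: sum.nat_diff_reindex)

section \<open>Disagreement of the tracking variables\<close>

text \<open>Jensen's inequality in every row, read off from \<open>weighted_variance\<close>; unit
  column sums then restore the sum of squares. It covers the steps outside complete windows, where
  connectivity says nothing.\<close>

lemma spread_averaging_le: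
  fixes a :: "'a \<Rightarrow> 'a \<Rightarrow> real" and z :: "'a \<Rightarrow> real"
  assumes nonneg: "\<And>l i. l \<in> I \<Longrightarrow> i \<in> I \<Longrightarrow> 0 \<le> a l i"
    and rows: "\<And>l. l \<in> I \<Longrightarrow> (\<Sum>i\<in>I. a l i) = 1"
    and cols: "\<And>i. i \<in> I \<Longrightarrow> (\<Sum>l\<in>I. a l i) = 1"
  shows "spread I (\<lambda>l. \<Sum>i\<in>I. a l i * z i) \<le> spread I z"
proof -
  have "(\<Sum>l\<in>I. (\<Sum>i\<in>I. a l i * z i)\<^sup>2) \<le> (\<Sum>l\<in>I. \<Sum>i\<in>I. a l i * (z i)\<^sup>2)"
  proof (rule sum_mono)
    fix l assume l: "l \<in> I"
    have "0 \<le> (\<Sum>i\<in>I. \<Sum>j\<in>I. a l i * a l j * (z i - z j)\<^sup>2)"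
      by (intro sum_nonneg mult_nonneg_nonneg nonneg l) auto
    then show "(\<Sum>i\<in>I. a l i * z i)\<^sup>2 \<le> (\<Sum>i\<in>I. a l i * (z i)\<^sup>2)"
      using weighted_variance[OF rows[OF l], of z] by simp
  qed
  also have "\<dots> = (\<Sum>i\<in>I. (z i)\<^sup>2)"
    using sum_doubly_stochastic[of I a "\<lambda>i. (z i)\<^sup>2"] cols by simp
  finally show ?thesis
    using sum_doubly_stochastic[of I a z] cols by (simp add: spread_def)
qed

text \<open>Square root of the total spread over the coordinates (\<open>disagreement_sq\<close>).
  It is a seminorm in v, and the triangle inequality lets contributions that entered the network at
  different times be bounded separately.\<close>

definition disagreement :: "'a set \<Rightarrow> ('a \<Rightarrow> 'b::real_normed_vector) \<Rightarrow> real" where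
  "disagreement I v = L2_set (\<lambda>i. norm (v i - (\<Sum>j\<in>I. v j) /\<^sub>R real (card I))) I"

lemma disagreement_nonneg [simp]: "0 \<le> disagreement I v"
  by (simp add: disagreement_def)

lemma disagreement_cong: "(\<And>i. i \<in> I \<Longrightarrow> u i = v i) \<Longrightarrow> disagreement I u = disagreement I v"
  unfolding disagreement_def by (rule L2_set_cong) auto

lemma disagreement_zero [simp]: "disagreement I (\<lambda>_. 0) = 0"
  by (simp add: disagreement_def L2_set_def)

lemma disagreement_add: "disagreement I (\<lambda>i. u i + v i) \<le> disagreement I u + disagreement I v"
proof -
  have "disagreement I (\<lambda>i. u i + v i)
      \<le> L2_set (\<lambda>i. norm (u i - (\<Sum>j\<in>I. u j) /\<^sub>R real (card I)) + norm (v i - (\<Sum>j\<in>I. v j) /\<^sub>R real (card I))) I"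
    unfolding disagreement_def
    by (intro L2_set_mono)
      (auto simp: sum.distrib scaleR_add_right add_diff_add intro: norm_triangle_ineq)
  also have "\<dots> \<le> disagreement I u + disagreement I v"
    unfolding disagreement_def by (rule L2_set_triangle_ineq)
  finally show ?thesis .
qed

lemma disagreement_sum:
  "disagreement I (\<lambda>i. \<Sum>t\<in>T. u t i) \<le> (\<Sum>t\<in>T. disagreement I (u t))"
proof (induction T rule: infinite_finite_induct)
  case (insert t T)
  then show ?case using disagreement_add[of I "u t" "\<lambda>i. \<Sum>t\<in>T. u t i"] by simp
qed auto

lemma norm_diff_mean_le_disagreement:
  assumes "finite I" "i \<in> I"
  shows "norm (v i - (\<Sum>j\<in>I. v j) /\<^sub>R real (card I)) \<le> disagreement I v"
  unfolding disagreement_def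
  using member_le_L2_set[OF assms, of "\<lambda>i. norm (v i - (\<Sum>j\<in>I. v j) /\<^sub>R real (card I))"] by simp

lemma disagreement_sq:
  fixes v :: "'a \<Rightarrow> fseq"
  assumes I: "finite I" "I \<noteq> {}" and v: "\<forall>i\<in>I. v i \<in> Rn d"
  shows "(disagreement I v)\<^sup>2 = (\<Sum>b<d. spread I (\<lambda>i. coord (v i) b))"
proof -
  have "(disagreement I v)\<^sup>2 = (\<Sum>i\<in>I. (norm (v i - (\<Sum>j\<in>I. v j) /\<^sub>R real (card I)))\<^sup>2)"
    unfolding disagreement_def L2_set_def by (simp add: sum_nonneg)
  also have "\<dots> = (\<Sum>i\<in>I. \<Sum>b<d. (coord (v i - (\<Sum>j\<in>I. v j) /\<^sub>R real (card I)) b)\<^sup>2)"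
    by (intro sum.cong[OF refl] norm_sq_Rn Rn_diff Rn_scaleR Rn_sum v[rule_format])
  also have "\<dots> = (\<Sum>b<d. spread I (\<lambda>i. coord (v i) b))"
    unfolding spread_eq[OF I] by (subst sum.swap) (simp add: coord_sum divide_inverse mult.commute)
  finally show ?thesis .
qed

text \<open>Leaving out the mean only increases the sum of squares, and the Euclidean norm is at
  most the sum norm.\<close>

lemma disagreement_le_sum_norm:
  fixes v :: "'a \<Rightarrow> fseq"
  assumes I: "finite I" "I \<noteq> {}"
  shows "disagreement I v \<le> (\<Sum>i\<in>I. norm (v i))"
proof -
  have "finite (\<Union>i\<in>I. {n. coord (v i) n \<noteq> 0})" using I by simp
  then obtain d where d: "(\<Union>i\<in>I. {n. coord (v i) n \<noteq> 0}) \<subseteq> {..<d}"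
    using finite_nat_iff_bounded by blast
  have v: "\<forall>i\<in>I. v i \<in> Rn d" using d by (force simp: Rn_def)
  have "(disagreement I v)\<^sup>2 \<le> (\<Sum>b<d. \<Sum>i\<in>I. (coord (v i) b)\<^sup>2)"
    unfolding disagreement_sq[OF I v] by (rule sum_mono) (simp add: spread_def)
  also have "\<dots> = (L2_set (\<lambda>i. norm (v i)) I)\<^sup>2"
    by (subst sum.swap) (simp add: L2_set_def sum_nonneg norm_sq_Rn[of _ d] v)
  finally have "disagreement I v \<le> L2_set (\<lambda>i. norm (v i)) I"
    by (rule power2_le_imp_le) simp
  also have "\<dots> \<le> (\<Sum>i\<in>I. norm (v i))" by (rule L2_set_le_sum) auto
  finally show ?thesis .
qed

section \<open>Repeated mixing over the network\<close>

lemma finite_players [simp]: "finite (players g)" and card_players [simp]: "card (players g) = nplayers g"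
  by (auto simp: players_def)

text \<open>The evolution of v under the weight matrices of the times s, ..., s + m - 1, without new
  input.\<close>

primrec mixes :: "'w agg_game \<Rightarrow> nat \<Rightarrow> nat \<Rightarrow> (nat \<Rightarrow> fseq) \<Rightarrow> nat \<Rightarrow> fseq" where
  "mixes g s 0 v = v"
| "mixes g s (Suc m) v = mix g (s + m) (mixes g s m v)"

lemma mixes_add: "mixes g s (m + n) v = mixes g (s + m) n (mixes g s m v)"
  by (induction n) (auto simp: add.assoc)

locale gossip =
  fixes g :: "'w agg_game" and wmin :: real and P :: nat
  assumes net: "network g wmin P" and some_player: "nplayers g \<ge> 1"
begin

abbreviation "N \<equiv> nplayers g"
abbreviation "I \<equiv> players g"
abbreviation "\<beta> \<equiv> conn_param (nplayers g) wmin P"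

lemma players_nonempty: "I \<noteq> {}"
  using some_player by (auto simp: players_def)

lemma weight_nonneg: "i \<in> I \<Longrightarrow> j \<in> I \<Longrightarrow> 0 \<le> weight g k i j"
  and weight_pos_iff: "i \<in> I \<Longrightarrow> j \<in> I \<Longrightarrow> 0 < weight g k i j \<longleftrightarrow> (j, i) \<in> edges g k"
  and weight_row: "i \<in> I \<Longrightarrow> (\<Sum>j\<in>I. weight g k i j) = 1"
  and weight_col: "i \<in> I \<Longrightarrow> (\<Sum>j\<in>I. weight g k j i) = 1"
  and edges_players: "edges g k \<subseteq> I \<times> I"
  and loops: "i \<in> I \<Longrightarrow> (i, i) \<in> edges g k"
  and wmin: "0 < wmin" "wmin < 1"
  and weight_ge: "(j, i) \<in> edges g k \<Longrightarrow> wmin \<le> weight g k i j"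
  and P: "1 \<le> P"
  and conn: "i \<in> I \<Longrightarrow> j \<in> I \<Longrightarrow> (i, j) \<in> (\<Union>l\<in>{1..P}. edges g (k + l))\<^sup>*"
  using net by (auto simp: network_def)

lemma mix_eq:
  assumes "i \<in> I"
  shows "mix g k v i = (\<Sum>j\<in>I. weight g k i j *\<^sub>R v j)"
  unfolding mix_def
proof (rule sum.mono_neutral_left)
  show "\<forall>j\<in>I - {j. (j, i) \<in> edges g k}. weight g k i j *\<^sub>R v j = 0"
  proof
    fix j assume j: "j \<in> I - {j. (j, i) \<in> edges g k}"
    then have "weight g k i j = 0" using weight_nonneg[of i j k] weight_pos_iff[of i j k] assms by force
    then show "weight g k i j *\<^sub>R v j = 0" by simp
  qed
qed (use edges_players in auto)

lemma mix_cong: "(\<And>i. i \<in> I \<Longrightarrow> u i = v i) \<Longrightarrow> mix g k u = mix g k v"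
  unfolding mix_def using edges_players[of k] by (intro ext sum.cong) auto

lemma mix_add: "mix g k (\<lambda>i. u i + v i) i = mix g k u i + mix g k v i"
  by (simp add: mix_def scaleR_add_right sum.distrib)

lemma mix_sum: "mix g k (\<lambda>i. \<Sum>t\<in>T. u t i) i = (\<Sum>t\<in>T. mix g k (u t) i)"
  unfolding mix_def scaleR_sum_right by (rule sum.swap)

lemma sum_mix: "(\<Sum>i\<in>I. mix g k v i) = (\<Sum>i\<in>I. v i)"
  using sum_doubly_stochastic[of I "weight g k" v] weight_col by (simp add: mix_eq)

lemma mix_in_Rn: "(\<And>i. i \<in> I \<Longrightarrow> v i \<in> Rn d) \<Longrightarrow> mix g k v i \<in> Rn d"
  unfolding mix_def using edges_players by (intro Rn_sum Rn_scaleR) auto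

lemma mixes_in_Rn: "(\<And>i. i \<in> I \<Longrightarrow> v i \<in> Rn d) \<Longrightarrow> i \<in> I \<Longrightarrow> mixes g s m v i \<in> Rn d"
  by (induction m arbitrary: i) (auto intro: mix_in_Rn)

lemma coord_mix: "i \<in> I \<Longrightarrow> coord (mix g k v i) b = (\<Sum>j\<in>I. weight g k i j * coord (v j) b)"
  by (simp add: mix_eq coord_sum)

text \<open>Finitely many finitely supported vectors share a dimension, so the coordinatewise
  formula for \<open>disagreement\<close> applies to arbitrary v.\<close>

lemma exists_Rn: "\<exists>d. \<forall>i\<in>I. v i \<in> Rn d"
proof -
  have "finite (\<Union>i\<in>I. {n. coord (v i) n \<noteq> 0})" by simp
  then obtain d where "(\<Union>i\<in>I. {n. coord (v i) n \<noteq> 0}) \<subseteq> {..<d}"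
    using finite_nat_iff_bounded by blast
  then show ?thesis by (intro exI[of _ d]) (force simp: Rn_def)
qed

lemma disagreement_mix_le: "disagreement I (mix g k v) \<le> disagreement I v"
proof -
  obtain d where v: "\<forall>i\<in>I. v i \<in> Rn d" using exists_Rn[of v] by blast
  note I = finite_players players_nonempty
  have mv: "\<forall>i\<in>I. mix g k v i \<in> Rn d" using v mix_in_Rn by blast
  have "(disagreement I (mix g k v))\<^sup>2 \<le> (disagreement I v)\<^sup>2"
    unfolding disagreement_sq[OF I v] disagreement_sq[OF I mv]
  proof (rule sum_mono)
    fix b
    have "spread I (\<lambda>i. coord (mix g k v i) b) = spread I (\<lambda>i. \<Sum>j\<in>I. weight g k i j * coord (v j) b)"
      unfolding spread_def by (simp add: coord_mix)
    also have "\<dots> \<le> spread I (\<lambda>i. coord (v i) b)"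
      by (rule spread_averaging_le) (use weight_nonneg weight_row weight_col in auto)
    finally show "spread I (\<lambda>i. coord (mix g k v i) b) \<le> spread I (\<lambda>i. coord (v i) b)" .
  qed
  then show ?thesis by (rule power2_le_imp_le) simp
qed

lemma disagreement_mixes_le: "disagreement I (mixes g s m v) \<le> disagreement I v"
  by (induction m) (auto intro: order_trans disagreement_mix_le)

text \<open>A path from inside S to outside S in the union graph must use an edge that leaves S. The
  network condition speaks of the times k + 1, ..., k + P, so a window starting at s uses k = s - 1,
  which is where 1 <= s enters.\<close>

lemma window_crossing:
  assumes "1 \<le> s" "S \<subset> I" "S \<noteq> {}"
  shows "\<exists>t<P. \<exists>l\<in>I. \<exists>i\<in>I. 0 < weight g (s + t) l i \<and> (l \<in> S) \<noteq> (i \<in> S)"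
proof -
  let ?E = "\<Union>l\<in>{1..P}. edges g (s - 1 + l)"
  obtain i j where ij: "i \<in> S" "j \<in> I" "j \<notin> S" "i \<in> I" using assms by blast
  have "\<exists>u v. (u, v) \<in> ?E \<and> u \<in> S \<and> v \<notin> S"
    using conn[OF \<open>i \<in> I\<close> \<open>j \<in> I\<close>, of "s - 1"] ij(1,3)
    by (induction rule: rtrancl_induct) blast+
  then obtain u v l where uv: "l \<in> {1..P}" "(u, v) \<in> edges g (s - 1 + l)" "u \<in> S" "v \<notin> S" by blast
  moreover have "u \<in> I" "v \<in> I" using uv edges_players by auto
  moreover have "s - 1 + l = s + (l - 1)" using assms uv by auto
  ultimately show ?thesis using weight_pos_iff[of v u "s - 1 + l"]
    by (intro exI[of _ "l - 1"] conjI bexI[of _ v] bexI[of _ u]) auto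
qed

text \<open>The lower bound 3 / 4 on \<beta>^P keeps the loss from incomplete windows an absolute
  constant, independent of P and N.\<close>

lemma conn_param_power: "\<beta> ^ P = 1 - wmin / (4 * (real N)\<^sup>2)"
  and conn_param_bounds: "3 / 4 \<le> \<beta> ^ P" "0 < \<beta>" "\<beta> < 1"
proof -
  have n: "(real N)\<^sup>2 \<ge> 1" using some_player by simp
  have "wmin / (4 * (real N)\<^sup>2) \<le> 1 / 4"
    using wmin n frac_le[of 1 wmin 1 "(real N)\<^sup>2"] by simp
  moreover have "0 < wmin / (4 * (real N)\<^sup>2)" using wmin some_player by (intro divide_pos_pos) auto
  ultimately have b: "3 / 4 \<le> 1 - wmin / (4 * (real N)\<^sup>2)" "1 - wmin / (4 * (real N)\<^sup>2) < 1" by auto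
  show eq: "\<beta> ^ P = 1 - wmin / (4 * (real N)\<^sup>2)"
  proof -
    have "(x powr (1 / real P)) ^ P = x" if "0 < x" for x
      using that P powr_realpow[of "x powr (1 / real P)" P] by (simp add: powr_powr)
    then show ?thesis using b by (simp add: conn_param_def)
  qed
  show "3 / 4 \<le> \<beta> ^ P" using b eq by simp
  show "0 < \<beta>" using b(1) unfolding conn_param_def powr_gt_zero by linarith
  show "\<beta> < 1" using b(2) eq one_le_power[of "\<beta>" P] by linarith
qed

text \<open>The coordinatewise contraction concerns squared norms, with factor 1 - c for c =
  \<open>wmin\<close> / N^2. As 1 - c <= (1 - c / 4)^2, the norm contracts by 1 - c / 4, which is
  \<beta>^P.\<close>

lemma disagreement_window:
  assumes s: "1 \<le> s"
  shows "disagreement I (mixes g s P v) \<le> \<beta> ^ P * disagreement I v"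
proof -
  obtain d where v: "\<forall>i\<in>I. v i \<in> Rn d" using exists_Rn[of v] by blast
  note I = finite_players players_nonempty
  define c where "c = wmin / (real N)\<^sup>2"
  have c: "1 - c \<le> (1 - c / 4)\<^sup>2"
    using wmin by (simp add: c_def power2_eq_square algebra_simps)
  have bc: "\<beta> ^ P = 1 - c / 4" unfolding conn_param_power c_def by simp
  have mv: "\<forall>i\<in>I. mixes g s P v i \<in> Rn d" using v mixes_in_Rn by blast
  have "(disagreement I (mixes g s P v))\<^sup>2 \<le> (1 - c) * (disagreement I v)\<^sup>2"
    unfolding disagreement_sq[OF I v] disagreement_sq[OF I mv] sum_distrib_left
  proof (rule sum_mono)
    fix b
    have "spread I (\<lambda>i. coord (mixes g s P v i) b)
        \<le> (1 - wmin / (real (card I))\<^sup>2) * spread I (\<lambda>i. coord (mixes g s 0 v i) b)"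
    proof (rule averaging_contraction[where a = "\<lambda>t. weight g (s + t)" and z = "\<lambda>t i. coord (mixes g s t v i) b"])
      show "\<exists>t<P. \<exists>l\<in>I. \<exists>i\<in>I. 0 < weight g (s + t) l i \<and> (l \<in> S) \<noteq> (i \<in> S)"
        if "S \<subset> I" "S \<noteq> {}" for S using window_crossing[OF s that] .
    qed (use players_nonempty weight_nonneg weight_row weight_col wmin weight_ge weight_pos_iff loops in
        \<open>auto simp: coord_mix\<close>)
    then show "spread I (\<lambda>i. coord (mixes g s P v i) b) \<le> (1 - c) * spread I (\<lambda>i. coord (v i) b)"
      by (simp add: c_def)
  qed
  also have "\<dots> \<le> (\<beta> ^ P)\<^sup>2 * (disagreement I v)\<^sup>2"
    unfolding bc by (rule mult_right_mono[OF c]) simp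
  finally have "(disagreement I (mixes g s P v))\<^sup>2 \<le> (\<beta> ^ P * disagreement I v)\<^sup>2"
    by (simp add: power_mult_distrib)
  then show ?thesis by (rule power2_le_imp_le) (use conn_param_bounds in auto)
qed

text \<open>Complete windows contract by \<beta>^P each. The last, incomplete one is only known not
  to expand, which the factor \<beta>^P on the left pays for.\<close>

lemma disagreement_windows:
  assumes s: "1 \<le> s"
  shows "\<beta> ^ P * disagreement I (mixes g s m v) \<le> \<beta> ^ m * disagreement I v"
  using s
proof (induction m arbitrary: s v rule: less_induct)
  case (less m)
  note b = conn_param_bounds
  show ?case
  proof (cases "m < P")
    case True
    then have "\<beta> ^ P \<le> \<beta> ^ m" by (intro power_decreasing) (use b in auto)
    then show ?thesis by (intro mult_mono disagreement_mixes_le) (use b in auto)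
  next
    case False
    then obtain m' where m: "m = P + m'" using le_Suc_ex[of P m] by auto
    have "\<beta> ^ P * disagreement I (mixes g (s + P) m' (mixes g s P v)) \<le> \<beta> ^ m' * disagreement I (mixes g s P v)"
      by (rule less.IH) (use m P less in auto)
    also have "\<dots> \<le> \<beta> ^ m' * (\<beta> ^ P * disagreement I v)"
      by (intro mult_left_mono disagreement_window less) (use b in auto)
    finally show ?thesis unfolding m mixes_add by (simp add: power_add mult_ac)
  qed
qed

text \<open>The connectivity windows start at time 1, so one more factor is lost when \<open>s = 0\<close>.\<close>

lemma disagreement_decay: "disagreement I (mixes g s m v) \<le> 2 * \<beta> ^ m * disagreement I v"
proof -
  note b = conn_param_bounds
  have "\<beta> ^ (P + 1) * disagreement I (mixes g s m v) \<le> \<beta> ^ m * disagreement I v"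
  proof (cases "s = 0 \<and> m \<noteq> 0")
    case True
    then obtain m' where m: "m = 1 + m'" using not0_implies_Suc by force
    have "\<beta> ^ P * disagreement I (mixes g 1 m' (mix g 0 v)) \<le> \<beta> ^ m' * disagreement I (mix g 0 v)"
      by (rule disagreement_windows) simp
    also have "\<dots> \<le> \<beta> ^ m' * disagreement I v"
      by (intro mult_left_mono disagreement_mix_le) (use b in auto)
    finally have "\<beta> * (\<beta> ^ P * disagreement I (mixes g s m v)) \<le> \<beta> * (\<beta> ^ m' * disagreement I v)"
      using True unfolding m mixes_add by (intro mult_left_mono) (use b in auto)
    then show ?thesis by (simp add: m mult_ac)
  next
    case False
    have "\<beta> ^ (P + 1) * disagreement I (mixes g s m v) \<le> \<beta> ^ P * disagreement I (mixes g s m v)"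
      by (intro mult_right_mono power_decreasing) (use b in auto)
    also have "\<dots> \<le> \<beta> ^ m * disagreement I v"
    proof (cases "m = 0")
      case True
      then show ?thesis using b by (simp add: mult_left_le_one_le power_le_one)
    qed (use False disagreement_windows[of s m v] in auto)
    finally show ?thesis .
  qed
  \<comment> \<open>As P + 1 <= 2 P, the power is at least (3 / 4)^2; this is the origin of the
    factor 2.\<close>
  moreover have "1 / 2 \<le> \<beta> ^ (P + 1)"
  proof -
    have "(3 / 4) * (3 / 4 :: real) \<le> \<beta> ^ P * \<beta> ^ P" by (intro mult_mono) (use b in auto)
    also have "\<dots> = \<beta> ^ (P + P)" by (simp add: power_add)
    also have "\<dots> \<le> \<beta> ^ (P + 1)" by (intro power_decreasing) (use b P in auto)
    finally show ?thesis by simp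
  qed
  then have "1 / 2 * disagreement I (mixes g s m v) \<le> \<beta> ^ (P + 1) * disagreement I (mixes g s m v)"
    by (rule mult_right_mono) simp
  ultimately show ?thesis by simp
qed

section \<open>Tracking variables: mixing with inputs\<close>

definition tracking :: "nat \<Rightarrow> nat \<Rightarrow> 'w \<Rightarrow> fseq" where
  "tracking i k \<omega> = snd (state g \<omega> k) i"

definition increment :: "'w \<Rightarrow> nat \<Rightarrow> nat \<Rightarrow> fseq" where
  "increment \<omega> k i = agg g i (iterate g i (Suc k) \<omega>) - agg g i (iterate g i k \<omega>)"

lemma iterate_0: "iterate g i 0 \<omega> = start g i \<omega>"
  and tracking_0: "tracking i 0 \<omega> = agg g i (start g i \<omega>)"
  by (simp_all add: iterate_def tracking_def)

lemma mixed_estimate_eq: "mixed_estimate g i k \<omega> = mix g k (\<lambda>j. tracking j k \<omega>) i"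
  by (simp add: mixed_estimate_def tracking_def)

lemma iterate_Suc:
  "iterate g i (Suc k) \<omega> = euclid_proj (strat g i) (iterate g i k \<omega> - step g i k *\<^sub>R
     (sampled_grad g i (iterate g i k \<omega>) (real N *\<^sub>R mixed_estimate g i k \<omega>) (sample g i k \<omega>)
      + reg g i k *\<^sub>R iterate g i k \<omega>))"
  by (simp add: iterate_def mixed_estimate_def Let_def)

lemma tracking_Suc: "tracking i (Suc k) \<omega> = mixed_estimate g i k \<omega> + increment \<omega> k i"
  by (simp add: tracking_def increment_def iterate_def mixed_estimate_def Let_def)

text \<open>The invariant of aggregate tracking: unit column sums preserve the total, and the
  increments telescope against the start values.\<close>

lemma sum_tracking: "(\<Sum>i\<in>I. tracking i k \<omega>) = (\<Sum>i\<in>I. agg g i (iterate g i k \<omega>))"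
  by (induction k)
    (simp_all add: tracking_0 iterate_0 tracking_Suc sum.distrib mixed_estimate_eq sum_mix increment_def sum_subtractf)

lemma sum_mixed_estimate: "(\<Sum>i\<in>I. mixed_estimate g i k \<omega>) = (\<Sum>i\<in>I. agg g i (iterate g i k \<omega>))"
  by (simp add: mixed_estimate_eq sum_mix sum_tracking)

text \<open>Variation of constants for a linear recursion: the increment of time t enters after the
  mixing of time t, hence is mixed from time t + 1 on.\<close>

lemma tracking_unroll:
  "i \<in> I \<Longrightarrow> tracking i k \<omega> = mixes g 0 k (\<lambda>j. tracking j 0 \<omega>) i
     + (\<Sum>t<k. mixes g (Suc t) (k - Suc t) (increment \<omega> t) i)"
proof (induction k arbitrary: i)
  case (Suc k)
  have "tracking i (Suc k) \<omega> = mix g k (\<lambda>j. tracking j k \<omega>) i + increment \<omega> k i"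
    by (simp add: tracking_Suc mixed_estimate_eq)
  also have "mix g k (\<lambda>j. tracking j k \<omega>)
      = mix g k (\<lambda>i. mixes g 0 k (\<lambda>j. tracking j 0 \<omega>) i + (\<Sum>t<k. mixes g (Suc t) (k - Suc t) (increment \<omega> t) i))"
    by (rule mix_cong) (rule Suc.IH)
  also have "\<dots> i = mixes g 0 (Suc k) (\<lambda>j. tracking j 0 \<omega>) i
      + (\<Sum>t<k. mix g k (mixes g (Suc t) (k - Suc t) (increment \<omega> t)) i)"
    by (simp add: mix_add mix_sum)
  also have "(\<Sum>t<k. mix g k (mixes g (Suc t) (k - Suc t) (increment \<omega> t)) i)
      = (\<Sum>t<k. mixes g (Suc t) (Suc k - Suc t) (increment \<omega> t) i)"
  proof (rule sum.cong[OF refl])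
    fix t assume "t \<in> {..<k}"
    then have "Suc k - Suc t = Suc (k - Suc t)" "Suc t + (k - Suc t) = k" by auto
    then show "mix g k (mixes g (Suc t) (k - Suc t) (increment \<omega> t)) i
        = mixes g (Suc t) (Suc k - Suc t) (increment \<omega> t) i" by simp
  qed
  finally show ?case by (simp add: add.assoc)
qed simp

lemma tracking_disagreement:
  "disagreement I (\<lambda>i. tracking i k \<omega>) \<le> 2 * \<beta> ^ k * disagreement I (\<lambda>i. tracking i 0 \<omega>)
     + 2 * (\<Sum>t<k. \<beta> ^ (k - Suc t) * disagreement I (increment \<omega> t))"
proof -
  have "disagreement I (\<lambda>i. tracking i k \<omega>) = disagreement I (\<lambda>i. mixes g 0 k (\<lambda>j. tracking j 0 \<omega>) i
     + (\<Sum>t<k. mixes g (Suc t) (k - Suc t) (increment \<omega> t) i))"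
    by (rule disagreement_cong) (rule tracking_unroll)
  also have "\<dots> \<le> disagreement I (mixes g 0 k (\<lambda>j. tracking j 0 \<omega>))
      + (\<Sum>t<k. disagreement I (mixes g (Suc t) (k - Suc t) (increment \<omega> t)))"
    by (rule order_trans[OF disagreement_add add_left_mono[OF disagreement_sum]])
  also have "\<dots> \<le> 2 * \<beta> ^ k * disagreement I (\<lambda>i. tracking i 0 \<omega>)
      + (\<Sum>t<k. 2 * \<beta> ^ (k - Suc t) * disagreement I (increment \<omega> t))"
    by (intro add_mono sum_mono disagreement_decay)
  finally show ?thesis by (simp add: sum_distrib_left mult.assoc)
qed

text \<open>By the invariant, the aggregate is N times the average of the mixed estimates, so the
  error of one player is N times its deviation from that average.\<close>

lemma mixed_estimate_error:
  assumes "i \<in> I"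
  shows "norm (real N *\<^sub>R mixed_estimate g i k \<omega> - (\<Sum>j\<in>I. agg g j (iterate g j k \<omega>)))
    \<le> real N * disagreement I (\<lambda>i. tracking i k \<omega>)"
proof -
  have "real N *\<^sub>R mixed_estimate g i k \<omega> - (\<Sum>j\<in>I. agg g j (iterate g j k \<omega>))
      = real N *\<^sub>R (mixed_estimate g i k \<omega> - (\<Sum>j\<in>I. mixed_estimate g j k \<omega>) /\<^sub>R real (card I))"
    using some_player by (simp add: sum_mixed_estimate scaleR_diff_right)
  then have "norm (real N *\<^sub>R mixed_estimate g i k \<omega> - (\<Sum>j\<in>I. agg g j (iterate g j k \<omega>)))
      \<le> real N * disagreement I (\<lambda>i. mixed_estimate g i k \<omega>)"
    using norm_diff_mean_le_disagreement[OF finite_players assms, of "\<lambda>i. mixed_estimate g i k \<omega>"]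
    by (simp add: mult_left_mono)
  also have "\<dots> \<le> real N * disagreement I (\<lambda>i. tracking i k \<omega>)"
    by (intro mult_left_mono) (use disagreement_mix_le[of k "\<lambda>i. tracking i k \<omega>"] in \<open>auto simp: mixed_estimate_eq\<close>)
  finally show ?thesis .
qed

end

section \<open>Regularity and measurability\<close>

lemma jac_transpose_eq:
  assumes "x \<in> Rn d" "(h has_derivative H) (at x within Rn d)"
  shows "jac_transpose d e h x w = (\<Sum>b<e. coord w b *\<^sub>R (\<Sum>c<d. coord (H (fbasis c)) b *\<^sub>R fbasis c))"
proof -
  have "((\<lambda>y. coord (h y) b) has_derivative (\<lambda>y. coord (H y) b)) (at x within Rn d)" for b
    by (rule bounded_linear.has_derivative[OF bounded_linear_coord assms(2)])
  from grad_eqI[OF assms(1) this] show ?thesis by (simp add: jac_transpose_def)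
qed

lemma (in prob_space) integrable_inner_of_squares:
  fixes Y Z :: "'a \<Rightarrow> 'b::{real_inner, second_countable_topology}"
  assumes [measurable]: "Y \<in> borel_measurable M" "Z \<in> borel_measurable M"
    and "integrable M (\<lambda>\<omega>. (norm (Y \<omega>))\<^sup>2)" "integrable M (\<lambda>\<omega>. (norm (Z \<omega>))\<^sup>2)"
  shows "integrable M (\<lambda>\<omega>. inner (Y \<omega>) (Z \<omega>))"
proof (rule Bochner_Integration.integrable_bound)
  show "integrable M (\<lambda>\<omega>. (norm (Y \<omega>))\<^sup>2 + (norm (Z \<omega>))\<^sup>2)" using assms by simp
  have "\<bar>inner a b\<bar> \<le> (norm a)\<^sup>2 + (norm b)\<^sup>2" for a b :: 'b
  proof -
    have "\<bar>inner a b\<bar> \<le> norm a * norm b" by (rule Cauchy_Schwarz_ineq2)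
    also have "\<dots> \<le> (norm a)\<^sup>2 + (norm b)\<^sup>2"
      using sum_squares_bound[of "norm a" "norm b"] mult_nonneg_nonneg[OF norm_ge_zero norm_ge_zero, of a b]
      by linarith
    finally show ?thesis .
  qed
  then show "AE \<omega> in M. norm (inner (Y \<omega>) (Z \<omega>)) \<le> norm ((norm (Y \<omega>))\<^sup>2 + (norm (Z \<omega>))\<^sup>2)" by simp
qed measurable

locale agg_play =
  fixes g :: "'w agg_game" and \<tau> wmin :: real and P :: nat and \<upsilon> lam \<delta> :: "nat \<Rightarrow> real"
  assumes adm: "admissible g \<tau> wmin P \<upsilon> lam \<delta>"

sublocale agg_play \<subseteq> gossip g wmin P
  using adm by unfold_locales (auto simp: admissible_def game_data_def)

sublocale agg_play \<subseteq> prob_space "pspace g"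
  using adm by (auto simp: admissible_def game_data_def)

context agg_play
begin

abbreviation "M \<equiv> pspace g"

lemma strat_Rn: "i \<in> I \<Longrightarrow> strat g i \<subseteq> Rn (sdim g i)"
  and strat_compact: "i \<in> I \<Longrightarrow> compact (strat g i)"
  and strat_convex: "i \<in> I \<Longrightarrow> convex (strat g i)"
  and agg_Rn: "i \<in> I \<Longrightarrow> agg g i ` Rn (sdim g i) \<subseteq> Rn (adim g)"
  and agg_C1: "i \<in> I \<Longrightarrow> cont_diff_on (Rn (sdim g i)) (agg g i)"
  using adm by (auto simp: admissible_def game_data_def)

lemma start_measurable: "i \<in> I \<Longrightarrow> start g i \<in> borel_measurable M"
  and start_strat: "i \<in> I \<Longrightarrow> \<omega> \<in> space M \<Longrightarrow> start g i \<omega> \<in> strat g i"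
  and sample_Rn: "i \<in> I \<Longrightarrow> \<omega> \<in> space M \<Longrightarrow> sample g i k \<omega> \<in> Rn (ndim g i)"
  and error_measurable: "i \<in> I \<Longrightarrow> sampling_error g i k \<in> borel_measurable M"
  and error_cond_exp: "i \<in> I \<Longrightarrow> n < sdim g i \<Longrightarrow> AE \<omega> in M.
     real_cond_exp M (history g k) (\<lambda>\<omega>. coord (sampling_error g i k \<omega>) n) \<omega> = 0"
  and error_cond_var: "i \<in> I \<Longrightarrow> AE \<omega> in M.
     nn_cond_exp M (history g k) (\<lambda>\<omega>. ennreal ((norm (sampling_error g i k \<omega>))\<^sup>2)) \<omega> \<le> ennreal ((\<upsilon> i)\<^sup>2)"
  using adm by (auto simp: admissible_def sampling_scheme_def image_subset_iff)

lemma strat_nonempty: "i \<in> I \<Longrightarrow> strat g i \<noteq> {}"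
  using start_strat not_empty by blast

lemma in_Rn: "i \<in> I \<Longrightarrow> x \<in> strat g i \<Longrightarrow> x \<in> Rn (sdim g i)"
  and agg_in_Rn: "i \<in> I \<Longrightarrow> x \<in> strat g i \<Longrightarrow> agg g i x \<in> Rn (adim g)"
  using strat_Rn agg_Rn by blast+

lemma agg_continuous: "i \<in> I \<Longrightarrow> continuous_on (strat g i) (agg g i)"
  using adm lipschitz_on_continuous_on unfolding admissible_def lipschitz_data_def by blast

section \<open>Derivatives along the strategy sets and the subspaces that contain the play\<close>

lemma agg_derivative:
  assumes "i \<in> I"
  obtains H where "\<And>x. x \<in> Rn (sdim g i) \<Longrightarrow> (agg g i has_derivative blinfun_apply (H x)) (at x within Rn (sdim g i))"
    "continuous_on (Rn (sdim g i)) H"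
  using agg_C1[OF assms] unfolding cont_diff_on_def by blast

lemma cost_derivative:
  assumes i: "i \<in> I"
  obtains L where "\<And>x z. x \<in> strat g i \<Longrightarrow> z \<in> Rn (adim g) \<Longrightarrow>
      ((\<lambda>(x, s). cost g i x s) has_derivative blinfun_apply (L (x, z))) (at (x, z) within Rn (sdim g i) \<times> Rn (adim g))"
    "continuous_on (strat g i \<times> Rn (adim g)) L"
proof -
  obtain U where U: "openin (top_of_set (Rn (sdim g i) \<times> Rn (adim g))) U"
      "strat g i \<times> Rn (adim g) \<subseteq> U" "cont_diff_on U (\<lambda>(x, s). cost g i x s)"
    using adm i unfolding admissible_def smooth_convex_costs_def by blast
  obtain L where L: "\<And>p. p \<in> U \<Longrightarrow> ((\<lambda>(x, s). cost g i x s) has_derivative blinfun_apply (L p)) (at p within U)"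
      "continuous_on U L"
    using U(3) unfolding cont_diff_on_def by blast
  show ?thesis
  proof (rule that)
    show "continuous_on (strat g i \<times> Rn (adim g)) L" using L(2) U(2) by (rule continuous_on_subset)
    fix x z assume "x \<in> strat g i" "z \<in> Rn (adim g)"
    then have "(x, z) \<in> U" using U(2) by auto
    with L(1)[OF this] show "((\<lambda>(x, s). cost g i x s) has_derivative blinfun_apply (L (x, z)))
        (at (x, z) within Rn (sdim g i) \<times> Rn (adim g))"
      by (simp add: at_within_openin[OF U(1)])
  qed
qed

text \<open>\<open>grad\<close> is a definite description, so continuity is proved for an explicit F
  that evaluates the continuous derivatives of \<open>cost\<close> and \<open>agg\<close> on basis
  vectors and coincides with \<open>grad_map\<close>. It serves both measurability along the play
  and the existence of the bounds.\<close>

lemma grad_map_continuous: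
  assumes i: "i \<in> I"
  shows "continuous_on (strat g i \<times> Rn (adim g)) (\<lambda>(x, z). grad_map g i x z)"
proof -
  let ?d = "sdim g i" and ?m = "adim g"
  obtain L where L: "\<And>x z. x \<in> strat g i \<Longrightarrow> z \<in> Rn ?m \<Longrightarrow>
      ((\<lambda>(x, s). cost g i x s) has_derivative blinfun_apply (L (x, z))) (at (x, z) within Rn ?d \<times> Rn ?m)"
    and cL: "continuous_on (strat g i \<times> Rn ?m) L"
    using cost_derivative[OF i] by blast
  obtain H where H: "\<And>x. x \<in> Rn ?d \<Longrightarrow> (agg g i has_derivative blinfun_apply (H x)) (at x within Rn ?d)"
    and cH: "continuous_on (Rn ?d) H"
    using agg_derivative[OF i] by blast
  have cH': "continuous_on (strat g i \<times> Rn ?m) (\<lambda>p. H (fst p))"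
    by (rule continuous_on_compose2[OF cH]) (use strat_Rn[OF i] in \<open>auto intro!: continuous_intros\<close>)
  define w where "w = (\<lambda>p. \<Sum>b<?m. blinfun_apply (L p) (0, fbasis b) *\<^sub>R fbasis b)"
  define F where "F = (\<lambda>p. (\<Sum>c<?d. blinfun_apply (L p) (fbasis c, 0) *\<^sub>R fbasis c)
      + (\<Sum>b<?m. coord (w p) b *\<^sub>R (\<Sum>c<?d. coord (blinfun_apply (H (fst p)) (fbasis c)) b *\<^sub>R fbasis c)))"
  have "F p = (\<lambda>(x, z). grad_map g i x z) p" if mem: "p \<in> strat g i \<times> Rn ?m" for p
  proof -
    obtain x z where p: "p = (x, z)" "x \<in> strat g i" "z \<in> Rn ?m" using mem by auto
    have x: "x \<in> Rn ?d" using in_Rn[OF i p(2)] .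
    note D = has_derivative_partials[OF L[OF p(2,3)] x p(3)]
    show ?thesis
      unfolding p(1) F_def w_def grad_map_def
      by (simp add: grad_eqI[OF x D(1)] grad_eqI[OF p(3) D(2)] jac_transpose_eq[OF x H[OF x]])
  qed
  note eq = this
  have ev: "continuous_on (strat g i \<times> Rn ?m) (\<lambda>p. blinfun_apply (L p) y)"
      "continuous_on (strat g i \<times> Rn ?m) (\<lambda>p. blinfun_apply (H (fst p)) x)" for y x
    using bounded_linear.continuous_on[OF blinfun.bounded_linear_left cL]
      bounded_linear.continuous_on[OF blinfun.bounded_linear_left cH'] by auto
  have w: "continuous_on (strat g i \<times> Rn ?m) w"
    unfolding w_def by (intro continuous_on_sum continuous_on_scaleR continuous_on_const ev(1))
  have "continuous_on (strat g i \<times> Rn ?m) F"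
    unfolding F_def
    by (intro continuous_on_add continuous_on_sum continuous_on_scaleR continuous_on_const
        continuous_on_coord[OF w] ev(1) continuous_on_coord[OF ev(2)])
  then show ?thesis by (rule continuous_on_eq) (rule eq)
qed

lemma jac_transpose_in_Rn:
  assumes i: "i \<in> I" and x: "x \<in> Rn (sdim g i)"
  shows "jac_transpose (sdim g i) e (agg g i) x w \<in> Rn (sdim g i)"
proof -
  obtain H where "(agg g i has_derivative blinfun_apply (H x)) (at x within Rn (sdim g i))"
    using agg_derivative[OF i] x by blast
  from jac_transpose_eq[OF x this] show ?thesis
    by (auto intro!: Rn_sum Rn_scaleR fbasis_in_Rn)
qed

lemma grad_map_in_Rn:
  assumes i: "i \<in> I" and x: "x \<in> strat g i" and z: "z \<in> Rn (adim g)"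
  shows "grad_map g i x z \<in> Rn (sdim g i)"
proof -
  obtain L where L: "((\<lambda>(x, s). cost g i x s) has_derivative blinfun_apply (L (x, z)))
      (at (x, z) within Rn (sdim g i) \<times> Rn (adim g))"
    using cost_derivative[OF i] x z by blast
  have x': "x \<in> Rn (sdim g i)" using in_Rn[OF i x] .
  have "(\<lambda>y. cost g i y z) differentiable (at x within Rn (sdim g i))"
    using has_derivative_partials(1)[OF L x' z] by (auto simp: differentiable_def)
  then show ?thesis unfolding grad_map_def
    by (intro Rn_add grad_in_Rn jac_transpose_in_Rn i x')
qed

lemma sampled_grad_in_Rn:
  assumes i: "i \<in> I" and x: "x \<in> strat g i" and z: "z \<in> Rn (adim g)" and \<xi>: "\<xi> \<in> Rn (ndim g i)"
  shows "sampled_grad g i x z \<xi> \<in> Rn (sdim g i)"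
proof -
  obtain C where C: "openin (top_of_set (Rn (sdim g i))) C" "strat g i \<subseteq> C"
      "(\<lambda>(x, s). loss g i x s \<xi>) differentiable_on (C \<times> Rn (adim g))"
    using adm i \<xi> unfolding admissible_def unbiased_gradients_def by blast
  have x': "x \<in> C" "x \<in> Rn (sdim g i)" using in_Rn[OF i x] C x by auto
  obtain L where "((\<lambda>(x, s). loss g i x s \<xi>) has_derivative L) (at (x, z) within C \<times> Rn (adim g))"
    using C(3) x' z unfolding differentiable_on_def differentiable_def by blast
  from has_derivative_partials(1)[OF this x'(1) z]
  have "(\<lambda>y. loss g i y z \<xi>) differentiable (at x within Rn (sdim g i))"
    by (auto simp: differentiable_def at_within_openin[OF C(1) x'(1)])
  then show ?thesis unfolding sampled_grad_def
    by (intro Rn_add grad_in_Rn jac_transpose_in_Rn i x')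
qed

lemma iterate_in_strat: "i \<in> I \<Longrightarrow> \<omega> \<in> space M \<Longrightarrow> iterate g i k \<omega> \<in> strat g i"
  by (cases k)
    (auto simp: iterate_0 iterate_Suc start_strat intro!: euclid_proj_props strat_compact strat_nonempty)

lemma tracking_in_Rn: "i \<in> I \<Longrightarrow> \<omega> \<in> space M \<Longrightarrow> tracking i k \<omega> \<in> Rn (adim g)"
  by (induction k arbitrary: i)
    (auto simp: tracking_0 tracking_Suc mixed_estimate_eq increment_def
      intro!: agg_in_Rn start_strat Rn_add Rn_diff mix_in_Rn iterate_in_strat)

lemma estimate_in_Rn: "\<omega> \<in> space M \<Longrightarrow> real N *\<^sub>R mixed_estimate g i k \<omega> \<in> Rn (adim g)"
  unfolding mixed_estimate_eq by (intro Rn_scaleR mix_in_Rn tracking_in_Rn)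

lemma sampled_eq: "sampled_grad g i (iterate g i k \<omega>) (real N *\<^sub>R mixed_estimate g i k \<omega>) (sample g i k \<omega>)
    = grad_map g i (iterate g i k \<omega>) (real N *\<^sub>R mixed_estimate g i k \<omega>) + sampling_error g i k \<omega>"
  by (simp add: sampling_error_def Let_def)

text \<open>The sampling scheme controls the conditional mean in the coordinates below
  \<open>sdim g i\<close>; as the error lives in that subspace, this accounts for all its
  coordinates.\<close>

lemma error_in_Rn: "i \<in> I \<Longrightarrow> \<omega> \<in> space M \<Longrightarrow> sampling_error g i k \<omega> \<in> Rn (sdim g i)"
  unfolding sampling_error_def Let_def
  by (intro Rn_diff sampled_grad_in_Rn grad_map_in_Rn iterate_in_strat estimate_in_Rn sample_Rn)

section \<open>The filtration generated by starts and errors\<close>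

lemma space_history [simp]: "space (history g k) = space M"
  unfolding history_def by (rule space_measure_of) auto

lemma sets_history: "sets (history g k) = sigma_sets (space M)
     ({start g i -` A \<inter> space M | i A. i \<in> I \<and> A \<in> sets borel}
      \<union> {sampling_error g i l -` A \<inter> space M | i l A. i \<in> I \<and> l < k \<and> A \<in> sets borel})"
  unfolding history_def by (rule sets_measure_of) auto

lemma subalgebra_history: "subalgebra M (history g k)"
  unfolding subalgebra_def sets_history
  by (auto intro!: sets.sigma_sets_subset measurable_sets[OF start_measurable] measurable_sets[OF error_measurable])

lemma start_history: "i \<in> I \<Longrightarrow> start g i \<in> borel_measurable (history g k)"
  by (rule measurableI) (auto simp only: sets_history space_history UNIV_I space_borel intro!: sigma_sets.Basic)

lemma error_history:
  assumes "i \<in> I" "l < k" shows "sampling_error g i l \<in> borel_measurable (history g k)"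
proof (rule measurableI)
  fix A :: "fseq set" assume "A \<in> sets borel"
  then show "sampling_error g i l -` A \<inter> space (history g k) \<in> sets (history g k)"
    unfolding sets_history space_history using assms by (intro sigma_sets.Basic UnI2) blast
qed auto

lemma history_mono: "k \<le> k' \<Longrightarrow> f \<in> borel_measurable (history g k) \<Longrightarrow> f \<in> borel_measurable (history g k')"
proof -
  assume le: "k \<le> k'" and f: "f \<in> borel_measurable (history g k)"
  have "sets (history g k) \<subseteq> sets (history g k')"
    unfolding sets_history
  proof (intro sigma_sets_mono' Un_mono order_refl)
    show "{sampling_error g i l -` A \<inter> space M | i l A. i \<in> I \<and> l < k \<and> A \<in> sets borel}
        \<subseteq> {sampling_error g i l -` A \<inter> space M | i l A. i \<in> I \<and> l < k' \<and> A \<in> sets borel}"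
      using le less_le_trans by blast
  qed
  then have "subalgebra (history g k') (history g k)" by (simp add: subalgebra_def)
  then show ?thesis using f by (rule measurable_from_subalg)
qed

end

text \<open>The maps applied to the iterates come with continuity on subsets such as the strategy
  sets, so the composition passes through the restricted Borel space.\<close>

lemma borel_measurable_continuous_on_compose:
  assumes "f \<in> borel_measurable F" "\<And>\<omega>. \<omega> \<in> space F \<Longrightarrow> f \<omega> \<in> S" "continuous_on S h"
  shows "(\<lambda>\<omega>. h (f \<omega>)) \<in> borel_measurable F"
proof -
  have f: "f \<in> measurable F (restrict_space borel S)"
    using assms by (intro measurable_restrict_space2) auto
  have h: "h \<in> borel_measurable (restrict_space borel S)"
    using assms by (intro borel_measurable_continuous_on_restrict)
  show ?thesis by (rule measurable_compose[OF f h])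
qed

lemma (in prob_space) expectation_le_sqrt:
  fixes X :: "'a \<Rightarrow> real"
  assumes X: "X \<in> borel_measurable M" "integrable M (\<lambda>\<omega>. (X \<omega>)\<^sup>2)" and le: "expectation (\<lambda>\<omega>. (X \<omega>)\<^sup>2) \<le> v"
  shows "integrable M X" "expectation X \<le> sqrt v"
proof -
  show int: "integrable M X" by (rule square_integrable_imp_integrable[OF X])
  have "0 \<le> variance X" by simp
  then have "(expectation X)\<^sup>2 \<le> expectation (\<lambda>\<omega>. (X \<omega>)\<^sup>2)"
    using variance_eq[OF int X(2)] by simp
  also note le
  finally show "expectation X \<le> sqrt v" by (rule real_le_rsqrt)
qed

context agg_play
begin

lemma sigma_finite_history: "sigma_finite_subalgebra M (history g k)"
  by (rule finite_measure_subalgebra_is_sigma_finite)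
    (intro finite_measure_subalgebra.intro finite_measure_subalgebra_axioms.intro subalgebra_history
      finite_measure_axioms)

text \<open>Adaptedness. The history is generated by starts and errors, not by the samples; writing
  the sampled gradient as \<open>grad_map\<close> plus \<open>sampling_error\<close> makes every
  ingredient of step k measurable at time k + 1. The tracking variables are carried along because
  the gradient is evaluated at their mixtures.\<close>

lemma iterate_tracking_history:
  "(\<forall>i\<in>I. iterate g i k \<in> borel_measurable (history g k)) \<and> (\<forall>i\<in>I. tracking i k \<in> borel_measurable (history g k))"
proof (induction k)
  case 0
  have "(\<lambda>\<omega>. agg g i (start g i \<omega>)) \<in> borel_measurable (history g 0)" if "i \<in> I" for i
    by (rule borel_measurable_continuous_on_compose[OF start_history[OF that] _ agg_continuous[OF that]])
      (use start_strat[OF that] in auto)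
  then show ?case using start_history[of _ 0] by (simp add: iterate_0[abs_def] tracking_0[abs_def])
next
  case (Suc k)
  let ?F = "history g (Suc k)"
  have x: "iterate g i k \<in> borel_measurable ?F" and v: "tracking i k \<in> borel_measurable ?F"
      and e: "sampling_error g i k \<in> borel_measurable ?F" if "i \<in> I" for i
    using Suc that history_mono[of k "Suc k"] error_history[OF that, of k "Suc k"] by auto
  have vh: "mixed_estimate g i k \<in> borel_measurable ?F" if i: "i \<in> I" for i
  proof -
    have "(\<lambda>\<omega>. \<Sum>j\<in>I. weight g k i j *\<^sub>R tracking j k \<omega>) \<in> borel_measurable ?F"
      using v by (intro borel_measurable_sum borel_measurable_scaleR) auto
    then show ?thesis by (simp add: mixed_estimate_eq[abs_def] mix_eq[OF i])
  qed
  have z: "(\<lambda>\<omega>. real N *\<^sub>R mixed_estimate g i k \<omega>) \<in> borel_measurable ?F" if i: "i \<in> I" for i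
    using vh[OF i] by measurable
  have F: "(\<lambda>\<omega>. grad_map g i (iterate g i k \<omega>) (real N *\<^sub>R mixed_estimate g i k \<omega>)) \<in> borel_measurable ?F"
    if i: "i \<in> I" for i
  proof -
    have "(\<lambda>\<omega>. (\<lambda>(x, z). grad_map g i x z) (iterate g i k \<omega>, real N *\<^sub>R mixed_estimate g i k \<omega>)) \<in> borel_measurable ?F"
      by (rule borel_measurable_continuous_on_compose[OF _ _ grad_map_continuous[OF i]])
        (use x[OF i] z[OF i] iterate_in_strat[OF i] estimate_in_Rn in \<open>auto intro: borel_measurable_Pair\<close>)
    then show ?thesis by simp
  qed
  have x': "iterate g i (Suc k) \<in> borel_measurable ?F" if i: "i \<in> I" for i
  proof -
    have [measurable]: "euclid_proj (strat g i) \<in> borel_measurable borel"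
      by (rule borel_measurable_continuous_onI)
        (rule continuous_on_euclid_proj[OF strat_compact[OF i] strat_convex[OF i] strat_nonempty[OF i]])
    note [measurable] = x[OF i] F[OF i] e[OF i]
    show ?thesis unfolding iterate_Suc[abs_def] sampled_eq by measurable
  qed
  have h: "(\<lambda>\<omega>. agg g i (iterate g i l \<omega>)) \<in> borel_measurable ?F"
    if i: "i \<in> I" and "iterate g i l \<in> borel_measurable ?F" for i l
    by (rule borel_measurable_continuous_on_compose[OF that(2) _ agg_continuous[OF i]])
      (use iterate_in_strat[OF i] in auto)
  have "tracking i (Suc k) \<in> borel_measurable ?F" if i: "i \<in> I" for i
    unfolding tracking_Suc[abs_def] increment_def
    using vh[OF i] h[OF i x'[OF i]] h[OF i x[OF i]] by measurable
  with x' show ?case by blast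
qed

lemma iterate_history: "i \<in> I \<Longrightarrow> iterate g i k \<in> borel_measurable (history g k)"
  using iterate_tracking_history by blast

lemma iterate_measurable: "i \<in> I \<Longrightarrow> iterate g i k \<in> borel_measurable M"
  using measurable_from_subalg[OF subalgebra_history iterate_history] .

text \<open>The conditional bound is integrated against the constant 1; in the extended nonnegative
  reals integrability comes out as a result.\<close>

lemma error_second_moment:
  assumes i: "i \<in> I"
  shows "integrable M (\<lambda>\<omega>. (norm (sampling_error g i k \<omega>))\<^sup>2)"
    and "expectation (\<lambda>\<omega>. (norm (sampling_error g i k \<omega>))\<^sup>2) \<le> (\<upsilon> i)\<^sup>2"
proof -
  interpret H: sigma_finite_subalgebra M "history g k" by (rule sigma_finite_history)
  note [measurable] = error_measurable[OF i, of k]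
  let ?f = "\<lambda>\<omega>. ennreal ((norm (sampling_error g i k \<omega>))\<^sup>2)"
  have "(\<integral>\<^sup>+ \<omega>. ?f \<omega> \<partial>M) = (\<integral>\<^sup>+ \<omega>. 1 * nn_cond_exp M (history g k) ?f \<omega> \<partial>M)"
    by (subst H.nn_cond_exp_intg) auto
  also have "\<dots> \<le> (\<integral>\<^sup>+ \<omega>. ennreal ((\<upsilon> i)\<^sup>2) \<partial>M)"
    by (rule nn_integral_mono_AE) (use error_cond_var[OF i, of k] in simp)
  also have "\<dots> = ennreal ((\<upsilon> i)\<^sup>2)" by (simp add: emeasure_space_1)
  finally have le: "(\<integral>\<^sup>+ \<omega>. ?f \<omega> \<partial>M) \<le> ennreal ((\<upsilon> i)\<^sup>2)" .
  show int: "integrable M (\<lambda>\<omega>. (norm (sampling_error g i k \<omega>))\<^sup>2)"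
    by (rule integrableI_bounded) (use le in \<open>auto simp: less_top[symmetric] top_unique\<close>)
  show "expectation (\<lambda>\<omega>. (norm (sampling_error g i k \<omega>))\<^sup>2) \<le> (\<upsilon> i)\<^sup>2"
    using le by (simp add: nn_integral_eq_integral[OF int])
qed

text \<open>A coordinate of Y is measurable for the history and pulls out of the conditional
  expectation, leaving the vanishing conditional mean; square integrability of both factors makes
  the products integrable. Summing the coordinates below \<open>sdim g i\<close> recovers the inner
  product.\<close>

lemma error_orthogonal:
  assumes i: "i \<in> I" and Y: "Y \<in> borel_measurable (history g k)"
    and sq: "integrable M (\<lambda>\<omega>. (norm (Y \<omega>))\<^sup>2)"
  shows "integrable M (\<lambda>\<omega>. inner (Y \<omega>) (sampling_error g i k \<omega>))"
    and "expectation (\<lambda>\<omega>. inner (Y \<omega>) (sampling_error g i k \<omega>)) = 0"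
proof -
  interpret H: sigma_finite_subalgebra M "history g k" by (rule sigma_finite_history)
  note e[measurable] = error_measurable[OF i, of k]
  have Ym[measurable]: "Y \<in> borel_measurable M" by (rule measurable_from_subalg[OF subalgebra_history Y])
  let ?e = "\<lambda>\<omega> n. coord (sampling_error g i k \<omega>) n"
  have coord_sq: "(coord x n)\<^sup>2 \<le> (norm x)\<^sup>2" for x n
    using Cauchy_Schwarz_ineq2[of x "fbasis n"] power_mono[of "\<bar>coord x n\<bar>" "norm x" 2]
    by (simp add: inner_fbasis)
  have int: "integrable M (\<lambda>\<omega>. coord (Y \<omega>) n * ?e \<omega> n)" for n
  proof -
    have "integrable M (\<lambda>\<omega>. inner (coord (Y \<omega>) n) (?e \<omega> n))"
    proof (rule integrable_inner_of_squares)
      show "integrable M (\<lambda>\<omega>. (norm (coord (Y \<omega>) n))\<^sup>2)"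
        by (rule Bochner_Integration.integrable_bound[OF sq]) (simp_all add: coord_sq)
      show "integrable M (\<lambda>\<omega>. (norm (?e \<omega> n))\<^sup>2)"
        by (rule Bochner_Integration.integrable_bound[OF error_second_moment(1)[OF i, of k]]) (simp_all add: coord_sq)
    qed auto
    then show ?thesis by simp
  qed
  have zero: "expectation (\<lambda>\<omega>. coord (Y \<omega>) n * ?e \<omega> n) = 0" if n: "n < sdim g i" for n
  proof -
    have Yn: "(\<lambda>\<omega>. coord (Y \<omega>) n) \<in> borel_measurable (history g k)"
      by (rule measurable_compose[OF Y borel_measurable_coord])
    have en: "(\<lambda>\<omega>. ?e \<omega> n) \<in> borel_measurable M" by measurable
    have "expectation (\<lambda>\<omega>. coord (Y \<omega>) n * ?e \<omega> n)
        = expectation (\<lambda>\<omega>. coord (Y \<omega>) n * real_cond_exp M (history g k) (\<lambda>\<omega>. ?e \<omega> n) \<omega>)"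
      using H.real_cond_exp_intg(2)[OF int Yn en] by simp
    also have "\<dots> = expectation (\<lambda>\<omega>. 0)"
      by (rule integral_cong_AE) (use error_cond_exp[OF i n, of k] in auto)
    finally show ?thesis by simp
  qed
  have eq: "inner (Y \<omega>) (sampling_error g i k \<omega>) = (\<Sum>n<sdim g i. coord (Y \<omega>) n * ?e \<omega> n)"
    if "\<omega> \<in> space M" for \<omega>
    using inner_Rn[OF error_in_Rn[OF i that, of k], of "Y \<omega>"] by (simp add: inner_commute mult.commute)
  have "integrable M (\<lambda>\<omega>. \<Sum>n<sdim g i. coord (Y \<omega>) n * ?e \<omega> n)"
    by (intro Bochner_Integration.integrable_sum int)
  also have "?this \<longleftrightarrow> integrable M (\<lambda>\<omega>. inner (Y \<omega>) (sampling_error g i k \<omega>))"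
    by (rule Bochner_Integration.integrable_cong[OF refl]) (simp add: eq)
  finally show "integrable M (\<lambda>\<omega>. inner (Y \<omega>) (sampling_error g i k \<omega>))" .
  have "expectation (\<lambda>\<omega>. inner (Y \<omega>) (sampling_error g i k \<omega>))
      = expectation (\<lambda>\<omega>. \<Sum>n<sdim g i. coord (Y \<omega>) n * ?e \<omega> n)"
    by (rule Bochner_Integration.integral_cong[OF refl eq])
  also have "\<dots> = 0" using int zero by simp
  finally show "expectation (\<lambda>\<omega>. inner (Y \<omega>) (sampling_error g i k \<omega>)) = 0" .
qed

text \<open>Martingale differences are orthogonal: the partial sum up to K uses errors before K
  only, hence is measurable for \<open>history g K\<close>, and its cross term with the error at K
  has mean zero.\<close>

lemma weighted_error_moment:
  assumes i: "i \<in> I"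
  shows "integrable M (\<lambda>\<omega>. (norm (\<Sum>k<K. a k *\<^sub>R sampling_error g i k \<omega>))\<^sup>2)"
    and "expectation (\<lambda>\<omega>. (norm (\<Sum>k<K. a k *\<^sub>R sampling_error g i k \<omega>))\<^sup>2) \<le> (\<Sum>k<K. (a k)\<^sup>2) * (\<upsilon> i)\<^sup>2"
proof -
  have "integrable M (\<lambda>\<omega>. (norm (\<Sum>k<K. a k *\<^sub>R sampling_error g i k \<omega>))\<^sup>2) \<and>
    expectation (\<lambda>\<omega>. (norm (\<Sum>k<K. a k *\<^sub>R sampling_error g i k \<omega>))\<^sup>2) \<le> (\<Sum>k<K. (a k)\<^sup>2) * (\<upsilon> i)\<^sup>2"
  proof (induction K)
    case (Suc K)
    define Y where "Y = (\<lambda>\<omega>. \<Sum>k<K. a k *\<^sub>R sampling_error g i k \<omega>)"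
    let ?e = "sampling_error g i K"
    have Y: "Y \<in> borel_measurable (history g K)"
      unfolding Y_def using error_history[OF i, of _ K]
      by (intro borel_measurable_sum borel_measurable_scaleR) auto
    have sq: "integrable M (\<lambda>\<omega>. (norm (Y \<omega>))\<^sup>2)" using Suc by (simp add: Y_def)
    note orth = error_orthogonal[OF i Y sq]
    note mom = error_second_moment[OF i, of K]
    have expand: "(norm (u + r *\<^sub>R w))\<^sup>2 = (norm u)\<^sup>2 + 2 * r * inner u w + r\<^sup>2 * (norm w)\<^sup>2"
      for u w :: fseq and r
      unfolding power2_norm_eq_inner
      by (simp add: inner_add_left inner_add_right inner_commute[of w u] power2_eq_square algebra_simps)
    have eq: "(norm (\<Sum>k<Suc K. a k *\<^sub>R sampling_error g i k \<omega>))\<^sup>2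
        = (norm (Y \<omega>))\<^sup>2 + 2 * a K * inner (Y \<omega>) (?e \<omega>) + (a K)\<^sup>2 * (norm (?e \<omega>))\<^sup>2" for \<omega>
      by (simp add: Y_def expand)
    have "expectation (\<lambda>\<omega>. (norm (Y \<omega>))\<^sup>2 + 2 * a K * inner (Y \<omega>) (?e \<omega>) + (a K)\<^sup>2 * (norm (?e \<omega>))\<^sup>2)
        = expectation (\<lambda>\<omega>. (norm (Y \<omega>))\<^sup>2) + (a K)\<^sup>2 * expectation (\<lambda>\<omega>. (norm (?e \<omega>))\<^sup>2)"
      using sq orth mom by simp
    also have "\<dots> \<le> (\<Sum>k<K. (a k)\<^sup>2) * (\<upsilon> i)\<^sup>2 + (a K)\<^sup>2 * (\<upsilon> i)\<^sup>2"
      by (intro add_mono mult_left_mono mom) (use Suc in \<open>auto simp: Y_def\<close>)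
    finally show ?case unfolding eq using sq orth mom by (simp add: distrib_right)
  qed simp
  then show "integrable M (\<lambda>\<omega>. (norm (\<Sum>k<K. a k *\<^sub>R sampling_error g i k \<omega>))\<^sup>2)"
    and "expectation (\<lambda>\<omega>. (norm (\<Sum>k<K. a k *\<^sub>R sampling_error g i k \<omega>))\<^sup>2) \<le> (\<Sum>k<K. (a k)\<^sup>2) * (\<upsilon> i)\<^sup>2"
    by blast+
qed

end

section \<open>Deterministic bounds\<close>

text \<open>The difference of the two sides is the sum of the squared pairwise distances.\<close>

lemma norm_add3_sq_le:
  fixes a b c :: "'a::real_inner"
  shows "(norm (a + b + c))\<^sup>2 \<le> 3 * ((norm a)\<^sup>2 + (norm b)\<^sup>2 + (norm c)\<^sup>2)"
proof -
  have "0 \<le> (norm (a - b))\<^sup>2 + (norm (a - c))\<^sup>2 + (norm (b - c))\<^sup>2" by simp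
  then show ?thesis
    by (simp add: power2_norm_eq_inner inner_add_left inner_add_right inner_diff_left inner_diff_right
        inner_commute[of b a] inner_commute[of c a] inner_commute[of c b])
qed

context agg_play
begin

abbreviation D :: "nat \<Rightarrow> 'w \<Rightarrow> real" where
  "D k \<omega> \<equiv> disagreement I (\<lambda>i. tracking i k \<omega>)"

lemma start_disagreement_le:
  assumes b: "\<And>i x. i \<in> I \<Longrightarrow> x \<in> strat g i \<Longrightarrow> norm (agg g i x) \<le> b" and \<omega>: "\<omega> \<in> space M"
  shows "D 0 \<omega> \<le> real N * b"
proof -
  have "D 0 \<omega> \<le> (\<Sum>i\<in>I. norm (tracking i 0 \<omega>))"
    by (rule disagreement_le_sum_norm[OF finite_players players_nonempty])
  also have "\<dots> \<le> (\<Sum>i\<in>I. b)"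
    by (rule sum_mono) (use b start_strat \<omega> in \<open>auto simp: tracking_0\<close>)
  finally show ?thesis by simp
qed

text \<open>Only the size b of the maps \<open>agg\<close> enters. Since no gradient is involved,
  \<open>constants_exist\<close> can choose the Lipschitz radius of \<open>grad_map\<close> from
  this bound without circularity.\<close>

lemma disagreement_le:
  assumes b: "\<And>i x. i \<in> I \<Longrightarrow> x \<in> strat g i \<Longrightarrow> norm (agg g i x) \<le> b" and \<omega>: "\<omega> \<in> space M"
  shows "D k \<omega> \<le> 6 * real N * b / (1 - \<beta>)"
proof -
  note \<beta> = conn_param_bounds
  obtain i where i: "i \<in> I" using players_nonempty by blast
  have b0: "0 \<le> b" using order_trans[OF norm_ge_zero b[OF i start_strat[OF i \<omega>]]] .
  have inc: "disagreement I (increment \<omega> t) \<le> 2 * real N * b" for t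
  proof -
    have "disagreement I (increment \<omega> t) \<le> (\<Sum>i\<in>I. norm (increment \<omega> t i))"
      by (rule disagreement_le_sum_norm[OF finite_players players_nonempty])
    also have "\<dots> \<le> (\<Sum>i\<in>I. b + b)"
      unfolding increment_def
      by (intro sum_mono norm_triangle_le_diff add_mono b iterate_in_strat \<omega>)
    finally show ?thesis by simp
  qed
  have "D k \<omega> \<le> 2 * \<beta> ^ k * D 0 \<omega> + 2 * (\<Sum>t<k. \<beta> ^ (k - Suc t) * disagreement I (increment \<omega> t))"
    by (rule tracking_disagreement)
  also have "\<dots> \<le> 2 * 1 * (real N * b) + 2 * (\<Sum>t<k. \<beta> ^ (k - Suc t) * (2 * real N * b))"
    by (intro add_mono mult_mono sum_mono start_disagreement_le b inc \<omega>)
      (use \<beta> b0 in \<open>auto intro: power_le_one sum_nonneg mult_nonneg_nonneg\<close>)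
  \<comment> \<open>The start contributes 2 N b; the increments, each of disagreement at most 2 N b
    and doubled by the decay bound, contribute 4 N b. With 1 <= 1 / (1 - \<beta>) this gives the
    factor 6.\<close>
  also have "\<dots> = 2 * (real N * b) + 4 * (real N * b) * (\<Sum>t<k. \<beta> ^ (k - Suc t))"
    by (simp add: sum_distrib_right[symmetric])
  also have "\<dots> \<le> 2 * (real N * b) * (1 / (1 - \<beta>)) + 4 * (real N * b) * (1 / (1 - \<beta>))"
  proof (intro add_mono mult_left_mono)
    have "1 \<le> 1 / (1 - \<beta>)" using \<beta> by (simp add: field_simps)
    then show "2 * (real N * b) \<le> 2 * (real N * b) * (1 / (1 - \<beta>))"
      using b0 mult_left_mono[of 1 "1 / (1 - \<beta>)" "2 * (real N * b)"] by simp
  qed (use \<beta> b0 in \<open>auto intro: sum_power_rev_le\<close>)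
  finally show ?thesis by (simp add: field_simps)
qed

end

text \<open>\<open>agg_play\<close> knows nothing of the dominating constant, so its existence can
  be proved there; here \<kappa> is a given number on which every hidden constant may
  depend.\<close>

locale agg_const = agg_play +
  fixes \<kappa> :: real
  assumes const: "constants_below g \<upsilon> lam \<delta> \<kappa>" and tau: "0 < \<tau>" "\<tau> < 1/4"
begin

lemma const_bounds:
  assumes "i \<in> I"
  shows "x \<in> strat g i \<Longrightarrow> norm x \<le> \<kappa>" "x \<in> strat g i \<Longrightarrow> norm (agg g i x) \<le> \<kappa>"
    "x \<in> strat g i \<Longrightarrow> norm (grad_map g i x 0) \<le> \<kappa>"
    "\<kappa>-lipschitz_on (strat g i) (agg g i)"
    "\<upsilon> i \<le> \<kappa>" "1 / \<kappa> \<le> lam i" "lam i \<le> \<kappa>" "1 / \<kappa> \<le> \<delta> i" "\<delta> i \<le> \<kappa>"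
proof -
  have "(\<forall>x\<in>strat g i. norm x \<le> \<kappa> \<and> norm (agg g i x) \<le> \<kappa> \<and> norm (grad_map g i x 0) \<le> \<kappa>) \<and>
      \<kappa>-lipschitz_on (strat g i) (agg g i) \<and>
      \<upsilon> i \<le> \<kappa> \<and> 1 / \<kappa> \<le> lam i \<and> lam i \<le> \<kappa> \<and> 1 / \<kappa> \<le> \<delta> i \<and> \<delta> i \<le> \<kappa>"
    by (rule bspec[OF conjunct1[OF conjunct2[OF const[unfolded constants_below_def]]] assms])
  then show "x \<in> strat g i \<Longrightarrow> norm x \<le> \<kappa>" "x \<in> strat g i \<Longrightarrow> norm (agg g i x) \<le> \<kappa>"
    "x \<in> strat g i \<Longrightarrow> norm (grad_map g i x 0) \<le> \<kappa>"
    "\<kappa>-lipschitz_on (strat g i) (agg g i)"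
    "\<upsilon> i \<le> \<kappa>" "1 / \<kappa> \<le> lam i" "lam i \<le> \<kappa>" "1 / \<kappa> \<le> \<delta> i" "\<delta> i \<le> \<kappa>"
    by blast+
qed

lemma upsilon_pos: "i \<in> I \<Longrightarrow> 0 < \<upsilon> i"
  using adm unfolding admissible_def unbiased_gradients_def by blast

lemma step_eq: "i \<in> I \<Longrightarrow> step g i k = (real k + lam i) powr (- (1/2 + \<tau>))"
  and reg_eq: "i \<in> I \<Longrightarrow> reg g i k = (real k + \<delta> i) powr (- (1/2 - 2 * \<tau>))"
  using adm unfolding admissible_def power_steps_def by blast+

text \<open>The shifts are bounded by \<kappa> from both sides, so 1 / \<kappa> <= \<kappa>. This
  makes different powers of \<kappa> comparable.\<close>

lemma kappa_ge_1: "1 \<le> \<kappa>"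
proof -
  obtain i where i: "i \<in> I" using players_nonempty by blast
  have k: "0 < \<kappa>" using const by (simp add: constants_below_def)
  have "1 / \<kappa> \<le> \<kappa>" using const_bounds(6,7)[OF i] by linarith
  then have "1 \<le> \<kappa>\<^sup>2" using k by (simp add: field_simps power2_eq_square)
  then show ?thesis using k power2_le_imp_le[of 1 \<kappa>] by simp
qed

lemma kappa_le_sq: "\<kappa> \<le> \<kappa>\<^sup>2"
  using kappa_ge_1 by (simp add: power2_eq_square)

lemma N_ge_1: "1 \<le> real N"
  using some_player by simp

lemma grad_map_lipschitz:
  obtains c where "0 < c" "\<And>x. x \<in> profiles g \<Longrightarrow> norm (aggregate g x) \<le> c"
    "\<And>i k \<omega>. i \<in> I \<Longrightarrow> \<omega> \<in> space M \<Longrightarrow> norm (real N *\<^sub>R mixed_estimate g i k \<omega>) \<le> c"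
    "\<And>i x z z'. i \<in> I \<Longrightarrow> x \<in> strat g i \<Longrightarrow> z \<in> Rn (adim g) \<Longrightarrow> z' \<in> Rn (adim g) \<Longrightarrow> norm z \<le> c \<Longrightarrow> norm z' \<le> c \<Longrightarrow>
       norm (grad_map g i x z - grad_map g i x z') \<le> \<kappa> * norm (z - z')"
proof -
  obtain c where c: "0 < c" "\<forall>x\<in>profiles g. norm (aggregate g x) \<le> c"
    "\<forall>i\<in>I. \<forall>k. \<forall>\<omega>\<in>space M. norm (real N *\<^sub>R mixed_estimate g i k \<omega>) \<le> c"
    and lip: "\<forall>i\<in>I. \<forall>x\<in>strat g i. \<kappa>-lipschitz_on (Rn (adim g) \<inter> cball 0 c) (grad_map g i x)"
    using const unfolding constants_below_def by blast
  have "norm (grad_map g i x z - grad_map g i x z') \<le> \<kappa> * norm (z - z')"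
    if "i \<in> I" "x \<in> strat g i" "z \<in> Rn (adim g)" "z' \<in> Rn (adim g)" "norm z \<le> c" "norm z' \<le> c" for i x z z'
    using lipschitz_onD[OF lip[rule_format, OF that(1,2)], of z z'] that by (simp add: dist_norm)
  then show ?thesis using that c by blast
qed

lemma profile_strat: "y \<in> profiles g \<Longrightarrow> i \<in> I \<Longrightarrow> y i \<in> strat g i"
  by (auto simp: profiles_def)

lemma aggregate_in_Rn: "y \<in> profiles g \<Longrightarrow> aggregate g y \<in> Rn (adim g)"
  unfolding aggregate_def by (intro Rn_sum agg_in_Rn profile_strat)

lemma aggregate_bound:
  assumes "y \<in> profiles g" shows "norm (aggregate g y) \<le> real N * \<kappa>"
proof -
  have "norm (aggregate g y) \<le> (\<Sum>j\<in>I. \<kappa>)"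
    unfolding aggregate_def by (rule sum_norm_le) (use const_bounds profile_strat assms in auto)
  then show ?thesis by simp
qed

text \<open>Size at zero aggregate plus Lipschitz growth up to an aggregate of norm at most N
  \<kappa>, that is \<kappa> + N \<kappa>^2, merged by 1 <= \<kappa> and 1 <= N.\<close>

lemma pseudo_grad_bound:
  assumes y: "y \<in> profiles g" and i: "i \<in> I"
  shows "norm (pseudo_grad g i y) \<le> 2 * \<kappa>\<^sup>2 * real N"
proof -
  obtain c where c: "0 < c" "norm (aggregate g y) \<le> c"
    and lip: "\<And>z z'. z \<in> Rn (adim g) \<Longrightarrow> z' \<in> Rn (adim g) \<Longrightarrow> norm z \<le> c \<Longrightarrow> norm z' \<le> c \<Longrightarrow>
       norm (grad_map g i (y i) z - grad_map g i (y i) z') \<le> \<kappa> * norm (z - z')"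
  proof -
    obtain c where c: "0 < c" "\<And>x. x \<in> profiles g \<Longrightarrow> norm (aggregate g x) \<le> c"
      "\<And>i k \<omega>. i \<in> I \<Longrightarrow> \<omega> \<in> space M \<Longrightarrow> norm (real N *\<^sub>R mixed_estimate g i k \<omega>) \<le> c"
      and lip: "\<And>i x z z'. i \<in> I \<Longrightarrow> x \<in> strat g i \<Longrightarrow> z \<in> Rn (adim g) \<Longrightarrow> z' \<in> Rn (adim g) \<Longrightarrow> norm z \<le> c \<Longrightarrow> norm z' \<le> c \<Longrightarrow>
       norm (grad_map g i x z - grad_map g i x z') \<le> \<kappa> * norm (z - z')"
      by (rule grad_map_lipschitz) (assumption | blast)+
    show ?thesis using that[OF c(1) c(2)[OF y] lip[OF i profile_strat[OF y i]]] .
  qed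
  have "norm (pseudo_grad g i y) \<le> norm (grad_map g i (y i) 0) + norm (pseudo_grad g i y - grad_map g i (y i) 0)"
    by (rule norm_triangle_sub)
  also have "\<dots> \<le> \<kappa> + \<kappa> * (real N * \<kappa>)"
  proof (rule add_mono)
    show "norm (grad_map g i (y i) 0) \<le> \<kappa>" using const_bounds(3)[OF i profile_strat[OF y i]] .
    have "norm (pseudo_grad g i y - grad_map g i (y i) 0) \<le> \<kappa> * norm (aggregate g y - 0)"
      unfolding pseudo_grad_def by (rule lip) (use c aggregate_in_Rn[OF y] in auto)
    also have "\<dots> \<le> \<kappa> * (real N * \<kappa>)"
      using aggregate_bound[OF y] kappa_ge_1 by (intro mult_left_mono) auto
    finally show "norm (pseudo_grad g i y - grad_map g i (y i) 0) \<le> \<kappa> * (real N * \<kappa>)" .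
  qed
  also have "\<dots> \<le> 2 * \<kappa>\<^sup>2 * real N"
  proof -
    have "\<kappa> * 1 * 1 \<le> \<kappa> * \<kappa> * real N"
      by (intro mult_mono) (use kappa_ge_1 N_ge_1 in auto)
    then show ?thesis by (simp add: power2_eq_square algebra_simps)
  qed
  finally show ?thesis .
qed

text \<open>Restricted to the players because \<open>profiles\<close> is an extensional function
  space.\<close>

definition profile_at :: "nat \<Rightarrow> 'a \<Rightarrow> nat \<Rightarrow> fseq" where
  "profile_at k \<omega> = restrict (\<lambda>i. iterate g i k \<omega>) I"

lemma profile_at_in: "\<omega> \<in> space M \<Longrightarrow> profile_at k \<omega> \<in> profiles g"
  by (auto simp: profile_at_def profiles_def iterate_in_strat)

lemma aggregate_profile_at: "aggregate g (profile_at k \<omega>) = (\<Sum>j\<in>I. agg g j (iterate g j k \<omega>))"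
  by (simp add: aggregate_def profile_at_def)

text \<open>The exact aggregate and the estimate both lie in the ball on which \<kappa> is a
  Lipschitz constant of \<open>grad_map\<close>.\<close>

lemma estimate_gradient_error:
  assumes i: "i \<in> I" and \<omega>: "\<omega> \<in> space M"
  shows "norm (pseudo_grad g i (profile_at k \<omega>)
      - grad_map g i (iterate g i k \<omega>) (real N *\<^sub>R mixed_estimate g i k \<omega>)) \<le> \<kappa> * (real N * D k \<omega>)"
proof -
  let ?z = "real N *\<^sub>R mixed_estimate g i k \<omega>" and ?s = "aggregate g (profile_at k \<omega>)"
  have "norm (pseudo_grad g i (profile_at k \<omega>) - grad_map g i (iterate g i k \<omega>) ?z) \<le> \<kappa> * norm (?s - ?z)"
  proof -
    obtain c where c: "0 < c" "\<And>x. x \<in> profiles g \<Longrightarrow> norm (aggregate g x) \<le> c"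
      "\<And>i k \<omega>. i \<in> I \<Longrightarrow> \<omega> \<in> space M \<Longrightarrow> norm (real N *\<^sub>R mixed_estimate g i k \<omega>) \<le> c"
      and lip: "\<And>i x z z'. i \<in> I \<Longrightarrow> x \<in> strat g i \<Longrightarrow> z \<in> Rn (adim g) \<Longrightarrow> z' \<in> Rn (adim g) \<Longrightarrow> norm z \<le> c \<Longrightarrow> norm z' \<le> c \<Longrightarrow>
       norm (grad_map g i x z - grad_map g i x z') \<le> \<kappa> * norm (z - z')"
      by (rule grad_map_lipschitz) (assumption | blast)+
    have "norm (grad_map g i (iterate g i k \<omega>) ?s - grad_map g i (iterate g i k \<omega>) ?z) \<le> \<kappa> * norm (?s - ?z)"
      by (rule lip[OF i iterate_in_strat[OF i \<omega>] aggregate_in_Rn[OF profile_at_in[OF \<omega>]]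
            estimate_in_Rn[OF \<omega>] c(2)[OF profile_at_in[OF \<omega>]] c(3)[OF i \<omega>]])
    then show ?thesis using i by (simp add: pseudo_grad_def profile_at_def)
  qed
  also have "\<dots> \<le> \<kappa> * (real N * D k \<omega>)"
    using mixed_estimate_error[OF i, of k \<omega>] kappa_ge_1
    by (intro mult_left_mono) (auto simp: aggregate_profile_at norm_minus_commute)
  finally show ?thesis .
qed

lemma start_disagreement: "\<omega> \<in> space M \<Longrightarrow> D 0 \<omega> \<le> real N * \<kappa>"
  using start_disagreement_le const_bounds(2) .

lemma disagreement_bound: "\<omega> \<in> space M \<Longrightarrow> D k \<omega> \<le> 6 * real N * \<kappa> / (1 - \<beta>)"
  using disagreement_le const_bounds(2) .

text \<open>The 8 is 2 from \<open>pseudo_grad_bound\<close> plus 6 from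
  \<open>disagreement_bound\<close>, after N <= N^2 / (1 - \<beta>).\<close>

definition grad_bound :: real where "grad_bound = 8 * \<kappa>\<^sup>2 * (real N)\<^sup>2 / (1 - \<beta>)"

lemma grad_bound_ge: "\<kappa>\<^sup>2 \<le> grad_bound" "0 \<le> grad_bound"
proof -
  note b = conn_param_bounds
  have "1 \<le> (real N)\<^sup>2" using N_ge_1 by simp
  then have "1 \<le> 8 * (real N)\<^sup>2 / (1 - \<beta>)" using b by (simp add: field_simps)
  then have "\<kappa>\<^sup>2 * 1 \<le> \<kappa>\<^sup>2 * (8 * (real N)\<^sup>2 / (1 - \<beta>))" by (rule mult_left_mono) simp
  then show "\<kappa>\<^sup>2 \<le> grad_bound" by (simp add: grad_bound_def mult_ac)
  then show "0 \<le> grad_bound" using zero_le_power2 order_trans by blast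
qed

lemma grad_map_bound:
  assumes i: "i \<in> I" and \<omega>: "\<omega> \<in> space M"
  shows "norm (grad_map g i (iterate g i k \<omega>) (real N *\<^sub>R mixed_estimate g i k \<omega>)) \<le> grad_bound"
proof -
  note b = conn_param_bounds
  let ?F = "grad_map g i (iterate g i k \<omega>) (real N *\<^sub>R mixed_estimate g i k \<omega>)"
  have "norm ?F \<le> norm (pseudo_grad g i (profile_at k \<omega>)) + norm (pseudo_grad g i (profile_at k \<omega>) - ?F)"
    using norm_triangle_sub[of ?F "pseudo_grad g i (profile_at k \<omega>)"] by (simp add: norm_minus_commute)
  also have "\<dots> \<le> 2 * \<kappa>\<^sup>2 * real N + \<kappa> * (real N * (6 * real N * \<kappa> / (1 - \<beta>)))"
  proof (intro add_mono pseudo_grad_bound profile_at_in i \<omega>)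
    have "\<kappa> * (real N * D k \<omega>) \<le> \<kappa> * (real N * (6 * real N * \<kappa> / (1 - \<beta>)))"
      by (intro mult_left_mono disagreement_bound \<omega>) (use kappa_ge_1 in auto)
    with estimate_gradient_error[OF i \<omega>, of k]
    show "norm (pseudo_grad g i (profile_at k \<omega>) - ?F) \<le> \<kappa> * (real N * (6 * real N * \<kappa> / (1 - \<beta>)))"
      by (rule order_trans)
  qed
  also have "2 * \<kappa>\<^sup>2 * real N \<le> 2 * \<kappa>\<^sup>2 * ((real N)\<^sup>2 / (1 - \<beta>))"
  proof (rule mult_left_mono)
    have "real N \<le> (real N)\<^sup>2" using N_ge_1 by (simp add: power2_eq_square)
    also have "\<dots> \<le> (real N)\<^sup>2 / (1 - \<beta>)" using b by (simp add: field_simps)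
    finally show "real N \<le> (real N)\<^sup>2 / (1 - \<beta>)" .
  qed simp
  finally show ?thesis by (simp add: grad_bound_def power2_eq_square field_simps)
qed

text \<open>Common envelopes of all step sizes, with the extreme shifts 1 / \<kappa> and \<kappa>
  that \<open>constants_below\<close> allows. They replace the individual steps by decreasing
  sequences that do not depend on the player.\<close>

definition abar :: "nat \<Rightarrow> real" where "abar k = (real k + 1 / \<kappa>) powr (- (1/2 + \<tau>))"
definition alow :: "nat \<Rightarrow> real" where "alow k = (real k + \<kappa>) powr (- (1/2 + \<tau>))"

lemma abar_nonneg: "0 \<le> abar k" and alow_nonneg: "0 \<le> alow k"
  by (simp_all add: abar_def alow_def)

lemma shift_pos: "0 < real k + 1 / \<kappa>"
  using kappa_ge_1 by (intro add_nonneg_pos) auto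

lemma inv_kappa: "0 < 1 / \<kappa>" "1 / \<kappa> \<le> \<kappa>"
  using kappa_ge_1 order_trans[of "1 / \<kappa>" 1 \<kappa>] by auto

lemma step_bounds:
  assumes "i \<in> I" shows "0 < step g i k" "alow k \<le> step g i k" "step g i k \<le> abar k"
proof -
  note l = const_bounds(6,7)[OF assms] inv_kappa
  show "0 < step g i k" unfolding step_eq[OF assms] powr_gt_zero using l by linarith
  show "alow k \<le> step g i k" "step g i k \<le> abar k"
    unfolding step_eq[OF assms] alow_def abar_def by (rule powr_mono2'; use l tau in linarith)+
qed

lemma max_step_bounds: "i \<in> I \<Longrightarrow> step g i k \<le> max_step g k" "alow k \<le> max_step g k" "max_step g k \<le> abar k" "0 < max_step g k"
proof -
  show le: "step g i k \<le> max_step g k" if "i \<in> I" for i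
    unfolding max_step_def using that by (intro Max_ge) auto
  obtain i where i: "i \<in> I" using players_nonempty by blast
  show "alow k \<le> max_step g k" "0 < max_step g k" using le[OF i] step_bounds[OF i, of k] by linarith+
  show "max_step g k \<le> abar k"
    unfolding max_step_def using players_nonempty step_bounds by (intro Max.boundedI) auto
qed

lemma abar_antimono: "abar (Suc k) \<le> abar k"
  unfolding abar_def by (rule powr_mono2'[OF _ shift_pos]) (use tau in auto)

lemma powr_inv_kappa_le:
  assumes "0 \<le> p" "p \<le> 1" shows "(1 / \<kappa>) powr (- p) \<le> \<kappa>"
proof -
  have "(1 / \<kappa>) powr (- p) = \<kappa> powr p"
    using kappa_ge_1 by (simp add: powr_minus powr_divide inverse_eq_divide)
  also have "\<dots> \<le> \<kappa> powr 1" by (rule powr_mono) (use assms kappa_ge_1 in auto)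
  finally show ?thesis using kappa_ge_1 by simp
qed

lemma abar_le: "abar k \<le> \<kappa>"
proof -
  have "abar k \<le> (1 / \<kappa>) powr (- (1/2 + \<tau>))"
    unfolding abar_def using inv_kappa(1) tau by (intro powr_mono2') auto
  also have "\<dots> \<le> \<kappa>" by (rule powr_inv_kappa_le) (use tau in auto)
  finally show ?thesis .
qed

lemma reg_bounds:
  assumes "i \<in> I"
  shows "0 \<le> reg g i k" "reg g i k \<le> (real k + 1 / \<kappa>) powr (- (1/2 - 2 * \<tau>))" "reg g i k \<le> \<kappa>"
proof -
  note l = const_bounds(8,9)[OF assms] inv_kappa
  show "0 \<le> reg g i k" unfolding reg_eq[OF assms] by simp
  show le: "reg g i k \<le> (real k + 1 / \<kappa>) powr (- (1/2 - 2 * \<tau>))"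
    unfolding reg_eq[OF assms] by (rule powr_mono2'; use l tau in linarith)
  also have "\<dots> \<le> (1 / \<kappa>) powr (- (1/2 - 2 * \<tau>))" using inv_kappa(1) tau by (intro powr_mono2') auto
  also have "\<dots> \<le> \<kappa>" by (rule powr_inv_kappa_le) (use tau in auto)
  finally show "reg g i k \<le> \<kappa>" .
qed

definition direction :: "nat \<Rightarrow> nat \<Rightarrow> 'a \<Rightarrow> fseq" where
  "direction i k \<omega> = grad_map g i (iterate g i k \<omega>) (real N *\<^sub>R mixed_estimate g i k \<omega>)
     + sampling_error g i k \<omega> + reg g i k *\<^sub>R iterate g i k \<omega>"

lemma iterate_step: "iterate g i (Suc k) \<omega> = euclid_proj (strat g i) (iterate g i k \<omega> - step g i k *\<^sub>R direction i k \<omega>)"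
  by (simp add: iterate_Suc sampled_eq direction_def)

lemma reg_iterate_bound:
  assumes "i \<in> I" "\<omega> \<in> space M" shows "norm (reg g i k *\<^sub>R iterate g i k \<omega>) \<le> \<kappa>\<^sup>2"
proof -
  have "reg g i k * norm (iterate g i k \<omega>) \<le> \<kappa> * \<kappa>"
    by (intro mult_mono reg_bounds(3) const_bounds(1)[OF assms(1)] iterate_in_strat assms)
      (use kappa_ge_1 in auto)
  then show ?thesis using reg_bounds(1)[OF assms(1), of k] by (simp add: power2_eq_square)
qed

text \<open>The current iterate is fixed by the projection, so nonexpansiveness bounds its move by
  the step times the direction. The regularisation part has norm at most \<kappa>^2 and is absorbed
  in a second copy of \<open>grad_bound\<close>.\<close>

lemma increment_bound:
  assumes \<omega>: "\<omega> \<in> space M"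
  shows "disagreement I (increment \<omega> t) \<le> \<kappa> * abar t * (\<Sum>i\<in>I. 2 * grad_bound + norm (sampling_error g i t \<omega>))"
proof -
  have "disagreement I (increment \<omega> t) \<le> (\<Sum>i\<in>I. norm (increment \<omega> t i))"
    by (rule disagreement_le_sum_norm[OF finite_players players_nonempty])
  also have "\<dots> \<le> (\<Sum>i\<in>I. \<kappa> * abar t * (2 * grad_bound + norm (sampling_error g i t \<omega>)))"
  proof (rule sum_mono)
    fix i assume i: "i \<in> I"
    let ?x = "iterate g i t \<omega>" and ?x' = "iterate g i (Suc t) \<omega>"
    have "norm (increment \<omega> t i) \<le> \<kappa> * norm (?x' - ?x)"
      unfolding increment_def
      using lipschitz_onD[OF const_bounds(4)[OF i] iterate_in_strat[OF i \<omega>] iterate_in_strat[OF i \<omega>], of "Suc t" t]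
      by (simp add: dist_norm)
    also have "norm (?x' - ?x) \<le> norm (?x - step g i t *\<^sub>R direction i t \<omega> - ?x)"
      using euclid_proj_nonexpansive[OF strat_compact[OF i] strat_convex[OF i] strat_nonempty[OF i], of _ ?x]
      by (simp only: iterate_step euclid_proj_self[OF iterate_in_strat[OF i \<omega>]])
    also have "\<dots> = step g i t * norm (direction i t \<omega>)"
      using step_bounds(1)[OF i, of t] by simp
    also have "\<dots> \<le> abar t * (2 * grad_bound + norm (sampling_error g i t \<omega>))"
    proof (rule mult_mono)
      have "norm (direction i t \<omega>) \<le> grad_bound + norm (sampling_error g i t \<omega>) + \<kappa>\<^sup>2"
        unfolding direction_def
        by (intro norm_triangle_mono grad_map_bound reg_iterate_bound i \<omega> order_refl)
      then show "norm (direction i t \<omega>) \<le> 2 * grad_bound + norm (sampling_error g i t \<omega>)" using grad_bound_ge by linarith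
    qed (use step_bounds(3)[OF i] abar_nonneg in auto)
    finally show "norm (increment \<omega> t i) \<le> \<kappa> * abar t * (2 * grad_bound + norm (sampling_error g i t \<omega>))"
      using kappa_ge_1 by (simp add: mult.assoc)
  qed
  finally show ?thesis by (simp add: sum_distrib_left)
qed

text \<open>A contribution from time t is weighted by \<open>abar k\<close> with k > t, which is at
  most \<open>abar t\<close>. Together with the step already contained in the increment this yields
  the summable weight \<open>abar\<close>^2, at the price of a factor 1 / (1 - \<beta>).\<close>

lemma weighted_disagreement:
  assumes \<omega>: "\<omega> \<in> space M"
  shows "(\<Sum>k<K. abar k * D k \<omega>) \<le> 2 * \<kappa>\<^sup>2 * real N / (1 - \<beta>)
     + 2 * \<kappa> / (1 - \<beta>) * (\<Sum>k<K. (abar k)\<^sup>2 * (\<Sum>i\<in>I. 2 * grad_bound + norm (sampling_error g i k \<omega>)))"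
proof -
  note b = conn_param_bounds
  define s where "s = (\<lambda>k. \<kappa> * abar k * (\<Sum>i\<in>I. 2 * grad_bound + norm (sampling_error g i k \<omega>)))"
  have s0: "0 \<le> s k" for k
    unfolding s_def using kappa_ge_1 grad_bound_ge abar_nonneg by (intro mult_nonneg_nonneg sum_nonneg) auto
  have "(\<Sum>k<K. abar k * D k \<omega>)
      \<le> (\<Sum>k<K. abar k * (2 * \<beta> ^ k * (real N * \<kappa>) + 2 * (\<Sum>t<k. \<beta> ^ (k - Suc t) * s t)))"
  proof (intro sum_mono mult_left_mono abar_nonneg)
    fix k
    have "D k \<omega> \<le> 2 * \<beta> ^ k * D 0 \<omega> + 2 * (\<Sum>t<k. \<beta> ^ (k - Suc t) * disagreement I (increment \<omega> t))"
      by (rule tracking_disagreement)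
    also have "\<dots> \<le> 2 * \<beta> ^ k * (real N * \<kappa>) + 2 * (\<Sum>t<k. \<beta> ^ (k - Suc t) * s t)"
      unfolding s_def
      by (intro add_mono mult_left_mono sum_mono start_disagreement increment_bound \<omega>) (use b in auto)
    finally show "D k \<omega> \<le> 2 * \<beta> ^ k * (real N * \<kappa>) + 2 * (\<Sum>t<k. \<beta> ^ (k - Suc t) * s t)" .
  qed
  also have "\<dots> = 2 * (real N * \<kappa>) * (\<Sum>k<K. abar k * \<beta> ^ k)
      + 2 * (\<Sum>k<K. abar k * (\<Sum>t<k. \<beta> ^ (k - Suc t) * s t))"
    by (simp add: distrib_left sum.distrib sum_distrib_left mult_ac)
  also have "\<dots> \<le> 2 * (real N * \<kappa>) * (\<kappa> * (1 / (1 - \<beta>))) + 2 * ((\<Sum>t<K. abar t * s t) / (1 - \<beta>))"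
  proof (intro add_mono mult_left_mono)
    have "(\<Sum>k<K. abar k * \<beta> ^ k) \<le> \<kappa> * (\<Sum>k<K. \<beta> ^ k)"
      unfolding sum_distrib_left by (intro sum_mono mult_right_mono abar_le) (use b in auto)
    also have "\<dots> \<le> \<kappa> * (1 / (1 - \<beta>))"
      by (intro mult_left_mono sum_power_le) (use b kappa_ge_1 in auto)
    finally show "(\<Sum>k<K. abar k * \<beta> ^ k) \<le> \<kappa> * (1 / (1 - \<beta>))" .
    show "(\<Sum>k<K. abar k * (\<Sum>t<k. \<beta> ^ (k - Suc t) * s t)) \<le> (\<Sum>t<K. abar t * s t) / (1 - \<beta>)"
      by (rule sum_geometric_tail_le) (use abar_nonneg abar_antimono s0 b in auto)
  qed (use kappa_ge_1 in auto)
  also have "(\<Sum>t<K. abar t * s t) = \<kappa> * (\<Sum>k<K. (abar k)\<^sup>2 * (\<Sum>i\<in>I. 2 * grad_bound + norm (sampling_error g i k \<omega>)))"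
    unfolding s_def sum_distrib_left[of \<kappa>] by (simp add: power2_eq_square mult_ac)
  finally show ?thesis by (simp add: power2_eq_square mult_ac)
qed

end

section \<open>The gap along a sample path\<close>

text \<open>A bound for the sum of \<open>abar\<close>^2; \<open>reg_const\<close> likewise bounds
  the sum of \<open>abar\<close> times \<open>reg\<close> relative to K^\<tau>. Both depend on
  \<tau> and \<kappa> alone, so constants built from them can be chosen before the game.\<close>

definition step_sq_const :: "real \<Rightarrow> real \<Rightarrow> real" where
  "step_sq_const \<tau> \<kappa> = (1 / \<kappa>) powr (- (1 + 2 * \<tau>)) + (\<Sum>k. real (Suc k) powr (- (1 + 2 * \<tau>)))"

definition reg_const :: "real \<Rightarrow> real \<Rightarrow> real" where
  "reg_const \<tau> \<kappa> = (1 / \<kappa>) powr (\<tau> - 1) + 1 / \<tau>"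

context agg_const
begin

text \<open>Expansion of the squared distance of the projected step to y, which is its own
  projection. Gradient, error and regularisation are separated; the inner product with the error is
  kept exactly, since it is handled only after summation and in expectation.\<close>

lemma projection_step:
  assumes y: "y \<in> profiles g" and i: "i \<in> I" and \<omega>: "\<omega> \<in> space M"
  shows "step g i k * inner (iterate g i k \<omega> - y i) (grad_map g i (iterate g i k \<omega>) (real N *\<^sub>R mixed_estimate g i k \<omega>))
    \<le> ((norm (iterate g i k \<omega> - y i))\<^sup>2 - (norm (iterate g i (Suc k) \<omega> - y i))\<^sup>2) / 2
      - step g i k * inner (iterate g i k \<omega> - y i) (sampling_error g i k \<omega>)
      + 2 * \<kappa>\<^sup>2 * (abar k * reg g i k)
      + 3 / 2 * (abar k)\<^sup>2 * (grad_bound\<^sup>2 + \<kappa> ^ 4 + (norm (sampling_error g i k \<omega>))\<^sup>2)"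
proof -
  define x x' e F s \<eta> where "x = iterate g i k \<omega>" and "x' = iterate g i (Suc k) \<omega>"
    and "e = sampling_error g i k \<omega>"
    and "F = grad_map g i x (real N *\<^sub>R mixed_estimate g i k \<omega>)" and "s = step g i k" and "\<eta> = reg g i k"
  define u d where "u = x - y i" and "d = F + e + \<eta> *\<^sub>R x"
  have xs: "x \<in> strat g i" unfolding x_def by (rule iterate_in_strat[OF i \<omega>])
  have ys: "y i \<in> strat g i" by (rule profile_strat[OF y i])
  have s: "0 < s" "s \<le> abar k" unfolding s_def using step_bounds[OF i] by auto
  have \<eta>: "0 \<le> \<eta>" unfolding \<eta>_def using reg_bounds[OF i] by auto
  have u: "norm u \<le> 2 * \<kappa>"
    using norm_triangle_ineq4[of x "y i"] const_bounds(1)[OF i xs] const_bounds(1)[OF i ys] by (simp add: u_def)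
  have "norm (x' - y i) \<le> norm (x - s *\<^sub>R d - y i)"
    using euclid_proj_nonexpansive[OF strat_compact[OF i] strat_convex[OF i] strat_nonempty[OF i], of "x - s *\<^sub>R d" "y i"]
      iterate_step[of i k \<omega>]
    by (simp add: euclid_proj_self[OF ys] x'_def x_def s_def d_def F_def e_def \<eta>_def direction_def)
  then have "(norm (x' - y i))\<^sup>2 \<le> (norm (x - s *\<^sub>R d - y i))\<^sup>2" by (rule power_mono) simp
  also have "x - s *\<^sub>R d - y i = u - s *\<^sub>R d" by (simp add: u_def)
  also have "(norm (u - s *\<^sub>R d))\<^sup>2 = (norm u)\<^sup>2 - 2 * s * inner u d + s\<^sup>2 * (norm d)\<^sup>2"
    unfolding power2_norm_eq_inner
    by (simp add: inner_diff_left inner_diff_right inner_commute[of d u] power2_eq_square algebra_simps)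
  finally have main: "s * inner u d \<le> ((norm u)\<^sup>2 - (norm (x' - y i))\<^sup>2) / 2 + s\<^sup>2 * (norm d)\<^sup>2 / 2"
    by (simp add: field_simps)
  \<comment> \<open>Cauchy-Schwarz with |u| <= 2 \<kappa> and |x| <= \<kappa> gives the constant 2
    \<kappa>^2.\<close>
  have "- (s * \<eta> * inner u x) \<le> s * \<eta> * (norm u * norm x)"
    using Cauchy_Schwarz_ineq2[of u x] s \<eta>
    by (simp add: mult_left_mono[of "- inner u x" "norm u * norm x" "s * \<eta>", simplified])
  also have "\<dots> \<le> abar k * \<eta> * (2 * \<kappa> * \<kappa>)"
    by (intro mult_mono u const_bounds(1)[OF i xs]) (use s \<eta> kappa_ge_1 in \<open>auto intro: order_trans\<close>)
  finally have reg: "- (s * \<eta> * inner u x) \<le> 2 * \<kappa>\<^sup>2 * (abar k * \<eta>)" by (simp add: power2_eq_square mult_ac)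
  have "(norm d)\<^sup>2 \<le> 3 * ((norm F)\<^sup>2 + (norm e)\<^sup>2 + (norm (\<eta> *\<^sub>R x))\<^sup>2)"
    unfolding d_def by (rule norm_add3_sq_le)
  also have "\<dots> \<le> 3 * (grad_bound\<^sup>2 + (norm e)\<^sup>2 + (\<kappa>\<^sup>2)\<^sup>2)"
    unfolding F_def x_def \<eta>_def
    by (intro mult_left_mono add_mono power_mono order_refl grad_map_bound reg_iterate_bound i \<omega>) auto
  finally have d: "(norm d)\<^sup>2 \<le> 3 * (grad_bound\<^sup>2 + \<kappa> ^ 4 + (norm e)\<^sup>2)" by simp
  have halve: "b * (3 * q) / 2 = 3 / 2 * b * q" for b q :: real by simp
  have "s\<^sup>2 * (norm d)\<^sup>2 / 2 \<le> (abar k)\<^sup>2 * (3 * (grad_bound\<^sup>2 + \<kappa> ^ 4 + (norm e)\<^sup>2)) / 2"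
    by (intro divide_right_mono mult_mono power_mono d) (use s in auto)
  then have "s\<^sup>2 * (norm d)\<^sup>2 / 2 \<le> 3 / 2 * (abar k)\<^sup>2 * (grad_bound\<^sup>2 + \<kappa> ^ 4 + (norm e)\<^sup>2)"
    unfolding halve .
  moreover have "s * inner u d = s * inner u F + s * inner u e + s * \<eta> * inner u x"
    by (simp add: d_def inner_add_right distrib_left)
  ultimately have "s * inner u F \<le> ((norm u)\<^sup>2 - (norm (x' - y i))\<^sup>2) / 2 - s * inner u e
      + 2 * \<kappa>\<^sup>2 * (abar k * \<eta>) + 3 / 2 * (abar k)\<^sup>2 * (grad_bound\<^sup>2 + \<kappa> ^ 4 + (norm e)\<^sup>2)"
    using main reg by linarith
  then show ?thesis by (simp add: u_def x_def x'_def e_def F_def s_def \<eta>_def)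
qed

text \<open>The common weight at the exact pseudo-gradient splits into the player's own step at the
  estimated gradient, the own step at the estimation error, and the excess of the maximal step over
  the own step.\<close>

lemma one_step:
  assumes y: "y \<in> profiles g" and i: "i \<in> I" and \<omega>: "\<omega> \<in> space M"
  shows "max_step g k * inner (iterate g i k \<omega> - y i) (pseudo_grad g i (profile_at k \<omega>))
    \<le> ((norm (iterate g i k \<omega> - y i))\<^sup>2 - (norm (iterate g i (Suc k) \<omega> - y i))\<^sup>2) / 2
      + 4 * \<kappa> ^ 3 * real N * (abar k - alow k)
      + 2 * \<kappa>\<^sup>2 * real N * (abar k * D k \<omega>)
      - step g i k * inner (iterate g i k \<omega> - y i) (sampling_error g i k \<omega>)
      + 2 * \<kappa>\<^sup>2 * (abar k * reg g i k)
      + 3 / 2 * (abar k)\<^sup>2 * (grad_bound\<^sup>2 + \<kappa> ^ 4 + (norm (sampling_error g i k \<omega>))\<^sup>2)"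
proof -
  define x F \<phi> s where "x = iterate g i k \<omega>"
    and "F = grad_map g i x (real N *\<^sub>R mixed_estimate g i k \<omega>)"
    and "\<phi> = pseudo_grad g i (profile_at k \<omega>)" and "s = step g i k"
  define u where "u = x - y i"
  have xs: "x \<in> strat g i" unfolding x_def by (rule iterate_in_strat[OF i \<omega>])
  have ys: "y i \<in> strat g i" by (rule profile_strat[OF y i])
  have u: "norm u \<le> 2 * \<kappa>"
    using norm_triangle_ineq4[of x "y i"] const_bounds(1)[OF i xs] const_bounds(1)[OF i ys] by (simp add: u_def)
  have "(max_step g k - s) * inner u \<phi> \<le> (max_step g k - s) * (norm u * norm \<phi>)"
    using max_step_bounds(1)[OF i, of k] norm_cauchy_schwarz by (intro mult_left_mono) (auto simp: s_def)
  also have "\<dots> \<le> (abar k - alow k) * (2 * \<kappa> * (2 * \<kappa>\<^sup>2 * real N))"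
    unfolding \<phi>_def s_def
    by (intro mult_mono diff_mono u pseudo_grad_bound profile_at_in i \<omega> max_step_bounds step_bounds)
      (use kappa_ge_1 step_bounds[OF i, of k] in \<open>auto intro: order_trans\<close>)
  finally have 1: "(max_step g k - s) * inner u \<phi> \<le> 4 * \<kappa> ^ 3 * real N * (abar k - alow k)"
    by (simp add: power3_eq_cube power2_eq_square mult_ac)
  have "s * inner u (\<phi> - F) \<le> s * (norm u * norm (\<phi> - F))"
    using step_bounds(1)[OF i, of k] norm_cauchy_schwarz by (intro mult_left_mono) (auto simp: s_def)
  also have "\<dots> \<le> abar k * (2 * \<kappa> * (\<kappa> * (real N * D k \<omega>)))"
    unfolding \<phi>_def s_def F_def x_def
    by (intro mult_mono estimate_gradient_error step_bounds u[unfolded x_def] i \<omega>)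
      (use kappa_ge_1 abar_nonneg u in auto)
  finally have 2: "s * inner u (\<phi> - F) \<le> 2 * \<kappa>\<^sup>2 * real N * (abar k * D k \<omega>)"
    by (simp add: power2_eq_square mult_ac)
  have "max_step g k * inner u \<phi> = s * inner u F + s * inner u (\<phi> - F) + (max_step g k - s) * inner u \<phi>"
    by (simp add: inner_diff_right algebra_simps)
  with 1 2 projection_step[OF y i \<omega>, of k] show ?thesis
    by (simp add: u_def x_def F_def \<phi>_def s_def)
qed

text \<open>The two shifts differ by at most m, the ceiling of \<kappa>, so \<open>alow k\<close> is
  at least \<open>abar (k + m)\<close> and the difference telescopes with lag m; the m remaining
  terms are at most \<kappa> each.\<close>

lemma sum_step_gap: "(\<Sum>k<K. abar k - alow k) \<le> (\<kappa> + 1) * \<kappa>"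
proof -
  define m where "m = nat \<lceil>\<kappa>\<rceil>"
  have m: "\<kappa> \<le> real m" "real m \<le> \<kappa> + 1" unfolding m_def using kappa_ge_1 by linarith+
  have "abar (k + m) \<le> alow k" for k
    unfolding abar_def alow_def
    by (rule powr_mono2') (use m tau kappa_ge_1 inv_kappa(1) in linarith)+
  then have "(\<Sum>k<K. abar k - alow k) \<le> (\<Sum>k<K. abar k - abar (k + m))"
    by (intro sum_mono diff_left_mono) auto
  also have "\<dots> \<le> (\<Sum>k<m. abar k)" by (rule sum_shift_difference_le) (rule abar_nonneg)
  also have "\<dots> \<le> (\<Sum>k<m. \<kappa>)" by (intro sum_mono abar_le)
  also have "\<dots> \<le> (\<kappa> + 1) * \<kappa>" using m kappa_ge_1 by (simp add: mult_right_mono)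
  finally show ?thesis .
qed

abbreviation "A2 \<equiv> step_sq_const \<tau> \<kappa>"
abbreviation "A3 \<equiv> reg_const \<tau> \<kappa>"

lemma sum_abar_sq: "(\<Sum>k<K. (abar k)\<^sup>2) \<le> A2"
proof -
  have "(abar k)\<^sup>2 = (real k + 1 / \<kappa>) powr (- (1 + 2 * \<tau>))" for k
    using shift_pos[of k] by (simp add: abar_def power2_eq_square powr_add[symmetric])
  then show ?thesis
    unfolding step_sq_const_def using sum_powr_shift_bounded[OF inv_kappa(1), of "1 + 2 * \<tau>" K] tau by simp
qed

lemma A2_nonneg: "0 \<le> A2"
  using sum_abar_sq[of 0] by simp

lemma sum_abar_reg:
  assumes "i \<in> I" "1 \<le> K"
  shows "(\<Sum>k<K. abar k * reg g i k) \<le> A3 * real K powr \<tau>"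
proof -
  have "(\<Sum>k<K. abar k * reg g i k) \<le> (\<Sum>k<K. (real k + 1 / \<kappa>) powr (\<tau> - 1))"
  proof (rule sum_mono)
    fix k
    have "abar k * reg g i k \<le> abar k * (real k + 1 / \<kappa>) powr (- (1/2 - 2 * \<tau>))"
      by (intro mult_left_mono reg_bounds assms abar_nonneg)
    also have "\<dots> = (real k + 1 / \<kappa>) powr (\<tau> - 1)"
      by (simp add: abar_def powr_add[symmetric])
    finally show "abar k * reg g i k \<le> (real k + 1 / \<kappa>) powr (\<tau> - 1)" .
  qed
  also have "\<dots> \<le> A3 * real K powr \<tau>"
    unfolding reg_const_def by (rule sum_powr_shift_le) (use assms tau inv_kappa in auto)
  finally show ?thesis .
qed

definition tracking_cost :: "nat \<Rightarrow> 'a \<Rightarrow> real" where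
  "tracking_cost K \<omega> = 2 * \<kappa>\<^sup>2 * real N / (1 - \<beta>)
     + 2 * \<kappa> / (1 - \<beta>) * (\<Sum>k<K. (abar k)\<^sup>2 * (\<Sum>i\<in>I. 2 * grad_bound + norm (sampling_error g i k \<omega>)))"

text \<open>Free of y, so that the supremum in the gap is taken path by path before the expectation.
  The first noise sum pairs each error with an iterate of the past and has mean zero; the norm of
  the weighted error sum dominates the pairing with y uniformly in y.\<close>

definition remainder :: "nat \<Rightarrow> nat \<Rightarrow> 'a \<Rightarrow> real" where
  "remainder i K \<omega> = 2 * \<kappa>\<^sup>2 + 4 * \<kappa> ^ 3 * real N * ((\<kappa> + 1) * \<kappa>)
     + 2 * \<kappa>\<^sup>2 * real N * tracking_cost K \<omega>
     + 2 * \<kappa>\<^sup>2 * (A3 * real K powr \<tau>)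
     + 3 / 2 * (\<Sum>k<K. (abar k)\<^sup>2 * (grad_bound\<^sup>2 + \<kappa> ^ 4 + (norm (sampling_error g i k \<omega>))\<^sup>2))
     - (\<Sum>k<K. step g i k * inner (iterate g i k \<omega>) (sampling_error g i k \<omega>))
     + \<kappa> * norm (\<Sum>k<K. step g i k *\<^sub>R sampling_error g i k \<omega>)"

lemma player_sum:
  assumes y: "y \<in> profiles g" and i: "i \<in> I" and \<omega>: "\<omega> \<in> space M" and K: "1 \<le> K"
  shows "(\<Sum>k<K. max_step g k * inner (iterate g i k \<omega> - y i) (pseudo_grad g i (profile_at k \<omega>)))
    \<le> remainder i K \<omega>"
proof -
  let ?x = "\<lambda>k. iterate g i k \<omega>" and ?e = "\<lambda>k. sampling_error g i k \<omega>"
  have xs: "?x k \<in> strat g i" for k by (rule iterate_in_strat[OF i \<omega>])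
  have ys: "y i \<in> strat g i" by (rule profile_strat[OF y i])
  have "(\<Sum>k<K. max_step g k * inner (?x k - y i) (pseudo_grad g i (profile_at k \<omega>)))
    \<le> (\<Sum>k<K. ((norm (?x k - y i))\<^sup>2 - (norm (?x (Suc k) - y i))\<^sup>2) / 2
      + 4 * \<kappa> ^ 3 * real N * (abar k - alow k)
      + 2 * \<kappa>\<^sup>2 * real N * (abar k * D k \<omega>)
      - step g i k * inner (?x k - y i) (?e k)
      + 2 * \<kappa>\<^sup>2 * (abar k * reg g i k)
      + 3 / 2 * (abar k)\<^sup>2 * (grad_bound\<^sup>2 + \<kappa> ^ 4 + (norm (?e k))\<^sup>2))"
    by (intro sum_mono one_step y i \<omega>)
  also have "\<dots> = ((norm (?x 0 - y i))\<^sup>2 - (norm (?x K - y i))\<^sup>2) / 2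
      + 4 * \<kappa> ^ 3 * real N * (\<Sum>k<K. abar k - alow k)
      + 2 * \<kappa>\<^sup>2 * real N * (\<Sum>k<K. abar k * D k \<omega>)
      - (\<Sum>k<K. step g i k * inner (?x k - y i) (?e k))
      + 2 * \<kappa>\<^sup>2 * (\<Sum>k<K. abar k * reg g i k)
      + 3 / 2 * (\<Sum>k<K. (abar k)\<^sup>2 * (grad_bound\<^sup>2 + \<kappa> ^ 4 + (norm (?e k))\<^sup>2))"
    using sum_lessThan_telescope'[of "\<lambda>k. (norm (?x k - y i))\<^sup>2" K]
    by (simp only: sum.distrib sum_subtractf[of "\<lambda>k. _ k + _ k" "\<lambda>k. step g i k * _ k"]
        sum_distrib_left[symmetric] sum_divide_distrib[symmetric] mult.assoc)
  also have "\<dots> \<le> 2 * \<kappa>\<^sup>2 + 4 * \<kappa> ^ 3 * real N * ((\<kappa> + 1) * \<kappa>)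
      + 2 * \<kappa>\<^sup>2 * real N * tracking_cost K \<omega>
      - (\<Sum>k<K. step g i k * inner (?x k - y i) (?e k))
      + 2 * \<kappa>\<^sup>2 * (A3 * real K powr \<tau>)
      + 3 / 2 * (\<Sum>k<K. (abar k)\<^sup>2 * (grad_bound\<^sup>2 + \<kappa> ^ 4 + (norm (?e k))\<^sup>2))"
  proof (intro add_mono diff_mono mult_left_mono order_refl sum_step_gap sum_abar_reg i K)
    have "norm (?x 0 - y i) \<le> 2 * \<kappa>"
      using norm_triangle_ineq4[of "?x 0" "y i"] const_bounds(1)[OF i xs, of 0] const_bounds(1)[OF i ys] by simp
    then have "(norm (?x 0 - y i))\<^sup>2 \<le> (2 * \<kappa>)\<^sup>2" by (rule power_mono) simp
    then have "(norm (?x 0 - y i))\<^sup>2 - (norm (?x K - y i))\<^sup>2 \<le> (2 * \<kappa>)\<^sup>2"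
      using zero_le_power2[of "norm (?x K - y i)"] by linarith
    then show "((norm (?x 0 - y i))\<^sup>2 - (norm (?x K - y i))\<^sup>2) / 2 \<le> 2 * \<kappa>\<^sup>2"
      by (simp add: power_mult_distrib)
    show "(\<Sum>k<K. abar k * D k \<omega>) \<le> tracking_cost K \<omega>"
      unfolding tracking_cost_def by (rule weighted_disagreement[OF \<omega>])
  qed (use kappa_ge_1 in auto)
  also have "\<dots> \<le> remainder i K \<omega>"
  proof -
    have "(\<Sum>k<K. step g i k * inner (?x k - y i) (?e k))
        = (\<Sum>k<K. step g i k * inner (?x k) (?e k)) - inner (y i) (\<Sum>k<K. step g i k *\<^sub>R ?e k)"
      by (simp add: inner_diff_left inner_sum_right right_diff_distrib sum_subtractf)
    moreover have "inner (y i) (\<Sum>k<K. step g i k *\<^sub>R ?e k) \<le> norm (y i) * norm (\<Sum>k<K. step g i k *\<^sub>R ?e k)"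
      by (rule norm_cauchy_schwarz)
    moreover have "\<dots> \<le> \<kappa> * norm (\<Sum>k<K. step g i k *\<^sub>R ?e k)"
      by (intro mult_right_mono const_bounds(1)[OF i ys]) simp
    ultimately show ?thesis unfolding remainder_def by linarith
  qed
  finally show ?thesis .
qed

lemma monotone:
  assumes "x \<in> profiles g" "y \<in> profiles g"
  shows "(\<Sum>i\<in>I. inner (x i - y i) (pseudo_grad g i y)) \<le> (\<Sum>i\<in>I. inner (x i - y i) (pseudo_grad g i x))"
proof -
  have "0 \<le> (\<Sum>i\<in>I. inner (pseudo_grad g i x - pseudo_grad g i y) (x i - y i))"
    using adm assms unfolding admissible_def lipschitz_monotone_def by blast
  then show ?thesis
    by (simp add: inner_commute[of _ "x _ - y _"] inner_diff_right[of "x _ - y _"] sum_subtractf)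
qed

lemma profiles_nonempty: "profiles g \<noteq> {}"
  unfolding profiles_def using strat_nonempty by (simp add: PiE_eq_empty_iff)

lemma sum_max_step_pos: "1 \<le> K \<Longrightarrow> 0 < (\<Sum>k<K. max_step g k)"
  by (rule sum_pos) (use max_step_bounds(4) players_nonempty in \<open>auto simp: lessThan_empty_iff\<close>)

text \<open>For fixed y the expression under the supremum is affine in x, so its value at the
  weighted average is the weighted average of its values at the iterates.\<close>

lemma gap_avg_le:
  assumes \<omega>: "\<omega> \<in> space M" and K: "1 \<le> K"
  shows "gap g (avg_iterate g K \<omega>) \<le> (\<Sum>i\<in>I. remainder i K \<omega>) / (\<Sum>k<K. max_step g k)"
  unfolding gap_def
proof (rule cSUP_least[OF profiles_nonempty])
  fix y assume y: "y \<in> profiles g"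
  define S where "S = (\<Sum>k<K. max_step g k)"
  have S: "0 < S" unfolding S_def by (rule sum_max_step_pos[OF K])
  have avg: "S *\<^sub>R avg_iterate g K \<omega> i = (\<Sum>k<K. max_step g k *\<^sub>R iterate g i k \<omega>)" for i
    using S by (simp add: avg_iterate_def S_def)
  have "S * (\<Sum>i\<in>I. inner (avg_iterate g K \<omega> i - y i) (pseudo_grad g i y))
      = (\<Sum>i\<in>I. inner (S *\<^sub>R avg_iterate g K \<omega> i - S *\<^sub>R y i) (pseudo_grad g i y))"
    by (simp add: sum_distrib_left inner_diff_left right_diff_distrib)
  also have "\<dots> = (\<Sum>i\<in>I. \<Sum>k<K. max_step g k * inner (iterate g i k \<omega> - y i) (pseudo_grad g i y))"
    unfolding avg
    by (simp add: S_def scaleR_sum_left sum_subtractf[symmetric] inner_sum_left inner_diff_left right_diff_distrib)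
  also have "\<dots> = (\<Sum>k<K. max_step g k * (\<Sum>i\<in>I. inner (profile_at k \<omega> i - y i) (pseudo_grad g i y)))"
    by (subst sum.swap) (simp add: sum_distrib_left profile_at_def)
  also have "\<dots> \<le> (\<Sum>k<K. max_step g k * (\<Sum>i\<in>I. inner (profile_at k \<omega> i - y i) (pseudo_grad g i (profile_at k \<omega>))))"
    using max_step_bounds(4) players_nonempty
    by (intro sum_mono mult_left_mono monotone profile_at_in \<omega> y) (auto intro: less_imp_le)
  also have "\<dots> = (\<Sum>i\<in>I. \<Sum>k<K. max_step g k * inner (iterate g i k \<omega> - y i) (pseudo_grad g i (profile_at k \<omega>)))"
    by (subst sum.swap) (simp add: sum_distrib_left profile_at_def)
  also have "\<dots> \<le> (\<Sum>i\<in>I. remainder i K \<omega>)"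
    by (intro sum_mono player_sum y \<omega> K)
  finally show "(\<Sum>i\<in>I. inner (avg_iterate g K \<omega> i - y i) (pseudo_grad g i y))
      \<le> (\<Sum>i\<in>I. remainder i K \<omega>) / (\<Sum>k<K. max_step g k)"
    using S by (simp add: S_def[symmetric] field_simps)
qed

end

section \<open>The expected gap\<close>

text \<open>The truncation at 1 makes the constants positive for every \<open>\<kappa>\<close>.\<close>

definition gap_const1 :: "real \<Rightarrow> real \<Rightarrow> real" where
  "gap_const1 \<tau> \<kappa> = max 1 ((1 + \<kappa>) powr (1/2 + \<tau>) * (2 * \<kappa>\<^sup>2 * reg_const \<tau> \<kappa>))"

definition gap_const2 :: "real \<Rightarrow> real \<Rightarrow> real" where
  "gap_const2 \<tau> \<kappa> = max 1 ((1 + \<kappa>) powr (1/2 + \<tau>) * (2 * \<kappa>\<^sup>2 + 4 * \<kappa> ^ 3 * ((\<kappa> + 1) * \<kappa>) + 4 * \<kappa> ^ 4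
     + 96 * \<kappa> ^ 5 * step_sq_const \<tau> \<kappa> + 288 * \<kappa> ^ 4 * step_sq_const \<tau> \<kappa> + \<kappa>\<^sup>2 * sqrt (step_sq_const \<tau> \<kappa>)))"

context agg_const
begin

lemma error_norm_mean:
  assumes i: "i \<in> I"
  shows "integrable M (\<lambda>\<omega>. norm (sampling_error g i k \<omega>))" "expectation (\<lambda>\<omega>. norm (sampling_error g i k \<omega>)) \<le> \<kappa>"
proof -
  have m: "(\<lambda>\<omega>. norm (sampling_error g i k \<omega>)) \<in> borel_measurable M"
    using error_measurable[OF i] by measurable
  note e = expectation_le_sqrt[OF m error_second_moment[OF i]]
  show "integrable M (\<lambda>\<omega>. norm (sampling_error g i k \<omega>))" by (rule e(1))
  show "expectation (\<lambda>\<omega>. norm (sampling_error g i k \<omega>)) \<le> \<kappa>"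
    using e(2) const_bounds(5)[OF i] upsilon_pos[OF i] by simp
qed

lemma error_sq_mean:
  assumes i: "i \<in> I"
  shows "expectation (\<lambda>\<omega>. (norm (sampling_error g i k \<omega>))\<^sup>2) \<le> \<kappa>\<^sup>2"
  using error_second_moment(2)[OF i, of k] power_mono[OF const_bounds(5)[OF i], of 2] upsilon_pos[OF i] by simp

lemma tracking_cost_mean:
  shows "integrable M (tracking_cost K)"
    "expectation (tracking_cost K) \<le> 2 * \<kappa>\<^sup>2 * real N / (1 - \<beta>) + 2 * \<kappa> / (1 - \<beta>) * (A2 * (real N * (2 * grad_bound + \<kappa>)))"
proof -
  note b = conn_param_bounds
  note e = error_norm_mean
  show "integrable M (tracking_cost K)"
    unfolding tracking_cost_def[abs_def] using e(1) by simp
  have "(\<Sum>k<K. (abar k)\<^sup>2 * (\<Sum>i\<in>I. 2 * grad_bound + expectation (\<lambda>\<omega>. norm (sampling_error g i k \<omega>))))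
      \<le> (\<Sum>k<K. (abar k)\<^sup>2 * (\<Sum>i\<in>I. 2 * grad_bound + \<kappa>))"
    by (intro sum_mono mult_left_mono add_left_mono e(2)) auto
  also have "\<dots> = (\<Sum>k<K. (abar k)\<^sup>2) * (real N * (2 * grad_bound + \<kappa>))" by (simp add: sum_distrib_right)
  also have "\<dots> \<le> A2 * (real N * (2 * grad_bound + \<kappa>))"
    by (intro mult_right_mono sum_abar_sq) (use grad_bound_ge kappa_ge_1 in auto)
  finally have "2 * \<kappa> / (1 - \<beta>) * (\<Sum>k<K. (abar k)\<^sup>2 * (\<Sum>i\<in>I. 2 * grad_bound + expectation (\<lambda>\<omega>. norm (sampling_error g i k \<omega>))))
      \<le> 2 * \<kappa> / (1 - \<beta>) * (A2 * (real N * (2 * grad_bound + \<kappa>)))"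
    by (rule mult_left_mono) (use b kappa_ge_1 in auto)
  moreover have "expectation (tracking_cost K) = 2 * \<kappa>\<^sup>2 * real N / (1 - \<beta>)
      + 2 * \<kappa> / (1 - \<beta>) * (\<Sum>k<K. (abar k)\<^sup>2 * (\<Sum>i\<in>I. 2 * grad_bound + expectation (\<lambda>\<omega>. norm (sampling_error g i k \<omega>))))"
    unfolding tracking_cost_def[abs_def] using e(1) by (simp add: prob_space)
  ultimately show "expectation (tracking_cost K)
      \<le> 2 * \<kappa>\<^sup>2 * real N / (1 - \<beta>) + 2 * \<kappa> / (1 - \<beta>) * (A2 * (real N * (2 * grad_bound + \<kappa>)))" by simp
qed

lemma iterate_sq_integrable:
  assumes i: "i \<in> I"
  shows "integrable M (\<lambda>\<omega>. (norm (iterate g i k \<omega>))\<^sup>2)"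
proof (rule integrable_const_bound)
  show "AE \<omega> in M. norm ((norm (iterate g i k \<omega>))\<^sup>2) \<le> \<kappa>\<^sup>2"
    using const_bounds(1)[OF i iterate_in_strat[OF i]] by (auto intro!: AE_I2 power_mono)
qed (use iterate_measurable[OF i] in measurable)

text \<open>The iterate at time k is bounded and measurable for \<open>history g k\<close>, so its
  pairing with the error has mean zero and drops out. The norm of the error sum is estimated through
  its second moment, with the steps bounded by \<open>abar\<close>.\<close>

lemma remainder_mean:
  assumes i: "i \<in> I"
  shows "integrable M (remainder i K)"
    "expectation (remainder i K) \<le> 2 * \<kappa>\<^sup>2 + 4 * \<kappa> ^ 3 * real N * ((\<kappa> + 1) * \<kappa>)
     + 2 * \<kappa>\<^sup>2 * real N * (2 * \<kappa>\<^sup>2 * real N / (1 - \<beta>) + 2 * \<kappa> / (1 - \<beta>) * (A2 * (real N * (2 * grad_bound + \<kappa>))))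
     + 2 * \<kappa>\<^sup>2 * (A3 * real K powr \<tau>)
     + 3 / 2 * (A2 * (grad_bound\<^sup>2 + \<kappa> ^ 4 + \<kappa>\<^sup>2)) + \<kappa>\<^sup>2 * sqrt A2"
proof -
  let ?e = "sampling_error g i"
  let ?S = "\<lambda>\<omega>. \<Sum>k<K. step g i k *\<^sub>R ?e k \<omega>"
  note e2 = error_second_moment(1)[OF i] error_sq_mean[OF i]
  note orth = error_orthogonal[OF i iterate_history[OF i] iterate_sq_integrable[OF i]]
  have Sm: "(\<lambda>\<omega>. norm (?S \<omega>)) \<in> borel_measurable M"
    using error_measurable[OF i] by measurable
  have "(\<Sum>k<K. (step g i k)\<^sup>2) * (\<upsilon> i)\<^sup>2 \<le> A2 * \<kappa>\<^sup>2"
  proof (intro mult_mono order_trans[OF _ sum_abar_sq[of K]] sum_mono power_mono)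
  qed (use step_bounds[OF i] const_bounds(5)[OF i] upsilon_pos[OF i] A2_nonneg in \<open>auto intro: less_imp_le sum_nonneg\<close>)
  note S = expectation_le_sqrt[OF Sm weighted_error_moment(1)[OF i] order_trans[OF weighted_error_moment(2)[OF i] this]]
  have S2: "expectation (\<lambda>\<omega>. norm (?S \<omega>)) \<le> \<kappa> * sqrt A2"
    using S(2) kappa_ge_1 by (simp add: real_sqrt_mult mult.commute)
  show "integrable M (remainder i K)"
    unfolding remainder_def[abs_def] using tracking_cost_mean(1) e2 orth S by simp
  have "expectation (remainder i K) = 2 * \<kappa>\<^sup>2 + 4 * \<kappa> ^ 3 * real N * ((\<kappa> + 1) * \<kappa>)
     + 2 * \<kappa>\<^sup>2 * real N * expectation (tracking_cost K)
     + 2 * \<kappa>\<^sup>2 * (A3 * real K powr \<tau>)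
     + 3 / 2 * (\<Sum>k<K. (abar k)\<^sup>2 * (grad_bound\<^sup>2 + \<kappa> ^ 4 + expectation (\<lambda>\<omega>. (norm (?e k \<omega>))\<^sup>2)))
     + \<kappa> * expectation (\<lambda>\<omega>. norm (?S \<omega>))"
    unfolding remainder_def[abs_def] using tracking_cost_mean(1) e2 orth S by (simp add: prob_space)
  also have "\<dots> \<le> 2 * \<kappa>\<^sup>2 + 4 * \<kappa> ^ 3 * real N * ((\<kappa> + 1) * \<kappa>)
     + 2 * \<kappa>\<^sup>2 * real N * (2 * \<kappa>\<^sup>2 * real N / (1 - \<beta>) + 2 * \<kappa> / (1 - \<beta>) * (A2 * (real N * (2 * grad_bound + \<kappa>))))
     + 2 * \<kappa>\<^sup>2 * (A3 * real K powr \<tau>)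
     + 3 / 2 * (A2 * (grad_bound\<^sup>2 + \<kappa> ^ 4 + \<kappa>\<^sup>2)) + \<kappa> * (\<kappa> * sqrt A2)"
  proof (intro add_mono mult_left_mono order_refl tracking_cost_mean S2)
    have "(\<Sum>k<K. (abar k)\<^sup>2 * (grad_bound\<^sup>2 + \<kappa> ^ 4 + expectation (\<lambda>\<omega>. (norm (?e k \<omega>))\<^sup>2)))
        \<le> (\<Sum>k<K. (abar k)\<^sup>2 * (grad_bound\<^sup>2 + \<kappa> ^ 4 + \<kappa>\<^sup>2))"
      by (intro sum_mono mult_left_mono add_left_mono e2) auto
    also have "\<dots> = (\<Sum>k<K. (abar k)\<^sup>2) * (grad_bound\<^sup>2 + \<kappa> ^ 4 + \<kappa>\<^sup>2)" by (simp add: sum_distrib_right)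
    also have "\<dots> \<le> A2 * (grad_bound\<^sup>2 + \<kappa> ^ 4 + \<kappa>\<^sup>2)"
      by (intro mult_right_mono sum_abar_sq) (use kappa_ge_1 in auto)
    finally show "(\<Sum>k<K. (abar k)\<^sup>2 * (grad_bound\<^sup>2 + \<kappa> ^ 4 + expectation (\<lambda>\<omega>. (norm (?e k \<omega>))\<^sup>2)))
        \<le> A2 * (grad_bound\<^sup>2 + \<kappa> ^ 4 + \<kappa>\<^sup>2)" .
  qed (use kappa_ge_1 tau in \<open>auto simp: reg_const_def\<close>)
  finally show "expectation (remainder i K) \<le> 2 * \<kappa>\<^sup>2 + 4 * \<kappa> ^ 3 * real N * ((\<kappa> + 1) * \<kappa>)
     + 2 * \<kappa>\<^sup>2 * real N * (2 * \<kappa>\<^sup>2 * real N / (1 - \<beta>) + 2 * \<kappa> / (1 - \<beta>) * (A2 * (real N * (2 * grad_bound + \<kappa>))))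
     + 2 * \<kappa>\<^sup>2 * (A3 * real K powr \<tau>)
     + 3 / 2 * (A2 * (grad_bound\<^sup>2 + \<kappa> ^ 4 + \<kappa>\<^sup>2)) + \<kappa>\<^sup>2 * sqrt A2"
    by (simp add: power2_eq_square)
qed

section \<open>Boundedness, measurability and integrability of the gap\<close>

lemma gap_terms_bound:
  assumes y: "y \<in> profiles g"
  shows "\<bar>\<Sum>i\<in>I. inner (x i - y i) (pseudo_grad g i y)\<bar> \<le> (\<Sum>i\<in>I. (norm (x i) + \<kappa>) * (2 * \<kappa>\<^sup>2 * real N))"
proof (rule order_trans[OF sum_abs sum_mono])
  fix i assume i: "i \<in> I"
  have "\<bar>inner (x i - y i) (pseudo_grad g i y)\<bar> \<le> norm (x i - y i) * norm (pseudo_grad g i y)"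
    by (rule Cauchy_Schwarz_ineq2)
  also have "\<dots> \<le> (norm (x i) + \<kappa>) * (2 * \<kappa>\<^sup>2 * real N)"
  proof (intro mult_mono pseudo_grad_bound y i)
    show "norm (x i - y i) \<le> norm (x i) + \<kappa>"
      using norm_triangle_ineq4[of "x i" "y i"] const_bounds(1)[OF i profile_strat[OF y i]] by linarith
  qed (use kappa_ge_1 in auto)
  finally show "\<bar>inner (x i - y i) (pseudo_grad g i y)\<bar> \<le> (norm (x i) + \<kappa>) * (2 * \<kappa>\<^sup>2 * real N)" .
qed

text \<open>A supremum of reals over an unbounded set would carry no information; the bound in terms
  of x alone makes \<open>gap\<close> a genuine supremum at every x.\<close>

lemma gap_bdd_above:
  "bdd_above ((\<lambda>y. \<Sum>i\<in>I. inner (x i - y i) (pseudo_grad g i y)) ` profiles g)"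
proof (rule bdd_aboveI2)
  fix y assume "y \<in> profiles g"
  from gap_terms_bound[OF this, of x]
  show "(\<Sum>i\<in>I. inner (x i - y i) (pseudo_grad g i y)) \<le> (\<Sum>i\<in>I. (norm (x i) + \<kappa>) * (2 * \<kappa>\<^sup>2 * real N))"
    by linarith
qed

lemma avg_iterate_measurable:
  assumes i: "i \<in> I" shows "(\<lambda>\<omega>. avg_iterate g K \<omega> i) \<in> borel_measurable M"
  unfolding avg_iterate_def using iterate_measurable[OF i] by measurable

text \<open>
  The gap is lower semicontinuous in the product topology, as a supremum of continuous functions.
\<close>

lemma gap_measurable: "(\<lambda>\<omega>. gap g (avg_iterate g K \<omega>)) \<in> borel_measurable M"
  unfolding borel_measurable_iff_greater
proof
  fix a
  \<comment> \<open>Set to zero outside the players, so that every coordinate is measurable; the gap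
    reads the players only.\<close>
  define T where "T = (\<lambda>\<omega> i. if i \<in> I then avg_iterate g K \<omega> i else 0)"
  define U where "U = (\<Union>y\<in>profiles g. {x :: nat \<Rightarrow> fseq. a < (\<Sum>i\<in>I. inner (x i - y i) (pseudo_grad g i y))})"
  have T: "T \<in> borel_measurable M"
  proof (rule measurable_coordinatewise_then_product)
    show "(\<lambda>\<omega>. T \<omega> i) \<in> borel_measurable M" for i
      using avg_iterate_measurable[of i K] by (cases "i \<in> I") (auto simp: T_def)
  qed
  have "open U"
    unfolding U_def
    by (intro open_UN ballI open_Collect_less continuous_intros continuous_on_product_coordinates)
  then have "T -` U \<inter> space M \<in> sets M" by (intro measurable_sets[OF T]) auto
  also have "T -` U \<inter> space M = {\<omega> \<in> space M. a < gap g (avg_iterate g K \<omega>)}"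
    unfolding gap_def less_cSUP_iff[OF profiles_nonempty gap_bdd_above] by (auto simp: U_def T_def)
  finally show "{\<omega> \<in> space M. a < gap g (avg_iterate g K \<omega>)} \<in> sets M" .
qed

lemma avg_iterate_bound:
  assumes i: "i \<in> I" and \<omega>: "\<omega> \<in> space M" and K: "1 \<le> K"
  shows "norm (avg_iterate g K \<omega> i) \<le> \<kappa>"
proof -
  note S = sum_max_step_pos[OF K]
  have "norm (\<Sum>p<K. max_step g p *\<^sub>R iterate g i p \<omega>) \<le> (\<Sum>p<K. max_step g p * \<kappa>)"
    by (rule sum_norm_le)
      (use const_bounds(1)[OF i iterate_in_strat[OF i \<omega>]] max_step_bounds(4) i in
        \<open>auto intro!: mult_mono intro: less_imp_le simp: abs_of_pos\<close>)
  also have "\<dots> = (\<Sum>p<K. max_step g p) * \<kappa>" by (simp add: sum_distrib_right)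
  finally show ?thesis using S by (simp add: avg_iterate_def field_simps)
qed

text \<open>Bounded on both sides: from above by the uniform bound for the terms, from below by
  evaluating at one arbitrary y.\<close>

lemma gap_integrable:
  assumes K: "1 \<le> K" shows "integrable M (\<lambda>\<omega>. gap g (avg_iterate g K \<omega>))"
proof (rule integrable_const_bound[OF _ gap_measurable])
  let ?c = "\<Sum>i\<in>I. (\<kappa> + \<kappa>) * (2 * \<kappa>\<^sup>2 * real N)"
  show "AE \<omega> in M. norm (gap g (avg_iterate g K \<omega>)) \<le> ?c"
  proof (rule AE_I2)
    fix \<omega> assume \<omega>: "\<omega> \<in> space M"
    have le: "\<bar>\<Sum>i\<in>I. inner (avg_iterate g K \<omega> i - y i) (pseudo_grad g i y)\<bar> \<le> ?c" if y: "y \<in> profiles g" for y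
      using gap_terms_bound[OF y]
      by (rule order_trans) (intro sum_mono mult_right_mono add_right_mono avg_iterate_bound \<omega> K, auto)
    obtain y where y: "y \<in> profiles g" using profiles_nonempty by blast
    have "- ?c \<le> (\<Sum>i\<in>I. inner (avg_iterate g K \<omega> i - y i) (pseudo_grad g i y))"
      using le[OF y] by linarith
    also have "\<dots> \<le> gap g (avg_iterate g K \<omega>)"
      unfolding gap_def by (rule cSUP_upper[OF y gap_bdd_above])
    finally have "- ?c \<le> gap g (avg_iterate g K \<omega>)" .
    moreover have "gap g (avg_iterate g K \<omega>) \<le> ?c"
      unfolding gap_def by (rule cSUP_least[OF profiles_nonempty]) (use le in \<open>auto simp: abs_le_iff\<close>)
    ultimately show "norm (gap g (avg_iterate g K \<omega>)) \<le> ?c" unfolding real_norm_def by (intro abs_leI) linarith+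
  qed
qed

section \<open>Assembling the rate\<close>

lemma sum_max_step_ge:
  assumes "1 \<le> K"
  shows "(1 + \<kappa>) powr (- (1/2 + \<tau>)) * real K powr (1/2 - \<tau>) \<le> (\<Sum>k<K. max_step g k)"
proof -
  have "(1 + \<kappa>) powr (- (1/2 + \<tau>)) * real K powr (1 - (1/2 + \<tau>)) \<le> (\<Sum>k<K. (real k + \<kappa> + 1) powr (- (1/2 + \<tau>)))"
    by (rule sum_powr_ge) (use assms tau kappa_ge_1 in auto)
  also have "\<dots> \<le> (\<Sum>k<K. max_step g k)"
  proof (rule sum_mono)
    fix k
    have "(real k + \<kappa> + 1) powr (- (1/2 + \<tau>)) \<le> alow k"
      unfolding alow_def by (rule powr_mono2') (use tau kappa_ge_1 in auto)
    moreover obtain i where "i \<in> I" using players_nonempty by blast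
    ultimately show "(real k + \<kappa> + 1) powr (- (1/2 + \<tau>)) \<le> max_step g k"
      using max_step_bounds(2)[of k] by linarith
  qed
  finally show ?thesis by simp
qed

abbreviation Q :: real where "Q \<equiv> real N ^ 5 / (1 - \<beta>)\<^sup>2"

lemma N_power_le_Q:
  assumes "n \<le> 5" "j \<le> 2"
  shows "real N ^ n / (1 - \<beta>) ^ j \<le> Q"
proof (rule frac_le)
  note b = conn_param_bounds
  show "real N ^ n \<le> real N ^ 5" by (rule power_increasing[OF assms(1) N_ge_1])
  show "(1 - \<beta>)\<^sup>2 \<le> (1 - \<beta>) ^ j" by (rule power_decreasing[OF assms(2)]) (use b in auto)
qed (use conn_param_bounds in auto)

text \<open>Power counting. The tracking term \<open>t4\<close> collects one N from the sum over
  players, one from scaling the average to the aggregate, one from the summed increments and N^2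
  from \<open>grad_bound\<close>, with one 1 / (1 - \<beta>) from \<open>grad_bound\<close> and one
  from the convolution; \<open>t5\<close> is N times \<open>grad_bound\<close>^2. Both reach N^5 /
  (1 - \<beta>)^2, and the other terms bounded in K have lower powers. The regularisation term alone
  grows with K and is kept apart.\<close>

lemma remainder_total:
  assumes K: "1 \<le> K"
  shows "(\<Sum>i\<in>I. expectation (remainder i K)) \<le> 2 * \<kappa>\<^sup>2 * A3 * (real N * real K powr \<tau>)
    + (2 * \<kappa>\<^sup>2 + 4 * \<kappa> ^ 3 * ((\<kappa> + 1) * \<kappa>) + 4 * \<kappa> ^ 4 + 96 * \<kappa> ^ 5 * A2 + 288 * \<kappa> ^ 4 * A2 + \<kappa>\<^sup>2 * sqrt A2) * Q"
proof -
  define r where "r = 1 / (1 - \<beta>)"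
  have r: "1 \<le> r" using conn_param_bounds by (simp add: r_def)
  define n where "n = real N"
  have n: "1 \<le> n" using N_ge_1 by (simp add: n_def)
  have grad_bound: "grad_bound = 8 * \<kappa>\<^sup>2 * n\<^sup>2 * r" by (simp add: grad_bound_def n_def r_def)
  have Q: "n ^ p * r ^ j \<le> Q" if "p \<le> 5" "j \<le> 2" for p j
    using N_power_le_Q[OF that] by (simp add: n_def r_def power_divide)
  have k2: "\<kappa> \<le> grad_bound" using grad_bound_ge(1) kappa_le_sq by linarith
  have B2: "\<kappa> ^ 4 \<le> grad_bound\<^sup>2" using power_mono[OF grad_bound_ge(1), of 2] by simp
  have k2': "\<kappa>\<^sup>2 \<le> grad_bound\<^sup>2" using power_mono[OF k2, of 2] kappa_ge_1 by simp
  have t1: "n * (2 * \<kappa>\<^sup>2) \<le> 2 * \<kappa>\<^sup>2 * Q"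
    using mult_left_mono[OF Q[of 1 0], of "2 * \<kappa>\<^sup>2"] by (simp add: mult_ac)
  have t2: "n * (4 * \<kappa> ^ 3 * n * ((\<kappa> + 1) * \<kappa>)) \<le> 4 * \<kappa> ^ 3 * ((\<kappa> + 1) * \<kappa>) * Q"
    using mult_left_mono[OF Q[of 2 0], of "4 * \<kappa> ^ 3 * ((\<kappa> + 1) * \<kappa>)"] kappa_ge_1
    by (simp add: mult_ac power2_eq_square)
  have t3: "n * (2 * \<kappa>\<^sup>2 * n * (2 * \<kappa>\<^sup>2 * n * r)) \<le> 4 * \<kappa> ^ 4 * Q"
    using mult_left_mono[OF Q[of 3 1], of "4 * \<kappa> ^ 4"] kappa_ge_1
    by (simp add: mult_ac power2_eq_square power3_eq_cube power4_eq_xxxx)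
  have t4: "n * (2 * \<kappa>\<^sup>2 * n * (2 * \<kappa> * r * (A2 * (n * (2 * grad_bound + \<kappa>))))) \<le> 96 * \<kappa> ^ 5 * A2 * Q"
  proof -
    have "n * (2 * \<kappa>\<^sup>2 * n * (2 * \<kappa> * r * (A2 * (n * (2 * grad_bound + \<kappa>)))))
        \<le> n * (2 * \<kappa>\<^sup>2 * n * (2 * \<kappa> * r * (A2 * (n * (3 * grad_bound)))))"
      using k2 n r kappa_ge_1 A2_nonneg by (intro mult_left_mono) auto
    \<comment> \<open>96 = 2 * 2 * 3 * 8, where 3 comes from merging 2 \<open>grad_bound\<close> +
      \<kappa> and 8 from \<open>grad_bound\<close> itself.\<close>
    also have "\<dots> = 96 * \<kappa> ^ 5 * A2 * (n ^ 5 * r ^ 2)"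
      unfolding grad_bound by (simp add: power2_eq_square eval_nat_numeral mult_ac)
    also have "\<dots> \<le> 96 * \<kappa> ^ 5 * A2 * Q"
      using kappa_ge_1 A2_nonneg by (intro mult_left_mono Q) auto
    finally show ?thesis .
  qed
  have t5: "n * (3 / 2 * (A2 * (grad_bound\<^sup>2 + \<kappa> ^ 4 + \<kappa>\<^sup>2))) \<le> 288 * \<kappa> ^ 4 * A2 * Q"
  proof -
    have "n * (3 / 2 * (A2 * (grad_bound\<^sup>2 + \<kappa> ^ 4 + \<kappa>\<^sup>2))) \<le> n * (3 / 2 * (A2 * (3 * grad_bound\<^sup>2)))"
      using B2 k2' n A2_nonneg by (intro mult_left_mono) auto
    \<comment> \<open>288 = 3 / 2 * 3 * 8^2, with three summands each at most
      \<open>grad_bound\<close>^2.\<close>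
    also have "\<dots> = 288 * \<kappa> ^ 4 * A2 * (n ^ 5 * r ^ 2)"
      unfolding grad_bound by (simp add: power2_eq_square eval_nat_numeral mult_ac)
    also have "\<dots> \<le> 288 * \<kappa> ^ 4 * A2 * Q"
      using kappa_ge_1 A2_nonneg by (intro mult_left_mono Q) auto
    finally show ?thesis .
  qed
  have t6: "n * (\<kappa>\<^sup>2 * sqrt A2) \<le> \<kappa>\<^sup>2 * sqrt A2 * Q"
    using mult_left_mono[OF Q[of 1 0], of "\<kappa>\<^sup>2 * sqrt A2"] A2_nonneg by (simp add: mult_ac)
  have "(\<Sum>i\<in>I. expectation (remainder i K)) \<le> (\<Sum>i\<in>I. 2 * \<kappa>\<^sup>2 + 4 * \<kappa> ^ 3 * n * ((\<kappa> + 1) * \<kappa>)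
     + 2 * \<kappa>\<^sup>2 * n * (2 * \<kappa>\<^sup>2 * n * r + 2 * \<kappa> * r * (A2 * (n * (2 * grad_bound + \<kappa>))))
     + 2 * \<kappa>\<^sup>2 * (A3 * real K powr \<tau>)
     + 3 / 2 * (A2 * (grad_bound\<^sup>2 + \<kappa> ^ 4 + \<kappa>\<^sup>2)) + \<kappa>\<^sup>2 * sqrt A2)"
    by (rule sum_mono) (use remainder_mean(2) in \<open>simp add: n_def r_def\<close>)
  also have "\<dots> = n * (2 * \<kappa>\<^sup>2) + n * (4 * \<kappa> ^ 3 * n * ((\<kappa> + 1) * \<kappa>))
     + (n * (2 * \<kappa>\<^sup>2 * n * (2 * \<kappa>\<^sup>2 * n * r)) + n * (2 * \<kappa>\<^sup>2 * n * (2 * \<kappa> * r * (A2 * (n * (2 * grad_bound + \<kappa>))))))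
     + n * (2 * \<kappa>\<^sup>2 * (A3 * real K powr \<tau>))
     + n * (3 / 2 * (A2 * (grad_bound\<^sup>2 + \<kappa> ^ 4 + \<kappa>\<^sup>2))) + n * (\<kappa>\<^sup>2 * sqrt A2)"
    by (simp add: n_def[symmetric] distrib_left)
  also have "\<dots> \<le> 2 * \<kappa>\<^sup>2 * Q + 4 * \<kappa> ^ 3 * ((\<kappa> + 1) * \<kappa>) * Q + (4 * \<kappa> ^ 4 * Q + 96 * \<kappa> ^ 5 * A2 * Q)
     + n * (2 * \<kappa>\<^sup>2 * (A3 * real K powr \<tau>)) + 288 * \<kappa> ^ 4 * A2 * Q + \<kappa>\<^sup>2 * sqrt A2 * Q"
    by (intro add_mono t1 t2 t3 t4 t5 t6 order_refl)
  also have "\<dots> = 2 * \<kappa>\<^sup>2 * A3 * (real N * real K powr \<tau>)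
    + (2 * \<kappa>\<^sup>2 + 4 * \<kappa> ^ 3 * ((\<kappa> + 1) * \<kappa>) + 4 * \<kappa> ^ 4 + 96 * \<kappa> ^ 5 * A2 + 288 * \<kappa> ^ 4 * A2 + \<kappa>\<^sup>2 * sqrt A2) * Q"
    by (simp add: n_def algebra_simps)
  finally show ?thesis .
qed

text \<open>Division by a sum of steps of order K^(1/2 - \<tau>) turns the regularisation term
  K^\<tau> into K^-(1/2 - 2 \<tau>) and the terms bounded in K into K^-(1/2 - \<tau>).\<close>

lemma expected_gap_le:
  assumes K: "1 \<le> K"
  shows "expected_gap g K \<le> gap_const1 \<tau> \<kappa> * (real N * real K powr (- (1/2 - 2 * \<tau>)))
    + gap_const2 \<tau> \<kappa> * (real N ^ 5 / (\<beta> * (1 - \<beta>)\<^sup>2) * real K powr (- (1/2 - \<tau>)))"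
proof -
  note b = conn_param_bounds
  define S where "S = (\<Sum>k<K. max_step g k)"
  define c where "c = (1 + \<kappa>) powr (1/2 + \<tau>)"
  define R1 where "R1 = 2 * \<kappa>\<^sup>2 * A3"
  define R2 where "R2 = 2 * \<kappa>\<^sup>2 + 4 * \<kappa> ^ 3 * ((\<kappa> + 1) * \<kappa>) + 4 * \<kappa> ^ 4 + 96 * \<kappa> ^ 5 * A2 + 288 * \<kappa> ^ 4 * A2 + \<kappa>\<^sup>2 * sqrt A2"
  have R: "0 \<le> R1" "0 \<le> R2"
    unfolding R1_def R2_def reg_const_def using kappa_ge_1 A2_nonneg tau by auto
  have c: "0 < c" using kappa_ge_1 by (simp add: c_def)
  have S: "0 < S" unfolding S_def by (rule sum_max_step_pos[OF K])
  have "expected_gap g K \<le> expectation (\<lambda>\<omega>. (\<Sum>i\<in>I. remainder i K \<omega>) / S)"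
    unfolding expected_gap_def S_def
    by (rule integral_mono[OF gap_integrable[OF K]]) (use remainder_mean(1) gap_avg_le K in auto)
  also have "\<dots> = (\<Sum>i\<in>I. expectation (remainder i K)) / S"
    using remainder_mean(1) by simp
  also have "\<dots> \<le> (R1 * (real N * real K powr \<tau>) + R2 * Q) / S"
    unfolding R1_def R2_def by (intro divide_right_mono remainder_total K) (use S in auto)
  also have "\<dots> \<le> (R1 * (real N * real K powr \<tau>) + R2 * Q) / ((1 / c) * real K powr (1/2 - \<tau>))"
  proof (rule divide_left_mono)
    have "1 / c = (1 + \<kappa>) powr (- (1/2 + \<tau>))" unfolding c_def by (simp only: powr_minus inverse_eq_divide)
    then show "1 / c * real K powr (1/2 - \<tau>) \<le> S"
      using sum_max_step_ge[OF K] unfolding S_def by (simp only:)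
  qed (use R c S K in \<open>auto intro!: add_nonneg_nonneg\<close>)
  also have "\<dots> = c * R1 * (real N * (real K powr \<tau> / real K powr (1/2 - \<tau>))) + c * R2 * (Q * (1 / real K powr (1/2 - \<tau>)))"
  proof -
    have "(R1 * (n * t) + R2 * q) / (1 / c * p) = c * R1 * (n * (t / p)) + c * R2 * (q * (1 / p))" for n t q p
      by (simp add: add_divide_distrib distrib_left mult_ac)
    then show ?thesis .
  qed
  also have "real K powr \<tau> / real K powr (1/2 - \<tau>) = real K powr (- (1/2 - 2 * \<tau>))"
    by (simp add: powr_diff[symmetric])
  also have "1 / real K powr (1/2 - \<tau>) = real K powr (- (1/2 - \<tau>))"
    by (simp only: powr_minus inverse_eq_divide)
  also have "c * R1 * (real N * real K powr (- (1/2 - 2 * \<tau>))) + c * R2 * (Q * real K powr (- (1/2 - \<tau>)))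
      \<le> gap_const1 \<tau> \<kappa> * (real N * real K powr (- (1/2 - 2 * \<tau>)))
        + gap_const2 \<tau> \<kappa> * (real N ^ 5 / (\<beta> * (1 - \<beta>)\<^sup>2) * real K powr (- (1/2 - \<tau>)))"
  proof (intro add_mono mult_mono order_refl)
    show "c * R1 \<le> gap_const1 \<tau> \<kappa>" "c * R2 \<le> gap_const2 \<tau> \<kappa>"
      by (simp_all add: gap_const1_def gap_const2_def c_def R1_def R2_def)
    \<comment> \<open>Here the factor 1 / \<beta> >= 1 of the stated rate is introduced.\<close>
    show "Q \<le> real N ^ 5 / (\<beta> * (1 - \<beta>)\<^sup>2)"
      by (rule divide_left_mono) (use b in \<open>auto intro: mult_left_le_one_le\<close>)
  qed (use R c b in \<open>auto simp: gap_const1_def gap_const2_def\<close>)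
  finally show ?thesis .
qed

end

section \<open>Existence of the constants and the corollary\<close>

lemma finite_uniform_bound:
  fixes R :: "'a \<Rightarrow> real \<Rightarrow> bool"
  assumes "finite A" "\<And>a. a \<in> A \<Longrightarrow> \<exists>b. R a b" "\<And>a b b'. R a b \<Longrightarrow> b \<le> b' \<Longrightarrow> R a b'"
  shows "\<exists>b. \<forall>a\<in>A. R a b"
  using assms(1,2)
proof (induction A)
  case (insert a A)
  then obtain b b' where "\<forall>a\<in>A. R a b" "R a b'" by blast
  then have "\<forall>a\<in>insert a A. R a (max b b')" using assms(3) by (metis insert_iff max.cobounded1 max.cobounded2)
  then show ?case by blast
qed simp

lemma compact_norm_bound:
  fixes f :: "'a::topological_space \<Rightarrow> 'b::real_normed_vector"
  assumes "compact S" "continuous_on S f"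
  shows "\<exists>b. \<forall>x\<in>S. norm (f x) \<le> b"
  using compact_imp_bounded[OF compact_continuous_image[OF assms(2,1)]] by (auto simp: bounded_iff)

context agg_play
begin

text \<open>The order of choices matters: b bounds \<open>agg\<close> on the strategy sets, it
  determines a radius c containing all aggregates and estimates, c determines the Lipschitz
  constants of \<open>grad_map\<close>, and only then is \<kappa> taken as a bound for all constants
  of all players.\<close>

lemma constants_exist: "\<exists>\<kappa>. constants_below g \<upsilon> lam \<delta> \<kappa>"
proof -
  have "\<exists>b. \<forall>i\<in>I. \<forall>x\<in>strat g i. norm (agg g i x) \<le> b"
    by (rule finite_uniform_bound)
      (use compact_norm_bound[OF strat_compact agg_continuous] in \<open>auto intro: order_trans\<close>)
  then obtain b where b: "\<And>i x. i \<in> I \<Longrightarrow> x \<in> strat g i \<Longrightarrow> norm (agg g i x) \<le> b" by blast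
  have b0: "0 \<le> b"
  proof -
    obtain i where i: "i \<in> I" using players_nonempty by blast
    obtain x where "x \<in> strat g i" using strat_nonempty[OF i] by blast
    then show ?thesis using order_trans[OF norm_ge_zero b[OF i]] by blast
  qed
  \<comment> \<open>Aggregate bound plus tracking error; the 1 makes c positive even if b =
    0.\<close>
  define c where "c = real N * b + real N * (6 * real N * b / (1 - \<beta>)) + 1"
  have nn: "0 \<le> real N * (6 * real N * b / (1 - \<beta>))" "0 \<le> real N * b"
    using b0 conn_param_bounds by auto
  have c: "0 < c" using nn by (simp add: c_def)
  have agg_sum: "norm (\<Sum>j\<in>I. agg g j (x j)) \<le> real N * b" if "\<And>j. j \<in> I \<Longrightarrow> x j \<in> strat g j" for x
    using sum_norm_le[of I "\<lambda>j. agg g j (x j)" "\<lambda>_. b"] b that by simp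
  have c1: "norm (aggregate g x) \<le> c" if "x \<in> profiles g" for x
    using agg_sum[of x] that nn by (auto simp: profiles_def aggregate_def c_def PiE_def Pi_def)
  have c2: "norm (real N *\<^sub>R mixed_estimate g i k \<omega>) \<le> c" if "i \<in> I" "\<omega> \<in> space M" for i k \<omega>
  proof -
    have "norm (real N *\<^sub>R mixed_estimate g i k \<omega> - (\<Sum>j\<in>I. agg g j (iterate g j k \<omega>)))
        \<le> real N * (6 * real N * b / (1 - \<beta>))"
      by (rule order_trans[OF mixed_estimate_error[OF that(1)] mult_left_mono[OF disagreement_le[OF b that(2)]]]) auto
    moreover have "norm (\<Sum>j\<in>I. agg g j (iterate g j k \<omega>)) \<le> real N * b"
      by (rule agg_sum) (rule iterate_in_strat[OF _ that(2)])
    ultimately show ?thesis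
      using norm_triangle_sub[of "real N *\<^sub>R mixed_estimate g i k \<omega>" "\<Sum>j\<in>I. agg g j (iterate g j k \<omega>)"]
      unfolding c_def by linarith
  qed
  define R where "R = (\<lambda>i \<kappa>. 0 < \<kappa> \<and>
      (\<forall>x\<in>strat g i. norm x \<le> \<kappa> \<and> norm (agg g i x) \<le> \<kappa> \<and> norm (grad_map g i x 0) \<le> \<kappa>) \<and>
      \<kappa>-lipschitz_on (strat g i) (agg g i) \<and>
      \<upsilon> i \<le> \<kappa> \<and> 1 / \<kappa> \<le> lam i \<and> lam i \<le> \<kappa> \<and> 1 / \<kappa> \<le> \<delta> i \<and> \<delta> i \<le> \<kappa> \<and>
      (\<forall>x\<in>strat g i. \<kappa>-lipschitz_on (Rn (adim g) \<inter> cball 0 c) (grad_map g i x)))"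
  have "\<exists>\<kappa>. \<forall>i\<in>I. R i \<kappa>"
  proof (rule finite_uniform_bound[OF finite_players])
    fix i assume i: "i \<in> I"
    obtain b1 where b1: "\<forall>x\<in>strat g i. norm x \<le> b1"
      using compact_norm_bound[OF strat_compact[OF i], of "\<lambda>x. x"] by auto
    have "continuous_on (strat g i) (\<lambda>x. (\<lambda>(x, z). grad_map g i x z) (x, 0))"
      by (rule continuous_on_compose2[OF grad_map_continuous[OF i]]) (auto intro!: continuous_intros)
    then obtain b2 where b2: "\<forall>x\<in>strat g i. norm (grad_map g i x 0) \<le> b2"
      using compact_norm_bound[OF strat_compact[OF i]] by fastforce
    have "lipschitz_data g" using adm by (simp add: admissible_def)
    then obtain l1 l2 where l1: "l1-lipschitz_on (strat g i) (agg g i)"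
      and l2: "\<forall>x\<in>strat g i. l2-lipschitz_on (Rn (adim g) \<inter> cball 0 c) (grad_map g i x)"
      unfolding lipschitz_data_def using i c by blast
    have pos: "0 < lam i" "0 < \<delta> i"
      using adm i unfolding admissible_def power_steps_def by blast+
    \<comment> \<open>The reciprocals of the shifts are included for the lower bounds 1 / \<kappa>
      on \<open>lam i\<close> and \<open>\<delta> i\<close>.\<close>
    define \<kappa> where "\<kappa> = Max {1, b, b1, b2, l1, l2, \<upsilon> i, lam i, 1 / lam i, \<delta> i, 1 / \<delta> i}"
    have le: "1 \<le> \<kappa>" "b \<le> \<kappa>" "b1 \<le> \<kappa>" "b2 \<le> \<kappa>" "l1 \<le> \<kappa>" "l2 \<le> \<kappa>" "\<upsilon> i \<le> \<kappa>" "lam i \<le> \<kappa>" "\<delta> i \<le> \<kappa>"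
      "1 / lam i \<le> \<kappa>" "1 / \<delta> i \<le> \<kappa>"
      unfolding \<kappa>_def by (rule Max_ge; simp)+
    have "1 / \<kappa> \<le> lam i" "1 / \<kappa> \<le> \<delta> i" using le(1,10,11) pos by (simp_all add: field_simps)
    moreover have "\<forall>x\<in>strat g i. \<kappa>-lipschitz_on (Rn (adim g) \<inter> cball 0 c) (grad_map g i x)"
      using l2 lipschitz_on_le[OF _ le(6)] by blast
    ultimately have "R i \<kappa>"
      unfolding R_def
      using le b1 b2 order_trans[OF b[OF i] le(2)] lipschitz_on_le[OF l1 le(5)]
      by (auto intro: order_trans)
    then show "\<exists>\<kappa>. R i \<kappa>" by blast
  next
    \<comment> \<open>Every clause of \<open>R\<close>, including the lower bounds by 1 / \<kappa>,
      persists when \<kappa> grows.\<close>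
    fix i \<kappa> \<kappa>' :: real and j assume "R j \<kappa>" "\<kappa> \<le> \<kappa>'"
    moreover from this have "1 / \<kappa>' \<le> 1 / \<kappa>" by (intro divide_left_mono) (auto simp: R_def)
    ultimately show "R j \<kappa>'"
      unfolding R_def by (auto intro: order_trans lipschitz_on_le)
  qed
  then obtain \<kappa> where \<kappa>: "\<forall>i\<in>I. R i \<kappa>" by blast
  have "0 < \<kappa>" using \<kappa> players_nonempty by (auto simp: R_def)
  then have "constants_below g \<upsilon> lam \<delta> \<kappa>"
    unfolding constants_below_def using \<kappa> c c1 c2 by (intro conjI exI[of _ c]) (auto simp: R_def)
  then show ?thesis by blast
qed

end

section \<open>Inverting the rate into an iteration count\<close>

lemma powr_neg_le_of_ge:
  fixes a c q K :: real
  assumes "0 < q" "0 < a" "0 < c" "0 < K" "c powr (1 / q) * a powr (1 / q) \<le> K"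
  shows "c * (a * K powr (- q)) \<le> 1"
proof -
  have "(c * a) powr (1 / q) \<le> K" using assms by (simp add: powr_mult)
  then have "((c * a) powr (1 / q)) powr q \<le> K powr q" using assms by (intro powr_mono2) auto
  then have "c * a \<le> K powr q" using assms by (simp add: powr_powr)
  then show ?thesis using assms by (simp add: powr_minus field_simps)
qed

text \<open>Each term gets half of \<epsilon>, whence the doubled constants inside the
  powers.\<close>

lemma two_term_complexity:
  fixes \<epsilon> :: real
  assumes q: "0 < q1" "0 < q2" and c: "0 < c1" "0 < c2" and a: "0 < a1" "0 < a2" and \<epsilon>: "0 < \<epsilon>" and K: "0 < K"
    and le: "max ((2 * c1) powr (1 / q1) * (a1 / \<epsilon>) powr (1 / q1)) ((2 * c2) powr (1 / q2) * (a2 / \<epsilon>) powr (1 / q2)) \<le> K"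
  shows "c1 * (a1 * K powr (- q1)) + c2 * (a2 * K powr (- q2)) \<le> \<epsilon>"
proof -
  have "2 * c1 * (a1 / \<epsilon> * K powr (- q1)) \<le> 1" "2 * c2 * (a2 / \<epsilon> * K powr (- q2)) \<le> 1"
    by (rule powr_neg_le_of_ge; use assms in simp)+
  then show ?thesis using \<epsilon> by (simp add: field_simps)
qed

text \<open>The constants of the rate and of the two-term complexity are quantified before the game
  and depend on \<tau> and the dominating \<kappa> only, so N and \<beta> enter exactly as
  displayed; in the simplified complexity the constant may depend on N and \<beta> as well. The
  first part shows that every admissible game has such a \<kappa>, so the bounds apply to all of
  them. Complexity is stated as a sufficient number of iterations: from that number on the averaged
  iterate is an \<epsilon>-equilibrium.\<close>

theorem corollary1:
  fixes \<tau> :: real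
  assumes "0 < \<tau>" and "\<tau> < 1/4"
  shows
    "(\<forall>(g :: 'w agg_game) wmin P \<upsilon> lam \<delta>. admissible g \<tau> wmin P \<upsilon> lam \<delta> \<longrightarrow>
        conn_param (nplayers g) wmin P \<in> {0<..<1} \<and> (\<exists>\<kappa>. constants_below g \<upsilon> lam \<delta> \<kappa>)) \<and>
     (\<forall>\<kappa>. \<exists>C1>0. \<exists>C2>0. \<forall>(g :: 'w agg_game) wmin P \<upsilon> lam \<delta>.
        admissible g \<tau> wmin P \<upsilon> lam \<delta> \<and> constants_below g \<upsilon> lam \<delta> \<kappa> \<longrightarrow>
        (let N = real (nplayers g); \<beta> = conn_param (nplayers g) wmin P in
         \<forall>K\<ge>1. integrable (pspace g) (\<lambda>\<omega>. gap g (avg_iterate g K \<omega>)) \<and>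
           expected_gap g K
             \<le> C1 * (N * real K powr (- (1/2 - 2 * \<tau>)))
               + C2 * (N ^ 5 / (\<beta> * (1 - \<beta>)\<^sup>2) * real K powr (- (1/2 - \<tau>))))) \<and>
     (\<forall>\<kappa>. \<exists>C1>0. \<exists>C2>0. \<forall>(g :: 'w agg_game) wmin P \<upsilon> lam \<delta>.
        admissible g \<tau> wmin P \<upsilon> lam \<delta> \<and> constants_below g \<upsilon> lam \<delta> \<kappa> \<longrightarrow>
        (let N = real (nplayers g); \<beta> = conn_param (nplayers g) wmin P in
         \<forall>\<epsilon>>0. \<forall>K\<ge>1.
           max (C1 * (N / \<epsilon>) powr (1 / (1/2 - 2 * \<tau>)))
               (C2 * (N ^ 5 / (\<epsilon> * \<beta> * (1 - \<beta>)\<^sup>2)) powr (1 / (1/2 - \<tau>))) \<le> real K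
           \<longrightarrow> eps_equilibrium g \<epsilon> K)) \<and>
     (\<exists>\<epsilon>'>0. 2 + \<epsilon>' = 1 / (1/2 - 2 * \<tau>) \<and>
        (\<forall>\<kappa> N \<beta>. \<exists>C>0. \<forall>(g :: 'w agg_game) wmin P \<upsilon> lam \<delta>.
           admissible g \<tau> wmin P \<upsilon> lam \<delta> \<and> constants_below g \<upsilon> lam \<delta> \<kappa> \<and>
           nplayers g = N \<and> conn_param N wmin P = \<beta> \<longrightarrow>
           (\<forall>\<epsilon>>0. \<forall>K\<ge>1. C * (1 / \<epsilon>) powr (2 + \<epsilon>') \<le> real K \<longrightarrow> eps_equilibrium g \<epsilon> K)))"
proof -
  define q1 q2 where "q1 = 1/2 - 2 * \<tau>" and "q2 = 1/2 - \<tau>"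
  have q: "0 < q1" "q1 < 1/2" "0 < q2" "q1 \<le> q2" using assms by (auto simp: q1_def q2_def)
  have c: "0 < gap_const1 \<tau> \<kappa>" "0 < gap_const2 \<tau> \<kappa>" for \<kappa>
    by (simp_all add: gap_const1_def gap_const2_def)
  have const_game: "agg_const g \<tau> wmin P \<upsilon> lam \<delta> \<kappa>"
    if "admissible g \<tau> wmin P \<upsilon> lam \<delta>" "constants_below g \<upsilon> lam \<delta> \<kappa>"
    for g :: "'w agg_game" and wmin P \<upsilon> lam \<delta> \<kappa>
    using that assms by (simp add: agg_const_def agg_play_def agg_const_axioms_def)
  have bound: "expected_gap g K \<le> gap_const1 \<tau> \<kappa> * (real (nplayers g) * real K powr (- q1))
        + gap_const2 \<tau> \<kappa> * (real (nplayers g) ^ 5 / (conn_param (nplayers g) wmin P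
            * (1 - conn_param (nplayers g) wmin P)\<^sup>2) * real K powr (- q2))"
    if "admissible g \<tau> wmin P \<upsilon> lam \<delta>" "constants_below g \<upsilon> lam \<delta> \<kappa>" "1 \<le> K"
    for g :: "'w agg_game" and wmin P \<upsilon> lam \<delta> \<kappa> K
    unfolding q1_def q2_def by (rule agg_const.expected_gap_le[OF const_game[OF that(1,2)] that(3)])
  have params: "0 < conn_param (nplayers g) wmin P" "conn_param (nplayers g) wmin P < 1" "1 \<le> real (nplayers g)"
    if "admissible g \<tau> wmin P \<upsilon> lam \<delta>" for g :: "'w agg_game" and wmin P \<upsilon> lam \<delta>
  proof -
    interpret agg_play g \<tau> wmin P \<upsilon> lam \<delta> using that by unfold_locales
    show "0 < conn_param (nplayers g) wmin P" "conn_param (nplayers g) wmin P < 1" "1 \<le> real (nplayers g)"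
      using conn_param_bounds some_player by auto
  qed
  have pos5: "0 < real (nplayers g) ^ 5 / (conn_param (nplayers g) wmin P * (1 - conn_param (nplayers g) wmin P)\<^sup>2)"
    if "admissible g \<tau> wmin P \<upsilon> lam \<delta>" for g :: "'w agg_game" and wmin P \<upsilon> lam \<delta>
    using params[OF that] by (intro divide_pos_pos mult_pos_pos) auto
  show ?thesis
    unfolding q1_def[symmetric] q2_def[symmetric]
  proof (intro conjI)
    show "\<forall>(g :: 'w agg_game) wmin P \<upsilon> lam \<delta>. admissible g \<tau> wmin P \<upsilon> lam \<delta> \<longrightarrow>
        conn_param (nplayers g) wmin P \<in> {0<..<1} \<and> (\<exists>\<kappa>. constants_below g \<upsilon> lam \<delta> \<kappa>)"
      using params(1,2) agg_play.constants_exist[OF agg_play.intro] by auto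
  next
    show "\<forall>\<kappa>. \<exists>C1>0. \<exists>C2>0. \<forall>(g :: 'w agg_game) wmin P \<upsilon> lam \<delta>.
        admissible g \<tau> wmin P \<upsilon> lam \<delta> \<and> constants_below g \<upsilon> lam \<delta> \<kappa> \<longrightarrow>
        (let N = real (nplayers g); \<beta> = conn_param (nplayers g) wmin P in
         \<forall>K\<ge>1. integrable (pspace g) (\<lambda>\<omega>. gap g (avg_iterate g K \<omega>)) \<and>
           expected_gap g K \<le> C1 * (N * real K powr (- q1))
               + C2 * (N ^ 5 / (\<beta> * (1 - \<beta>)\<^sup>2) * real K powr (- q2)))"
    proof (intro allI exI conjI impI)
      fix \<kappa> and g :: "'w agg_game" and wmin P \<upsilon> lam \<delta>
      assume H: "admissible g \<tau> wmin P \<upsilon> lam \<delta> \<and> constants_below g \<upsilon> lam \<delta> \<kappa>"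
      show "let N = real (nplayers g); \<beta> = conn_param (nplayers g) wmin P in
         \<forall>K\<ge>1. integrable (pspace g) (\<lambda>\<omega>. gap g (avg_iterate g K \<omega>)) \<and>
           expected_gap g K \<le> gap_const1 \<tau> \<kappa> * (N * real K powr (- q1))
               + gap_const2 \<tau> \<kappa> * (N ^ 5 / (\<beta> * (1 - \<beta>)\<^sup>2) * real K powr (- q2))"
        unfolding Let_def
        using bound[OF conjunct1[OF H] conjunct2[OF H]]
          agg_const.gap_integrable[OF const_game[OF conjunct1[OF H] conjunct2[OF H]]] by blast
    qed (rule c)+
  next
    show "\<forall>\<kappa>. \<exists>C1>0. \<exists>C2>0. \<forall>(g :: 'w agg_game) wmin P \<upsilon> lam \<delta>.
        admissible g \<tau> wmin P \<upsilon> lam \<delta> \<and> constants_below g \<upsilon> lam \<delta> \<kappa> \<longrightarrow>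
        (let N = real (nplayers g); \<beta> = conn_param (nplayers g) wmin P in
         \<forall>\<epsilon>>0. \<forall>K\<ge>1.
           max (C1 * (N / \<epsilon>) powr (1 / q1)) (C2 * (N ^ 5 / (\<epsilon> * \<beta> * (1 - \<beta>)\<^sup>2)) powr (1 / q2)) \<le> real K
           \<longrightarrow> eps_equilibrium g \<epsilon> K)"
    proof (intro allI exI conjI impI)
      fix \<kappa> and g :: "'w agg_game" and wmin P \<upsilon> lam \<delta>
      assume H: "admissible g \<tau> wmin P \<upsilon> lam \<delta> \<and> constants_below g \<upsilon> lam \<delta> \<kappa>"
      show "let N = real (nplayers g); \<beta> = conn_param (nplayers g) wmin P in
         \<forall>\<epsilon>>0. \<forall>K\<ge>1.
           max ((2 * gap_const1 \<tau> \<kappa>) powr (1 / q1) * (N / \<epsilon>) powr (1 / q1))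
             ((2 * gap_const2 \<tau> \<kappa>) powr (1 / q2) * (N ^ 5 / (\<epsilon> * \<beta> * (1 - \<beta>)\<^sup>2)) powr (1 / q2)) \<le> real K
           \<longrightarrow> eps_equilibrium g \<epsilon> K"
        unfolding Let_def
      proof (intro allI impI)
        fix \<epsilon> :: real and K :: nat
        let ?N = "real (nplayers g)" and ?\<beta> = "conn_param (nplayers g) wmin P"
        assume \<epsilon>: "0 < \<epsilon>" and K: "1 \<le> K"
          and le: "max ((2 * gap_const1 \<tau> \<kappa>) powr (1 / q1) * (?N / \<epsilon>) powr (1 / q1))
             ((2 * gap_const2 \<tau> \<kappa>) powr (1 / q2) * (?N ^ 5 / (\<epsilon> * ?\<beta> * (1 - ?\<beta>)\<^sup>2)) powr (1 / q2)) \<le> real K"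
        have "?N ^ 5 / (\<epsilon> * ?\<beta> * (1 - ?\<beta>)\<^sup>2) = ?N ^ 5 / (?\<beta> * (1 - ?\<beta>)\<^sup>2) / \<epsilon>"
          by (simp add: mult_ac)
        with le have "gap_const1 \<tau> \<kappa> * (?N * real K powr (- q1))
            + gap_const2 \<tau> \<kappa> * (?N ^ 5 / (?\<beta> * (1 - ?\<beta>)\<^sup>2) * real K powr (- q2)) \<le> \<epsilon>"
          using params(3)[OF conjunct1[OF H]] pos5[OF conjunct1[OF H]] K
          by (intro two_term_complexity q c \<epsilon>) auto
        with bound[OF conjunct1[OF H] conjunct2[OF H] K] show "eps_equilibrium g \<epsilon> K"
          unfolding eps_equilibrium_def by (rule order_trans)
      qed
    qed (simp_all add: less_imp_neq[OF c(1), symmetric] less_imp_neq[OF c(2), symmetric])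
  next
    show "\<exists>\<epsilon>'>0. 2 + \<epsilon>' = 1 / q1 \<and>
        (\<forall>\<kappa> N \<beta>. \<exists>C>0. \<forall>(g :: 'w agg_game) wmin P \<upsilon> lam \<delta>.
           admissible g \<tau> wmin P \<upsilon> lam \<delta> \<and> constants_below g \<upsilon> lam \<delta> \<kappa> \<and>
           nplayers g = N \<and> conn_param N wmin P = \<beta> \<longrightarrow>
           (\<forall>\<epsilon>>0. \<forall>K\<ge>1. C * (1 / \<epsilon>) powr (2 + \<epsilon>') \<le> real K \<longrightarrow> eps_equilibrium g \<epsilon> K))"
    \<comment> \<open>The excess over 2 is positive because q1 < 1 / 2, and it tends to 0 with
      \<tau>.\<close>
    proof (rule exI[of _ "1 / q1 - 2"], intro conjI allI)
      show "0 < 1 / q1 - 2" using q by (simp add: field_simps)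
      show "2 + (1 / q1 - 2) = 1 / q1" by simp
      fix \<kappa> \<beta> :: real and N :: nat
      \<comment> \<open>N and \<beta> are arbitrary numbers here, not yet those of a game; the
        maximum with 1 keeps A positive in all cases.\<close>
      define A where "A = max 1 (gap_const1 \<tau> \<kappa> * real N + gap_const2 \<tau> \<kappa> * (real N ^ 5 / (\<beta> * (1 - \<beta>)\<^sup>2)))"
      have A: "0 < A" by (simp add: A_def)
      show "\<exists>C>0. \<forall>(g :: 'w agg_game) wmin P \<upsilon> lam \<delta>.
           admissible g \<tau> wmin P \<upsilon> lam \<delta> \<and> constants_below g \<upsilon> lam \<delta> \<kappa> \<and>
           nplayers g = N \<and> conn_param N wmin P = \<beta> \<longrightarrow>
           (\<forall>\<epsilon>>0. \<forall>K\<ge>1. C * (1 / \<epsilon>) powr (2 + (1 / q1 - 2)) \<le> real K \<longrightarrow> eps_equilibrium g \<epsilon> K)"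
      proof (rule exI[of _ "A powr (1 / q1)"], intro conjI allI impI)
        show "0 < A powr (1 / q1)" using A by simp
        fix g :: "'w agg_game" and wmin P \<upsilon> lam \<delta> and \<epsilon> :: real and K :: nat
        assume H: "admissible g \<tau> wmin P \<upsilon> lam \<delta> \<and> constants_below g \<upsilon> lam \<delta> \<kappa> \<and>
           nplayers g = N \<and> conn_param N wmin P = \<beta>"
          and \<epsilon>: "0 < \<epsilon>" and K: "1 \<le> K"
          and le: "A powr (1 / q1) * (1 / \<epsilon>) powr (2 + (1 / q1 - 2)) \<le> real K"
        have H1: "admissible g \<tau> wmin P \<upsilon> lam \<delta>" and H2: "constants_below g \<upsilon> lam \<delta> \<kappa>"
          and H3: "nplayers g = N" "conn_param N wmin P = \<beta>" using H by auto
        have "expected_gap g K \<le> gap_const1 \<tau> \<kappa> * (real N * real K powr (- q1))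
            + gap_const2 \<tau> \<kappa> * (real N ^ 5 / (\<beta> * (1 - \<beta>)\<^sup>2) * real K powr (- q2))"
          using bound[OF H1 H2 K] by (simp only: H3)
        \<comment> \<open>For K >= 1 the slower decay, with exponent q1 <= q2, dominates, so the two
          terms merge.\<close>
        also have "\<dots> \<le> gap_const1 \<tau> \<kappa> * (real N * real K powr (- q1))
            + gap_const2 \<tau> \<kappa> * (real N ^ 5 / (\<beta> * (1 - \<beta>)\<^sup>2) * real K powr (- q1))"
          using pos5[OF H1] H3 K c[of \<kappa>] q by (intro add_left_mono mult_left_mono powr_mono) auto
        also have "\<dots> = (gap_const1 \<tau> \<kappa> * real N + gap_const2 \<tau> \<kappa> * (real N ^ 5 / (\<beta> * (1 - \<beta>)\<^sup>2))) * real K powr (- q1)"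
          by (simp add: distrib_right)
        also have "\<dots> \<le> A * real K powr (- q1)"
          by (intro mult_right_mono) (auto simp: A_def)
        also have "\<dots> \<le> \<epsilon>"
        proof -
          have "A * (1 / \<epsilon> * real K powr (- q1)) \<le> 1"
            by (rule powr_neg_le_of_ge) (use q A \<epsilon> K le in auto)
          then show ?thesis using \<epsilon> by (simp add: field_simps)
        qed
        finally show "eps_equilibrium g \<epsilon> K" unfolding eps_equilibrium_def .
      qed
    qed
  qed
qed

end
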